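(* Let $k$ be an infinite field of characteristic $0$. If $H_1=(L_1,V_1),H_2=(L_2,V_2)\in\Xi$ are automorphically equivalent representations, then the Lie algebras with projection-derivation $\mathcal{F}(H_1)$ and $\mathcal{F}(H_2)$ are automorphically equivalent.
   Context: A representation $(L,V)$: Lie algebra $L$ over $k$, $k$-vector space $V$ which is an $L$-module (action $l\circ v$); homomorphism $(\varphi,\psi)$: Lie homomorphism $\varphi$ and linear $\psi$ with $\varphi(l)\circ\psi(v)=\psi(l\circ v)$. $\Xi$ is the class of all representations. $W(X,Y)=(L(X),A(X)Y)$ is the free representation ($L(X)$ free Lie algebra, $A(X)$ free unital associative algebra, $A(X)Y$ free $A(X)$-module with basis $Y$). With countably infinite $X^0,Y^0$, $\Xi^0$ is the category of $W(X,Y)$, $X\subset X^0,Y\subset Y^0$ finite, with all homomorphisms. A Lie algebra with projection-derivation is a Lie algebra $M$ with a linear $p$ such that $p^2=p$ and $p[m_1,m_2]=[pm_1,m_2]+[m_1,pm_2]$; $\Theta$ is the variety of these (homomorphisms commute with $p$); with a countably infinite $M^0$, $\Theta^0$ is the category of free algebras $F(M)$ of $\Theta$, $M\subset M^0$ finite, with all homomorphisms. $\mathcal{F}(L,V)=(L\oplus V,p_V)$ with bracket $[l_1+v_1,l_2+v_2]=[l_1,l_2]+l_1\circ v_2-l_2\circ v_1$ and $p_V(l+v)=v$. Closed sets: for an algebra $H$ (in $\Xi$ or $\Theta$), a free object $W$ of $\Xi^0$ (resp. $\Theta^0$) and a subset $T$ of $W$ (in $\Xi$ a pair $(T_1,T_2)$,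 $T_1\subseteq L(X)$, $T_2\subseteq A(X)Y$), $T'_H$ is the set of homomorphisms $W\to H$ whose kernel contains $T$ (in $\Xi$: $T_1\subseteq\ker\varphi$, $T_2\subseteq\ker\psi$), $T''_H$ is the intersection of their kernels (componentwise in $\Xi$), $T$ is $H$-closed if $T''_H=T$, and $Cl_H(W)$ is the set of $H$-closed subsets. For objects $W_1,W_2$ and a congruence $T$ of $W_2$, $\beta_{W_1,W_2}(T)$ is the relation on $\mathrm{Hom}(W_1,W_2)$ consisting of pairs of homomorphisms agreeing modulo $T$ on every element (in $\Xi$, sortwise modulo $T_1$ and $T_2$). $H_1,H_2$ are automorphically equivalent if there are an automorphism $\Phi$ of the category ($\Xi^0$, resp. $\Theta^0$) and bijections $\alpha_W:Cl_{H_1}(W)\to Cl_{H_2}(\Phi(W))$ for all objects $W$ such that $\Phi(\beta_{W_1,W_2}(T))=\beta_{\Phi(W_1),\Phi(W_2)}(\alpha_{W_2}(T))$ for all objects $W_1,W_2$ and all $T\in Cl_{H_1}(W_2)$ ($\Phi$ applied componentwise to pairs of morphisms). *)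

theory Defs
  imports "HOL-Library.FuncSet" "HOL-Library.Function_Algebras"
begin

definition vspace :: "'a set \<Rightarrow> 'a \<Rightarrow> ('a \<Rightarrow> 'a \<Rightarrow> 'a) \<Rightarrow> ('k::field \<Rightarrow> 'a \<Rightarrow> 'a) \<Rightarrow> bool" where
  "vspace C z ad sc \<longleftrightarrow>
     z \<in> C \<and> (\<forall>x\<in>C. \<forall>y\<in>C. ad x y \<in> C) \<and> (\<forall>a. \<forall>x\<in>C. sc a x \<in> C) \<and>
     (\<forall>x\<in>C. \<forall>y\<in>C. \<forall>w\<in>C. ad (ad x y) w = ad x (ad y w)) \<and>
     (\<forall>x\<in>C. \<forall>y\<in>C. ad x y = ad y x) \<and>
     (\<forall>x\<in>C. ad x z = x) \<and>
     (\<forall>x\<in>C. ad x (sc (-1) x) = z) \<and>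
     (\<forall>a. \<forall>x\<in>C. \<forall>y\<in>C. sc a (ad x y) = ad (sc a x) (sc a y)) \<and>
     (\<forall>a b. \<forall>x\<in>C. sc (a + b) x = ad (sc a x) (sc b x)) \<and>
     (\<forall>a b. \<forall>x\<in>C. sc (a * b) x = sc a (sc b x)) \<and>
     (\<forall>x\<in>C. sc 1 x = x)"

definition lie_alg :: "'a set \<Rightarrow> 'a \<Rightarrow> ('a \<Rightarrow> 'a \<Rightarrow> 'a) \<Rightarrow> ('k::field \<Rightarrow> 'a \<Rightarrow> 'a)
                        \<Rightarrow> ('a \<Rightarrow> 'a \<Rightarrow> 'a) \<Rightarrow> bool" where
  "lie_alg C z ad sc br \<longleftrightarrow> vspace C z ad sc \<and>
     (\<forall>x\<in>C. \<forall>y\<in>C. br x y \<in> C) \<and>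
     (\<forall>x\<in>C. \<forall>y\<in>C. \<forall>w\<in>C. br (ad x y) w = ad (br x w) (br y w)) \<and>
     (\<forall>x\<in>C. \<forall>y\<in>C. \<forall>w\<in>C. br x (ad y w) = ad (br x y) (br x w)) \<and>
     (\<forall>a. \<forall>x\<in>C. \<forall>y\<in>C. br (sc a x) y = sc a (br x y)) \<and>
     (\<forall>a. \<forall>x\<in>C. \<forall>y\<in>C. br x (sc a y) = sc a (br x y)) \<and>
     (\<forall>x\<in>C. br x x = z) \<and>
     (\<forall>x\<in>C. \<forall>y\<in>C. \<forall>w\<in>C. ad (br x (br y w)) (ad (br y (br w x)) (br w (br x y))) = z)"

record ('k, 'l, 'v) rep =
  Lcar :: "'l set"
  lzero :: 'l
  ladd :: "'l \<Rightarrow> 'l \<Rightarrow> 'l"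
  lsc :: "'k \<Rightarrow> 'l \<Rightarrow> 'l"
  lbr :: "'l \<Rightarrow> 'l \<Rightarrow> 'l"
  Vcar :: "'v set"
  vzero :: 'v
  vadd :: "'v \<Rightarrow> 'v \<Rightarrow> 'v"
  vsc :: "'k \<Rightarrow> 'v \<Rightarrow> 'v"
  ract :: "'l \<Rightarrow> 'v \<Rightarrow> 'v"

definition is_rep :: "('k::field, 'l, 'v) rep \<Rightarrow> bool" where
  "is_rep R \<longleftrightarrow>
     lie_alg (Lcar R) (lzero R) (ladd R) (lsc R) (lbr R) \<and>
     vspace (Vcar R) (vzero R) (vadd R) (vsc R) \<and>
     (\<forall>l\<in>Lcar R. \<forall>v\<in>Vcar R. ract R l v \<in> Vcar R) \<and>
     (\<forall>l1\<in>Lcar R. \<forall>l2\<in>Lcar R. \<forall>v\<in>Vcar R.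
        ract R (ladd R l1 l2) v = vadd R (ract R l1 v) (ract R l2 v)) \<and>
     (\<forall>a. \<forall>l\<in>Lcar R. \<forall>v\<in>Vcar R. ract R (lsc R a l) v = vsc R a (ract R l v)) \<and>
     (\<forall>l\<in>Lcar R. \<forall>v\<in>Vcar R. \<forall>w\<in>Vcar R.
        ract R l (vadd R v w) = vadd R (ract R l v) (ract R l w)) \<and>
     (\<forall>a. \<forall>l\<in>Lcar R. \<forall>v\<in>Vcar R. ract R l (vsc R a v) = vsc R a (ract R l v)) \<and>
     (\<forall>l1\<in>Lcar R. \<forall>l2\<in>Lcar R. \<forall>v\<in>Vcar R.
        ract R (lbr R l1 l2) v =
          vadd R (ract R l1 (ract R l2 v)) (vsc R (-1) (ract R l2 (ract R l1 v))))"

text \<open>Homomorphisms of representations; as morphisms they are taken extensional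
  (undefined outside the carriers) so that equality of morphisms is equality on carriers.\<close>

definition rep_hom :: "('k, 'l1, 'v1, 'z1) rep_scheme \<Rightarrow> ('k, 'l2, 'v2, 'z2) rep_scheme
                         \<Rightarrow> ('l1 \<Rightarrow> 'l2) \<times> ('v1 \<Rightarrow> 'v2) \<Rightarrow> bool" where
  "rep_hom R S h \<longleftrightarrow>
     fst h \<in> Lcar R \<rightarrow>\<^sub>E Lcar S \<and> snd h \<in> Vcar R \<rightarrow>\<^sub>E Vcar S \<and>
     (\<forall>x\<in>Lcar R. \<forall>y\<in>Lcar R. fst h (ladd R x y) = ladd S (fst h x) (fst h y)) \<and>
     (\<forall>a. \<forall>x\<in>Lcar R. fst h (lsc R a x) = lsc S a (fst h x)) \<and>
     (\<forall>x\<in>Lcar R. \<forall>y\<in>Lcar R. fst h (lbr R x y) = lbr S (fst h x) (fst h y)) \<and>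
     (\<forall>x\<in>Vcar R. \<forall>y\<in>Vcar R. snd h (vadd R x y) = vadd S (snd h x) (snd h y)) \<and>
     (\<forall>a. \<forall>x\<in>Vcar R. snd h (vsc R a x) = vsc S a (snd h x)) \<and>
     (\<forall>l\<in>Lcar R. \<forall>v\<in>Vcar R. ract S (fst h l) (snd h v) = snd h (ract R l v))"

section \<open>The free representations W(X,Y), X,Y finite subsets of X0 = Y0 = nat\<close>

text \<open>Free unital associative algebra A(X^0): noncommutative polynomials, i.e. finitely
  supported functions on words.\<close>

type_synonym 'k nca = "nat list \<Rightarrow> 'k"
type_synonym 'k ncm = "nat list \<times> nat \<Rightarrow> 'k"

definition nca_mul :: "'k::field nca \<Rightarrow> 'k nca \<Rightarrow> 'k nca" where
  "nca_mul f g = (\<lambda>w. \<Sum>i\<in>{0..length w}. f (take i w) * g (drop i w))"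

definition nca_gen :: "nat \<Rightarrow> 'k::field nca" where
  "nca_gen x = (\<lambda>w. if w = [x] then 1 else 0)"

definition nca_comm :: "'k::field nca \<Rightarrow> 'k nca \<Rightarrow> 'k nca" where
  "nca_comm f g = nca_mul f g - nca_mul g f"

definition nca_sc :: "'k::field \<Rightarrow> ('b \<Rightarrow> 'k) \<Rightarrow> ('b \<Rightarrow> 'k)" where
  "nca_sc a f = (\<lambda>w. a * f w)"

definition Aalg :: "nat set \<Rightarrow> 'k::field nca set" where
  "Aalg X = {f. finite {w. f w \<noteq> 0} \<and> (\<forall>w. f w \<noteq> 0 \<longrightarrow> set w \<subseteq> X)}"

text \<open>The free Lie algebra L(X), realized as the Lie subalgebra of A(X) (with the
  commutator bracket) generated by X.\<close>
inductive_set lie_gen :: "nat set \<Rightarrow> 'k::field nca set" for X :: "nat set" where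
  gen: "x \<in> X \<Longrightarrow> nca_gen x \<in> lie_gen X"
| zero: "0 \<in> lie_gen X"
| add: "f \<in> lie_gen X \<Longrightarrow> g \<in> lie_gen X \<Longrightarrow> f + g \<in> lie_gen X"
| sc: "f \<in> lie_gen X \<Longrightarrow> nca_sc a f \<in> lie_gen X"
| br: "f \<in> lie_gen X \<Longrightarrow> g \<in> lie_gen X \<Longrightarrow> nca_comm f g \<in> lie_gen X"

text \<open>The free A(X)-module A(X)Y with basis Y.\<close>
definition Fmod :: "nat set \<Rightarrow> nat set \<Rightarrow> 'k::field ncm set" where
  "Fmod X Y = {m. finite {p. m p \<noteq> 0} \<and> (\<forall>w y. m (w, y) \<noteq> 0 \<longrightarrow> set w \<subseteq> X \<and> y \<in> Y)}"

definition nca_act :: "'k::field nca \<Rightarrow> 'k ncm \<Rightarrow> 'k ncm" where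
  "nca_act f m = (\<lambda>(w, y). \<Sum>i\<in>{0..length w}. f (take i w) * m (drop i w, y))"

definition Wrep :: "nat set \<Rightarrow> nat set \<Rightarrow> ('k::field, 'k nca, 'k ncm) rep" where
  "Wrep X Y = \<lparr> Lcar = lie_gen X, lzero = 0, ladd = (+), lsc = nca_sc, lbr = nca_comm,
                Vcar = Fmod X Y, vzero = 0, vadd = (+), vsc = nca_sc, ract = nca_act \<rparr>"

text \<open>A category given by an object set, hom-sets, composition (indexed by the source
  object: comp A g f = g o f) and identities. An automorphism is a functor bijective on
  objects and on every hom-set.\<close>

definition cat_aut :: "'o set \<Rightarrow> ('o \<Rightarrow> 'o \<Rightarrow> 'm set) \<Rightarrow> ('o \<Rightarrow> 'm \<Rightarrow> 'm \<Rightarrow> 'm)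
                       \<Rightarrow> ('o \<Rightarrow> 'm) \<Rightarrow> ('o \<Rightarrow> 'o) \<Rightarrow> ('o \<Rightarrow> 'o \<Rightarrow> 'm \<Rightarrow> 'm) \<Rightarrow> bool" where
  "cat_aut Obj Hom cmp idm \<Phi>o \<Phi>m \<longleftrightarrow>
     bij_betw \<Phi>o Obj Obj \<and>
     (\<forall>A\<in>Obj. \<forall>B\<in>Obj. bij_betw (\<Phi>m A B) (Hom A B) (Hom (\<Phi>o A) (\<Phi>o B))) \<and>
     (\<forall>A\<in>Obj. \<forall>B\<in>Obj. \<forall>C\<in>Obj. \<forall>f\<in>Hom A B. \<forall>g\<in>Hom B C.
        \<Phi>m A C (cmp A g f) = cmp (\<Phi>o A) (\<Phi>m B C g) (\<Phi>m A B f)) \<and>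
     (\<forall>A\<in>Obj. \<Phi>m A A (idm A) = idm (\<Phi>o A))"

definition aut_equiv :: "'o set \<Rightarrow> ('o \<Rightarrow> 'o \<Rightarrow> 'm set) \<Rightarrow> ('o \<Rightarrow> 'm \<Rightarrow> 'm \<Rightarrow> 'm)
        \<Rightarrow> ('o \<Rightarrow> 'm) \<Rightarrow> ('o \<Rightarrow> 't set) \<Rightarrow> ('o \<Rightarrow> 't set)
        \<Rightarrow> ('o \<Rightarrow> 'o \<Rightarrow> 't \<Rightarrow> ('m \<times> 'm) set) \<Rightarrow> bool" where
  "aut_equiv Obj Hom cmp idm Cl1 Cl2 beta \<longleftrightarrow>
     (\<exists>\<Phi>o \<Phi>m \<alpha>. cat_aut Obj Hom cmp idm \<Phi>o \<Phi>m \<and>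
        (\<forall>A\<in>Obj. bij_betw (\<alpha> A) (Cl1 A) (Cl2 (\<Phi>o A))) \<and>
        (\<forall>A\<in>Obj. \<forall>B\<in>Obj. \<forall>T\<in>Cl1 B.
           (\<lambda>(f, g). (\<Phi>m A B f, \<Phi>m A B g)) ` beta A B T = beta (\<Phi>o A) (\<Phi>o B) (\<alpha> B T)))"

type_synonym 'k rmor = "('k nca \<Rightarrow> 'k nca) \<times> ('k ncm \<Rightarrow> 'k ncm)"

definition XiObj :: "(nat set \<times> nat set) set" where
  "XiObj = {(X, Y). finite X \<and> finite Y}"

definition XiHom :: "nat set \<times> nat set \<Rightarrow> nat set \<times> nat set \<Rightarrow> 'k::field rmor set" where
  "XiHom A B = {h. rep_hom (Wrep (fst A) (snd A) :: ('k, 'k nca, 'k ncm) rep)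
                           (Wrep (fst B) (snd B)) h}"

definition XiComp :: "nat set \<times> nat set \<Rightarrow> 'k::field rmor \<Rightarrow> 'k rmor \<Rightarrow> 'k rmor" where
  "XiComp A g f = (compose (lie_gen (fst A)) (fst g) (fst f),
                   compose (Fmod (fst A) (snd A)) (snd g) (snd f))"

definition XiId :: "nat set \<times> nat set \<Rightarrow> 'k::field rmor" where
  "XiId A = (restrict id (lie_gen (fst A)), restrict id (Fmod (fst A) (snd A)))"

definition rep_T' :: "('k::field, 'l, 'v) rep \<Rightarrow> nat set \<times> nat set
                       \<Rightarrow> 'k nca set \<times> 'k ncm set \<Rightarrow> (('k nca \<Rightarrow> 'l) \<times> ('k ncm \<Rightarrow> 'v)) set" where
  "rep_T' H A T = {h. rep_hom (Wrep (fst A) (snd A)) H h \<and>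
                      (\<forall>l\<in>fst T. fst h l = lzero H) \<and> (\<forall>v\<in>snd T. snd h v = vzero H)}"

definition rep_T'' :: "('k::field, 'l, 'v) rep \<Rightarrow> nat set \<times> nat set
                        \<Rightarrow> 'k nca set \<times> 'k ncm set \<Rightarrow> 'k nca set \<times> 'k ncm set" where
  "rep_T'' H A T =
     ({l \<in> lie_gen (fst A). \<forall>h\<in>rep_T' H A T. fst h l = lzero H},
      {v \<in> Fmod (fst A) (snd A). \<forall>h\<in>rep_T' H A T. snd h v = vzero H})"

definition rep_Cl :: "('k::field, 'l, 'v) rep \<Rightarrow> nat set \<times> nat set
                       \<Rightarrow> ('k nca set \<times> 'k ncm set) set" where
  "rep_Cl H A = {T. rep_T'' H A T = T}"

definition rep_beta :: "nat set \<times> nat set \<Rightarrow> nat set \<times> nat set \<Rightarrow> 'k::field nca set \<times> 'k ncm set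
                         \<Rightarrow> ('k rmor \<times> 'k rmor) set" where
  "rep_beta A B T = {(h, h'). h \<in> XiHom A B \<and> h' \<in> XiHom A B \<and>
      (\<forall>l\<in>lie_gen (fst A). fst h l - fst h' l \<in> fst T) \<and>
      (\<forall>v\<in>Fmod (fst A) (snd A). snd h v - snd h' v \<in> snd T)}"

definition rep_aut_equiv :: "('k::field, 'l1, 'v1) rep \<Rightarrow> ('k, 'l2, 'v2) rep \<Rightarrow> bool" where
  "rep_aut_equiv H1 H2 \<longleftrightarrow>
     aut_equiv XiObj XiHom XiComp XiId (rep_Cl H1) (rep_Cl H2) rep_beta"

record ('k, 'm) pdl =
  Mcar :: "'m set"
  mzero :: 'm
  madd :: "'m \<Rightarrow> 'm \<Rightarrow> 'm"
  msc :: "'k \<Rightarrow> 'm \<Rightarrow> 'm"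
  mbr :: "'m \<Rightarrow> 'm \<Rightarrow> 'm"
  mproj :: "'m \<Rightarrow> 'm"

definition is_pdl :: "('k::field, 'm) pdl \<Rightarrow> bool" where
  "is_pdl M \<longleftrightarrow> lie_alg (Mcar M) (mzero M) (madd M) (msc M) (mbr M) \<and>
     (\<forall>x\<in>Mcar M. mproj M x \<in> Mcar M) \<and>
     (\<forall>x\<in>Mcar M. \<forall>y\<in>Mcar M. mproj M (madd M x y) = madd M (mproj M x) (mproj M y)) \<and>
     (\<forall>a. \<forall>x\<in>Mcar M. mproj M (msc M a x) = msc M a (mproj M x)) \<and>
     (\<forall>x\<in>Mcar M. mproj M (mproj M x) = mproj M x) \<and>
     (\<forall>x\<in>Mcar M. \<forall>y\<in>Mcar M.
        mproj M (mbr M x y) = madd M (mbr M (mproj M x) y) (mbr M x (mproj M y)))"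

definition pdl_hom :: "('k, 'm1, 'z1) pdl_scheme \<Rightarrow> ('k, 'm2, 'z2) pdl_scheme \<Rightarrow> ('m1 \<Rightarrow> 'm2) \<Rightarrow> bool" where
  "pdl_hom A B f \<longleftrightarrow> f \<in> Mcar A \<rightarrow>\<^sub>E Mcar B \<and>
     (\<forall>x\<in>Mcar A. \<forall>y\<in>Mcar A. f (madd A x y) = madd B (f x) (f y)) \<and>
     (\<forall>a. \<forall>x\<in>Mcar A. f (msc A a x) = msc B a (f x)) \<and>
     (\<forall>x\<in>Mcar A. \<forall>y\<in>Mcar A. f (mbr A x y) = mbr B (f x) (f y)) \<and>
     (\<forall>x\<in>Mcar A. f (mproj A x) = mproj B (f x))"

definition calF :: "('k::field, 'l, 'v) rep \<Rightarrow> ('k, 'l \<times> 'v) pdl" where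
  "calF R = \<lparr> Mcar = Lcar R \<times> Vcar R,
              mzero = (lzero R, vzero R),
              madd = (\<lambda>(l1, v1) (l2, v2). (ladd R l1 l2, vadd R v1 v2)),
              msc = (\<lambda>a (l, v). (lsc R a l, vsc R a v)),
              mbr = (\<lambda>(l1, v1) (l2, v2). (lbr R l1 l2,
                        vadd R (ract R l1 v2) (vsc R (-1) (ract R l2 v1)))),
              mproj = (\<lambda>(l, v). (lzero R, v)) \<rparr>"

datatype 'k tm = TV nat | TZ | TA "'k tm" "'k tm" | TS 'k "'k tm" | TB "'k tm" "'k tm"
  | TP "'k tm"

fun tvars :: "'k tm \<Rightarrow> nat set" where
  "tvars (TV n) = {n}"
| "tvars TZ = {}"
| "tvars (TA s t) = tvars s \<union> tvars t"
| "tvars (TS a t) = tvars t"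
| "tvars (TB s t) = tvars s \<union> tvars t"
| "tvars (TP t) = tvars t"

inductive teq :: "'k::field tm \<Rightarrow> 'k tm \<Rightarrow> bool" where
  refl: "teq t t"
| sym: "teq s t \<Longrightarrow> teq t s"
| trans: "teq s t \<Longrightarrow> teq t u \<Longrightarrow> teq s u"
| cA: "teq s s' \<Longrightarrow> teq t t' \<Longrightarrow> teq (TA s t) (TA s' t')"
| cS: "teq s s' \<Longrightarrow> teq (TS a s) (TS a s')"
| cB: "teq s s' \<Longrightarrow> teq t t' \<Longrightarrow> teq (TB s t) (TB s' t')"
| cP: "teq s s' \<Longrightarrow> teq (TP s) (TP s')"
| assoc: "teq (TA (TA s t) u) (TA s (TA t u))"
| comm: "teq (TA s t) (TA t s)"
| zero: "teq (TA s TZ) s"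
| neg: "teq (TA s (TS (-1) s)) TZ"
| sdist: "teq (TS a (TA s t)) (TA (TS a s) (TS a t))"
| adist: "teq (TS (a + b) s) (TA (TS a s) (TS b s))"
| smul: "teq (TS (a * b) s) (TS a (TS b s))"
| sone: "teq (TS 1 s) s"
| bAl: "teq (TB (TA s t) u) (TA (TB s u) (TB t u))"
| bAr: "teq (TB s (TA t u)) (TA (TB s t) (TB s u))"
| bSl: "teq (TB (TS a s) t) (TS a (TB s t))"
| bSr: "teq (TB s (TS a t)) (TS a (TB s t))"
| alt: "teq (TB s s) TZ"
| jacobi: "teq (TA (TB s (TB t u)) (TA (TB t (TB u s)) (TB u (TB s t)))) TZ"
| pA: "teq (TP (TA s t)) (TA (TP s) (TP t))"
| pS: "teq (TP (TS a s)) (TS a (TP s))"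
| pP: "teq (TP (TP s)) (TP s)"
| pB: "teq (TP (TB s t)) (TA (TB (TP s) t) (TB s (TP t)))"

definition tcls :: "'k::field tm \<Rightarrow> 'k tm set" where
  "tcls t = {s. teq t s}"

definition trep :: "'k tm set \<Rightarrow> 'k tm" where
  "trep C = (SOME t. t \<in> C)"

definition Fcar :: "nat set \<Rightarrow> 'k::field tm set set" where
  "Fcar M = {tcls t | t. tvars t \<subseteq> M}"

definition Ffree :: "nat set \<Rightarrow> ('k::field, 'k tm set) pdl" where
  "Ffree M = \<lparr> Mcar = Fcar M, mzero = tcls TZ,
               madd = (\<lambda>C D. tcls (TA (trep C) (trep D))),
               msc = (\<lambda>a C. tcls (TS a (trep C))),
               mbr = (\<lambda>C D. tcls (TB (trep C) (trep D))),
               mproj = (\<lambda>C. tcls (TP (trep C))) \<rparr>"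

type_synonym 'k tmor = "'k tm set \<Rightarrow> 'k tm set"

definition ThObj :: "nat set set" where
  "ThObj = {M. finite M}"

definition ThHom :: "nat set \<Rightarrow> nat set \<Rightarrow> 'k::field tmor set" where
  "ThHom M1 M2 = {f. pdl_hom (Ffree M1 :: ('k, 'k tm set) pdl) (Ffree M2) f}"

definition ThComp :: "nat set \<Rightarrow> 'k::field tmor \<Rightarrow> 'k tmor \<Rightarrow> 'k tmor" where
  "ThComp M g f = compose (Fcar M :: 'k tm set set) g f"

definition ThId :: "nat set \<Rightarrow> 'k::field tmor" where
  "ThId M = restrict id (Fcar M)"

definition pdl_T' :: "('k::field, 'm) pdl \<Rightarrow> nat set \<Rightarrow> 'k tm set set \<Rightarrow> ('k tm set \<Rightarrow> 'm) set" where
  "pdl_T' H M T = {f. pdl_hom (Ffree M) H f \<and> (\<forall>t\<in>T. f t = mzero H)}"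

definition pdl_T'' :: "('k::field, 'm) pdl \<Rightarrow> nat set \<Rightarrow> 'k tm set set \<Rightarrow> 'k tm set set" where
  "pdl_T'' H M T = {x \<in> Fcar M. \<forall>f\<in>pdl_T' H M T. f x = mzero H}"

definition pdl_Cl :: "('k::field, 'm) pdl \<Rightarrow> nat set \<Rightarrow> 'k tm set set set" where
  "pdl_Cl H M = {T. pdl_T'' H M T = T}"

definition pdl_beta :: "nat set \<Rightarrow> nat set \<Rightarrow> 'k::field tm set set \<Rightarrow> ('k tmor \<times> 'k tmor) set" where
  "pdl_beta M1 M2 T = {(f, g). f \<in> ThHom M1 M2 \<and> g \<in> ThHom M1 M2 \<and>
      (\<forall>x\<in>Fcar M1. madd (Ffree M2) (f x) (msc (Ffree M2) (-1) (g x)) \<in> T)}"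

definition pdl_aut_equiv :: "('k::field, 'm1) pdl \<Rightarrow> ('k, 'm2) pdl \<Rightarrow> bool" where
  "pdl_aut_equiv H1 H2 \<longleftrightarrow>
     aut_equiv ThObj (ThHom :: nat set \<Rightarrow> nat set \<Rightarrow> 'k tmor set) ThComp ThId
               (pdl_Cl H1) (pdl_Cl H2) pdl_beta"

end

(* The functor calF is an equivalence from representations to Lie algebras with
   projection-derivation: the inverse splits M into the kernel and the image of p, and the image
   of p is an abelian ideal because a bracket of two elements of it is an eigenvector for the
   eigenvalue 2. Hence the free algebra F(M) is calF of the free representation W(X,Y) with
   |X| = |Y| = |M|; homomorphisms, closed sets and the relations beta correspond. That the Lie
   polynomials form a free Lie algebra is proved by the Dynkin-Specht-Wever argument.

   An automorphism Phi of the category of free representations preserves coproducts, and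
   W(X,Y) is a coproduct of |X| copies of W({x},{}) and |Y| copies of W({},{y}). So Phi acts on the
   ranks (|X|,|Y|) by an invertible matrix over the natural numbers, i.e. by the identity or the
   swap, and preserves the diagonal |X| = |Y|. Transporting the restriction of Phi to the
   diagonal along F(M) = calF(W(M,M)) = calF(Phi(W(M,M))) gives an automorphism of the category
   of free algebras that fixes all objects. *)

theory Submission
  imports Defs "HOL.Vector_Spaces"
begin

section \<open>Finitely supported functions\<close>

text \<open>A variable n of F(M) splits as (n - p n) + p n, so it supplies one Lie generator and one
  module generator; this is why the diagonal appears. Homomorphisms commuting with the projections
  are block diagonal, so they are pairs of maps and their kernels are rectangles T1 x T2: a closed
  subset on one side is a pair of subsets on the other. The automorphism may send W(M,M) to an
  object with other generator sets of the same sizes. Each F(M) therefore carries two chosen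
  identifications, one with W(M,M) and one with its image, and morphisms are conjugated from the
  first to the second. Ranks are counted by linear algebra: Hom into an object with a
  one-dimensional Lie algebra and zero module, or the reverse, is a vector space whose dimension is
  one of the two ranks, and the universal property of a coproduct becomes a uniquely solvable linear
  system. These test targets are used only after the image diagram is known to be a coproduct, so
  the automorphism may move them. Characteristic 0 enters through division by word lengths and by
  2.\<close>

definition finsup :: "'b set \<Rightarrow> ('b \<Rightarrow> 'k::field) set" where
  "finsup B = {f. finite {b. f b \<noteq> 0} \<and> {b. f b \<noteq> 0} \<subseteq> B}"

definition delta :: "'b \<Rightarrow> 'b \<Rightarrow> 'k::field" where
  "delta b = (\<lambda>x. if x = b then 1 else 0)"

lemma nca_sc_apply: "nca_sc a f x = a * f x"
  by (simp add: nca_sc_def)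

text \<open>As simp rules these also eta-expand unapplied sums of functions.\<close>

declare plus_fun_apply [simp del] zero_fun_apply [simp del] minus_apply [simp del] uminus_apply [simp del]

lemmas fun_applys = plus_fun_apply zero_fun_apply minus_apply uminus_apply nca_sc_apply

lemma vector_space_nca_sc: "vector_space (nca_sc :: 'k::field \<Rightarrow> ('b \<Rightarrow> 'k) \<Rightarrow> 'b \<Rightarrow> 'k)"
  by unfold_locales (auto simp: fun_eq_iff fun_applys algebra_simps)

interpretation fn: vector_space "nca_sc :: 'k::field \<Rightarrow> ('b \<Rightarrow> 'k) \<Rightarrow> 'b \<Rightarrow> 'k"
  by (rule vector_space_nca_sc)

lemma finsup_zero: "0 \<in> finsup B"
  by (simp add: finsup_def fun_applys)

lemma finsup_delta: "b \<in> B \<Longrightarrow> delta b \<in> finsup B"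
  by (auto simp: finsup_def delta_def)

lemma finsup_add:
  assumes "f \<in> finsup B" "g \<in> finsup B" shows "f + g \<in> finsup B"
proof -
  have "{b. (f + g) b \<noteq> 0} \<subseteq> {b. f b \<noteq> 0} \<union> {b. g b \<noteq> 0}" by (auto simp: fun_applys)
  with assms show ?thesis unfolding finsup_def by (auto intro: finite_subset)
qed

lemma finsup_sc: "f \<in> finsup B \<Longrightarrow> nca_sc a f \<in> finsup B"
  unfolding finsup_def by (auto simp: fun_applys elim: rev_finite_subset)

lemma finsup_diff: 
  assumes "f \<in> finsup B" "g \<in> finsup B" shows "f - g \<in> finsup B"
  using finsup_add[OF assms(1) finsup_sc[OF assms(2), of "-1"]]
  by (simp add: nca_sc_def plus_fun_def fun_diff_def)

lemma finsup_mono: "B \<subseteq> C \<Longrightarrow> finsup B \<subseteq> finsup C"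
  by (auto simp: finsup_def)

text \<open>Support points are peeled off one at a time; multilinear identities are reduced with it
  to single words.\<close>

lemma finsup_induct [consumes 1, case_names zero step]:
  assumes "f \<in> finsup B" and "P 0"
    and step: "\<And>c b f. b \<in> B \<Longrightarrow> f \<in> finsup B \<Longrightarrow> P f \<Longrightarrow> P (nca_sc c (delta b) + f)"
  shows "P f"
proof -
  have "\<And>f. {b. f b \<noteq> 0} = S \<Longrightarrow> S \<subseteq> B \<Longrightarrow> P f" if "finite S" for S
    using that
  proof (induction S rule: finite_induct)
    case empty
    then have "f = 0" by (auto simp: fun_eq_iff fun_applys)
    with \<open>P 0\<close> show ?case by metis
  next
    case (insert b S)
    define g where "g = f(b := 0)"
    have g: "{x. g x \<noteq> 0} = S" using insert unfolding g_def by auto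
    have "g \<in> finsup B" using g insert by (auto simp: finsup_def)
    moreover have "P g" using g insert by auto
    moreover have "f = nca_sc (f b) (delta b) + g"
      by (auto simp: fun_eq_iff fun_applys g_def delta_def)
    ultimately show ?case using step[of b g "f b"] insert by auto
  qed
  with assms(1) show ?thesis by (auto simp: finsup_def)
qed

context vector_space
begin

text \<open>Linear extension of \<open>g\<close> from the basis vectors \<open>delta b\<close>. On
  infinite support the sum is the default 0, so linearity is stated for finitely supported
  arguments.\<close>

definition lext :: "('c \<Rightarrow> 'b) \<Rightarrow> ('c \<Rightarrow> 'a) \<Rightarrow> 'b" where
  "lext g f = (\<Sum>b | f b \<noteq> 0. scale (f b) (g b))"

lemma lext_superset:
  fixes f :: "'c \<Rightarrow> 'a"
  shows "finite S \<Longrightarrow> {b. f b \<noteq> 0} \<subseteq> S \<Longrightarrow> lext g f = (\<Sum>b\<in>S. scale (f b) (g b))"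
  unfolding lext_def by (rule sum.mono_neutral_left) auto

lemma lext_zero [simp]: "lext g 0 = 0"
  by (simp add: lext_def fun_applys)

lemma lext_delta [simp]: "lext g (delta b) = g b"
proof -
  have "lext g (delta b) = (\<Sum>x\<in>{b}. scale (delta b x) (g x))"
    by (rule lext_superset) (auto simp: delta_def)
  then show ?thesis by (simp add: delta_def)
qed

lemma lext_add:
  assumes "f \<in> finsup B" "h \<in> finsup C"
  shows "lext g (f + h) = lext g f + lext g h"
proof -
  let ?S = "{b. f b \<noteq> 0} \<union> {b. h b \<noteq> 0}"
  have fin: "finite ?S" using assms by (auto simp: finsup_def)
  show ?thesis
    by (subst (1 2 3) lext_superset[OF fin]) (auto simp: fun_applys scale_left_distrib sum.distrib)
qed

lemma lext_sc:
  assumes "f \<in> finsup B"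
  shows "lext g (nca_sc a f) = scale a (lext g f)"
proof -
  let ?S = "{b. f b \<noteq> 0}"
  have fin: "finite ?S" using assms by (auto simp: finsup_def)
  show ?thesis
    by (subst (1 2) lext_superset[OF fin]) (auto simp: scale_sum_right fun_applys)
qed

lemma lext_step:
  assumes "f \<in> finsup B"
  shows "lext g (nca_sc c (delta b) + f) = scale c (g b) + lext g f"
  using lext_add[OF finsup_sc[OF finsup_delta[of b UNIV]] assms] lext_sc[OF finsup_delta[of b UNIV]]
  by simp

end

section \<open>The free associative algebra and its free modules\<close>

lemma nca_gen_delta: "nca_gen x = delta [x]"
  by (simp add: nca_gen_def delta_def)

lemma Aalg_finsup: "Aalg X = finsup (lists X)"
  by (auto simp: Aalg_def finsup_def in_lists_conv_set)

lemma Fmod_finsup: "Fmod X Y = finsup (lists X \<times> Y)"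
  by (auto simp: Fmod_def finsup_def in_lists_conv_set)

text \<open>Left quotient by a letter. It turns the convolution over all cuts of a word into a
  recursion on the word, so products can be treated by induction without rearranging double
  sums.\<close>

definition lshift :: "nat \<Rightarrow> 'k::field nca \<Rightarrow> 'k nca" where
  "lshift x f = (\<lambda>w. f (x # w))"

lemma nca_mul_Nil: "nca_mul f g [] = f [] * g []"
  by (simp add: nca_mul_def)

lemma nca_mul_Cons: "nca_mul f g (x # w) = f [] * g (x # w) + nca_mul (lshift x f) g w"
proof -
  have "nca_mul f g (x # w) = (\<Sum>i\<in>insert 0 (Suc ` {0..length w}). f (take i (x # w)) * g (drop i (x # w)))"
    unfolding nca_mul_def image_Suc_atLeastAtMost
    by (intro sum.cong) auto
  also have "\<dots> = f [] * g (x # w) + (\<Sum>i\<in>{0..length w}. f (x # take i w) * g (drop i w))"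
    by (subst sum.insert) (auto simp: sum.reindex simp del: image_Suc_atLeastAtMost)
  finally show ?thesis by (simp add: nca_mul_def lshift_def)
qed

lemma nca_mul_add_left: "nca_mul (f + f') g = nca_mul f g + nca_mul f' g"
  by (auto simp: nca_mul_def fun_eq_iff fun_applys sum.distrib algebra_simps)
lemma nca_mul_add_right: "nca_mul f (g + g') = nca_mul f g + nca_mul f g'"
  by (auto simp: nca_mul_def fun_eq_iff fun_applys sum.distrib algebra_simps)
lemma nca_mul_sc_left: "nca_mul (nca_sc a f) g = nca_sc a (nca_mul f g)"
  by (auto simp: nca_mul_def fun_eq_iff fun_applys sum_distrib_left algebra_simps)
lemma nca_mul_sc_right: "nca_mul f (nca_sc a g) = nca_sc a (nca_mul f g)"
  by (auto simp: nca_mul_def fun_eq_iff fun_applys sum_distrib_left algebra_simps)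
lemma nca_mul_zero: "nca_mul 0 g = 0" "nca_mul f 0 = 0"
  by (auto simp: nca_mul_def fun_eq_iff fun_applys)

lemma nca_mul_assoc: "nca_mul (nca_mul f g) h = nca_mul f (nca_mul g h)"
proof (rule ext)
  fix w show "nca_mul (nca_mul f g) h w = nca_mul f (nca_mul g h) w"
  proof (induction w arbitrary: f g)
    case (Cons x w)
    \<comment> \<open>A twisted product rule: the second summand is again a product, with a shifted
      left factor, which is why the induction generalises over the factors.\<close>
    have "lshift x (nca_mul f g) = nca_sc (f []) (lshift x g) + nca_mul (lshift x f) g"
      by (auto simp: lshift_def nca_mul_Cons fun_eq_iff fun_applys)
    then show ?case
      by (simp add: nca_mul_Cons nca_mul_Nil nca_mul_add_left nca_mul_sc_left Cons fun_applys algebra_simps)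
  qed (simp add: nca_mul_Nil)
qed

lemma nca_mul_delta: "nca_mul (delta u) (delta w) = delta (u @ w)"
proof (rule ext)
  fix v
  have shift: "lshift x (delta (y # u)) = (if x = y then delta u else 0)" for x y :: nat and u
    by (auto simp: lshift_def delta_def fun_eq_iff fun_applys)
  have nil: "lshift x (delta []) = (0 :: nat list \<Rightarrow> 'a)" for x
    by (auto simp: lshift_def delta_def fun_eq_iff fun_applys)
  have "nca_mul (delta u) (delta w) v = (delta (u @ w) v :: 'a)"
  proof (induction v arbitrary: u)
    case Nil then show ?case by (cases u) (auto simp: nca_mul_Nil delta_def)
  next
    case (Cons x v)
    show ?case
    proof (cases u)
      case Nil then show ?thesis by (simp add: nca_mul_Cons nil nca_mul_zero fun_applys) (simp add: delta_def)
    next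
      case (Cons y u')
      then show ?thesis using Cons.IH[of u']
        by (simp add: nca_mul_Cons shift nca_mul_zero fun_applys) (auto simp: delta_def)
    qed
  qed
  then show "nca_mul (delta u) (delta w) v = (delta (u @ w) v :: 'a)" .
qed

text \<open>The module consists of copies of the algebra, one for each \<open>y\<close>, and the
  action is the product in each copy; facts about \<open>nca_mul\<close> carry over.\<close>

lemma nca_act_mul: "nca_act f m (w, y) = nca_mul f (\<lambda>u. m (u, y)) w"
  by (simp add: nca_act_def nca_mul_def)

lemma nca_act_add_left: "nca_act (f + f') m = nca_act f m + nca_act f' m"
  by (auto simp: fun_eq_iff fun_applys nca_act_mul nca_mul_add_left)
lemma nca_act_diff_left: "nca_act (f - f') m = nca_act f m - nca_act f' m"
  by (auto simp: nca_act_def fun_eq_iff fun_applys sum_subtractf algebra_simps)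
lemma nca_act_add_right: "nca_act f (m + m') = nca_act f m + nca_act f m'"
  by (auto simp: nca_act_def fun_eq_iff fun_applys sum.distrib algebra_simps)
lemma nca_act_sc_left: "nca_act (nca_sc a f) m = nca_sc a (nca_act f m)"
  by (auto simp: nca_act_def fun_eq_iff fun_applys sum_distrib_left algebra_simps)
lemma nca_act_sc_right: "nca_act f (nca_sc a m) = nca_sc a (nca_act f m)"
  by (auto simp: nca_act_def fun_eq_iff fun_applys sum_distrib_left algebra_simps)
lemma nca_act_zero: "nca_act 0 m = 0" "nca_act f 0 = 0"
  by (auto simp: nca_act_def fun_eq_iff fun_applys)

lemma nca_act_assoc: "nca_act (nca_mul f g) m = nca_act f (nca_act g m)"
  by (auto simp: fun_eq_iff fun_applys nca_act_mul nca_mul_assoc)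

lemma nca_act_delta: "nca_act (delta u) (delta (w, y)) = delta (u @ w, y)"
proof -
  have "(\<lambda>v. delta (w, y) (v, z)) = (if z = y then delta w else (0 :: nat list \<Rightarrow> 'a))" for z
    by (auto simp: delta_def fun_eq_iff fun_applys)
  then have "nca_act (delta u) (delta (w, y)) (v, z) = (delta (u @ w, y) (v, z) :: 'a)" for v z
    by (auto simp: nca_act_mul nca_mul_delta nca_mul_zero fun_applys) (auto simp: delta_def)
  then show ?thesis by auto
qed

text \<open>The word sets are parameters because words over X give closure of A(X), while words of a
  fixed length give homogeneity in the Dynkin argument.\<close>

lemma finsup_mul:
  assumes "f \<in> finsup B" "g \<in> finsup C" "\<And>u w. u \<in> B \<Longrightarrow> w \<in> C \<Longrightarrow> u @ w \<in> D"
  shows "nca_mul f g \<in> finsup D"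
  using assms(1)
proof (induction f rule: finsup_induct)
  case (step c u f)
  have "nca_mul (delta u) g \<in> finsup D"
    using assms(2)
  proof (induction g rule: finsup_induct)
    case (step d w g)
    then show ?case using assms(3) \<open>u \<in> B\<close>
      by (simp add: nca_mul_add_right nca_mul_sc_right nca_mul_delta finsup_add finsup_sc finsup_delta)
  qed (simp add: nca_mul_zero finsup_zero)
  then show ?case using step by (simp add: nca_mul_add_left nca_mul_sc_left finsup_add finsup_sc)
qed (simp add: nca_mul_zero finsup_zero)

lemma Fmod_act:
  assumes "f \<in> Aalg X" "m \<in> Fmod X Y"
  shows "nca_act f m \<in> Fmod X Y"
  using assms(1) unfolding Aalg_finsup
proof (induction f rule: finsup_induct)
  case (step c u f)
  have "nca_act (delta u) m \<in> Fmod X Y"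
    using assms(2) unfolding Fmod_finsup
  proof (induction m rule: finsup_induct)
    case (step d p m)
    then show ?case using \<open>u \<in> lists X\<close>
      by (cases p) (simp add: nca_act_add_right nca_act_sc_right nca_act_delta finsup_add finsup_sc finsup_delta)
  qed (simp add: nca_act_zero finsup_zero)
  then show ?case using step unfolding Fmod_finsup
    by (simp add: nca_act_add_left nca_act_sc_left finsup_add finsup_sc)
qed (simp add: nca_act_zero finsup_zero Fmod_finsup)

lemma nca_comm_add_left: "nca_comm (f + f') g = nca_comm f g + nca_comm f' g"
  by (simp add: nca_comm_def nca_mul_add_left nca_mul_add_right)
lemma nca_comm_add_right: "nca_comm f (g + g') = nca_comm f g + nca_comm f g'"
  by (simp add: nca_comm_def nca_mul_add_left nca_mul_add_right)
lemma nca_comm_sc_left: "nca_comm (nca_sc a f) g = nca_sc a (nca_comm f g)"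
  by (simp add: nca_comm_def nca_mul_sc_left nca_mul_sc_right fn.scale_right_diff_distrib)
lemma nca_comm_sc_right: "nca_comm f (nca_sc a g) = nca_sc a (nca_comm f g)"
  by (simp add: nca_comm_def nca_mul_sc_left nca_mul_sc_right fn.scale_right_diff_distrib)
lemma nca_comm_zero: "nca_comm 0 g = 0" "nca_comm f 0 = 0"
  by (simp_all add: nca_comm_def nca_mul_zero)
lemma nca_mul_diff_left: "nca_mul (f - f') g = nca_mul f g - nca_mul f' g"
  using nca_mul_add_left[of "f - f'" f' g] by (simp add: algebra_simps)
lemma nca_mul_diff_right: "nca_mul g (f - f') = nca_mul g f - nca_mul g f'"
  using nca_mul_add_right[of g "f - f'" f'] by (simp add: algebra_simps)

lemma nca_jacobi: "nca_comm f (nca_comm g h) + (nca_comm g (nca_comm h f) + nca_comm h (nca_comm f g)) = 0"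
  by (simp add: nca_comm_def nca_mul_diff_left nca_mul_diff_right nca_mul_assoc)

lemma nca_act_comm: "nca_act (nca_comm f g) m = nca_act f (nca_act g m) - nca_act g (nca_act f m)"
  by (simp add: nca_comm_def nca_act_diff_left nca_act_assoc)

lemma lie_gen_Aalg: "f \<in> lie_gen X \<Longrightarrow> f \<in> Aalg X"
proof (induction f rule: lie_gen.induct)
  case (br f g)
  then show ?case unfolding Aalg_finsup nca_comm_def
    by (intro finsup_diff finsup_mul) auto
qed (auto simp: Aalg_finsup finsup_zero finsup_add finsup_sc finsup_delta nca_gen_delta)

section \<open>Freeness of W(X,Y)\<close>

lemma (in vector_space) lext_diff:
  assumes "f \<in> finsup B" "h \<in> finsup C"
  shows "lext g (f - h) = lext g f - lext g h"
proof -
  have "f - h = f + nca_sc (-1) h" by (simp add: fun_eq_iff fun_applys)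
  then show ?thesis
    by (simp only: lext_add[OF assms(1) finsup_sc[OF assms(2)]] lext_sc[OF assms(2)]) simp
qed

text \<open>Letters act by arbitrary linear operators; \<open>aact\<close> is the resulting action
  of noncommutative polynomials. It is used for the brackets with the images of the letters and for
  the action of these images on a module.\<close>

locale word_action = vector_space scale
  for scale :: "'k::field \<Rightarrow> 'b::ab_group_add \<Rightarrow> 'b" (infixr "*s" 75) +
  fixes opr :: "nat \<Rightarrow> 'b \<Rightarrow> 'b"
  assumes opr_add: "opr x (v + w) = opr x v + opr x w"
    and opr_scale: "opr x (c *s v) = c *s opr x v"
begin

abbreviation wact :: "nat list \<Rightarrow> 'b \<Rightarrow> 'b" where "wact \<equiv> foldr opr"

definition aact :: "'k nca \<Rightarrow> 'b \<Rightarrow> 'b" where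
  "aact f v = lext (\<lambda>w. wact w v) f"

lemma wact_add: "wact u (v + w) = wact u v + wact u w"
  by (induction u) (simp_all add: opr_add)

lemma wact_scale: "wact u (c *s v) = c *s wact u v"
  by (induction u) (simp_all add: opr_scale)

lemma aact_zero: "aact 0 v = 0"
  by (simp add: aact_def)

lemma aact_delta: "aact (delta u) v = wact u v"
  by (simp add: aact_def)

lemma aact_add: "f \<in> finsup B \<Longrightarrow> g \<in> finsup C \<Longrightarrow> aact (f + g) v = aact f v + aact g v"
  unfolding aact_def by (rule lext_add)

lemma aact_diff: "f \<in> finsup B \<Longrightarrow> g \<in> finsup C \<Longrightarrow> aact (f - g) v = aact f v - aact g v"
  unfolding aact_def by (rule lext_diff)

lemma aact_sc: "f \<in> finsup B \<Longrightarrow> aact (nca_sc c f) v = c *s aact f v"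
  unfolding aact_def by (rule lext_sc)

lemma aact_step: "f \<in> finsup B \<Longrightarrow> aact (nca_sc c (delta u) + f) v = c *s wact u v + aact f v"
  unfolding aact_def by (rule lext_step)

lemma aact_mul:
  assumes f: "f \<in> finsup B" and g: "g \<in> finsup C"
  shows "aact (nca_mul f g) v = aact f (aact g v)"
  using f
proof (induction f rule: finsup_induct)
  case (step c u f)
  have "aact (nca_mul (delta u) g) v = wact u (aact g v)"
    using g
  proof (induction g rule: finsup_induct)
    case zero
    show ?case using wact_scale[of u 0 0] by (simp add: nca_mul_zero aact_zero)
  next
    case (step d w g)
    have "nca_mul (delta u) g \<in> finsup UNIV"
      by (rule finsup_mul[OF finsup_delta[of u UNIV] step(2)]) auto
    with step show ?case
      by (simp add: nca_mul_add_right nca_mul_sc_right nca_mul_delta aact_step wact_add wact_scale)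
  qed
  moreover have "nca_mul f g \<in> finsup UNIV" "nca_mul (delta u) g \<in> finsup UNIV"
    by (rule finsup_mul[OF step(2) g] finsup_mul[OF finsup_delta[of u UNIV] g]; simp)+
  ultimately show ?case using step
    by (simp add: nca_mul_add_left nca_mul_sc_left aact_add[OF finsup_sc] aact_sc aact_step)
qed (simp add: nca_mul_zero aact_zero)

lemma aact_comm:
  assumes f: "f \<in> finsup B" and g: "g \<in> finsup C"
  shows "aact (nca_comm f g) v = aact f (aact g v) - aact g (aact f v)"
proof -
  have "nca_mul f g \<in> finsup UNIV" "nca_mul g f \<in> finsup UNIV"
    by (rule finsup_mul[OF f g] finsup_mul[OF g f]; simp)+
  then show ?thesis
    by (simp add: nca_comm_def aact_diff aact_mul[OF f g] aact_mul[OF g f])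
qed

end

section \<open>Lie algebras, their modules and the universal property of W(X,Y)\<close>

locale lie_algebra = vector_space scale
  for scale :: "'k::field \<Rightarrow> 'b::ab_group_add \<Rightarrow> 'b" (infixr "*s" 75) +
  fixes br :: "'b \<Rightarrow> 'b \<Rightarrow> 'b"
  assumes br_add_left: "br (x + y) z = br x z + br y z"
    and br_add_right: "br x (y + z) = br x y + br x z"
    and br_scale_left: "br (c *s x) y = c *s br x y"
    and br_scale_right: "br x (c *s y) = c *s br x y"
    and br_self: "br x x = 0"
    and jacobi: "br x (br y z) + (br y (br z x) + br z (br x y)) = 0"
begin

lemma br_anti: "br y x = - br x y"
proof -
  have "br x y + br y x = 0"
    using br_self[of "x + y"] unfolding br_add_left br_add_right
    by (simp add: br_self add.commute)
  then show ?thesis by (simp add: eq_neg_iff_add_eq_0 add.commute)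
qed

lemma br_zero: "br 0 x = 0" "br x 0 = 0"
  using br_scale_left[of 0 0 x] br_scale_right[of x 0 0] by simp_all

lemma br_minus_right: "br x (- y) = - br x y"
  using br_scale_right[of x "-1" y] by simp

text \<open>The Jacobi identity read as: bracketing is an action. It makes the adjoint
  representation a module and extends \<open>L.aact\<close> from letters to Lie monomials.\<close>

lemma br_br: "br (br x y) z = br x (br y z) - br y (br x z)"
  using jacobi[of x y z] br_anti[of z x] br_anti[of "br x y" z]
  by (simp add: br_minus_right algebra_simps)

end

locale lie_module = lie_algebra sl br + V: vector_space sv
  for sl :: "'k::field_char_0 \<Rightarrow> 'l::ab_group_add \<Rightarrow> 'l" and br
    and sv :: "'k \<Rightarrow> 'v::ab_group_add \<Rightarrow> 'v" +
  fixes act :: "'l \<Rightarrow> 'v \<Rightarrow> 'v"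
  assumes act_add_left: "act (x + y) v = act x v + act y v"
    and act_scale_left: "act (sl c x) v = sv c (act x v)"
    and act_add_right: "act x (v + w) = act x v + act x w"
    and act_scale_right: "act x (sv c v) = sv c (act x v)"
    and act_br: "act (br x y) v = act x (act y v) - act y (act x v)"

text \<open>The data of the universal property: images \<open>a\<close> of the Lie generators and
  \<open>b\<close> of the module generators in a representation. \<open>lie_lift\<close> is defined
  on all polynomials but shown to respect brackets on Lie polynomials.\<close>

locale free_lift = lie_module sl br sv act
  for sl :: "'k::field_char_0 \<Rightarrow> 'l::ab_group_add \<Rightarrow> 'l" and br
    and sv :: "'k \<Rightarrow> 'v::ab_group_add \<Rightarrow> 'v" and act +
  fixes a :: "nat \<Rightarrow> 'l" and b :: "nat \<Rightarrow> 'v"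
begin

sublocale L: word_action sl "\<lambda>x. br (a x)"
  by unfold_locales (simp_all add: br_add_right br_scale_right)

sublocale M: word_action sv "\<lambda>x. act (a x)"
  by unfold_locales (simp_all add: act_add_right act_scale_right)

text \<open>The empty word has no bracket; its value 0 also absorbs the weight 1 / 0 that
  \<open>lie_lift\<close> puts on it.\<close>

fun rnest :: "nat list \<Rightarrow> 'l" where
  "rnest [] = 0"
| "rnest [x] = a x"
| "rnest (x # y # w) = br (a x) (rnest (y # w))"

text \<open>The normalisation by the word length makes the right-nested bracketing a left inverse
  of the embedding of Lie polynomials (Dynkin, Specht, Wever); this is where characteristic 0
  enters.\<close>

definition lie_lift :: "'k nca \<Rightarrow> 'l" where
  "lie_lift = lext (\<lambda>w. sl (1 / of_nat (length w)) (rnest w))"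

definition mod_lift :: "'k ncm \<Rightarrow> 'v" where
  "mod_lift = V.lext (\<lambda>(w, y). M.wact w (b y))"

lemma rnest_append: "w \<noteq> [] \<Longrightarrow> rnest (u @ w) = L.wact u (rnest w)"
proof (induction u)
  case (Cons x u)
  obtain y v where "u @ w = y # v" using Cons.prems by (cases "u @ w") auto
  with Cons show ?case by simp
qed simp

text \<open>The nested bracket of a concatenation is the left word acting on the nested right word,
  so only the weights change: from 1 / n in \<open>lie_lift g\<close> to 1 / (m + n) on the product.
  The right factor has positive degree because the empty word is nested to 0.\<close>

lemma lie_lift_mul:
  assumes f: "f \<in> finsup {w. length w = m}" and g: "g \<in> finsup {w. length w = n}" and "n > 0"
  shows "lie_lift (nca_mul f g) = sl (of_nat n / of_nat (m + n)) (L.aact f (lie_lift g))"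
  using f
proof (induction f rule: finsup_induct)
  case (step c u f)
  have "lie_lift (nca_mul (delta u) g) = sl (of_nat n / of_nat (m + n)) (L.wact u (lie_lift g))"
    using g
  proof (induction g rule: finsup_induct)
    case zero
    show ?case using L.wact_scale[of u 0 0] by (simp add: nca_mul_zero lie_lift_def)
  next
    case (step d w g)
    have "nca_mul (delta u) g \<in> finsup UNIV"
      by (rule finsup_mul[OF finsup_delta[of u UNIV] step(2)]) auto
    moreover have "w \<noteq> []" "length w = n" "length u = m"
      using \<open>n > 0\<close> step(1) \<open>u \<in> _\<close> by auto
    ultimately show ?case using step \<open>n > 0\<close>
      by (simp add: nca_mul_add_right nca_mul_sc_right nca_mul_delta lie_lift_def lext_step
          L.wact_add L.wact_scale rnest_append scale_right_distrib)
  qed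
  moreover have "nca_mul f g \<in> finsup UNIV" "nca_mul (delta u) g \<in> finsup UNIV"
    by (rule finsup_mul[OF step(2) g] finsup_mul[OF finsup_delta[of u UNIV] g]; simp)+
  ultimately show ?case using step
    by (simp add: nca_mul_add_left nca_mul_sc_left lie_lift_def lext_add[OF finsup_sc] lext_sc
        L.aact_step scale_right_distrib scale_left_commute)
qed (simp add: nca_mul_zero L.aact_zero lie_lift_def)

text \<open>A Lie monomial, its value in the target and its degree. It is a relation because one
  polynomial may arise from several bracket expressions; that all give the same value follows from
  \<open>lie_lift f = l\<close> below.\<close>

inductive lmon :: "'k nca \<Rightarrow> 'l \<Rightarrow> nat \<Rightarrow> bool" where
  gen: "lmon (nca_gen x) (a x) 1"
| br: "lmon f l m \<Longrightarrow> lmon g l' n \<Longrightarrow> lmon (nca_comm f g) (br l l') (m + n)"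

text \<open>The clauses are proved together: \<open>lie_lift_mul\<close> expresses the lift of a
  product through \<open>L.aact f\<close>, and the adjoint clause identifies this operator with
  bracketing by \<open>l\<close>.\<close>

lemma lmon_props:
  assumes "lmon f l n"
  shows "n > 0" "f \<in> finsup {w. length w = n}" "lie_lift f = l"
    "L.aact f v = br l v" "M.aact f u = act l u"
proof -
  have "n > 0 \<and> f \<in> finsup {w. length w = n} \<and> lie_lift f = l \<and>
    (\<forall>v. L.aact f v = br l v) \<and> (\<forall>u. M.aact f u = act l u)"
    using assms
  proof (induction rule: lmon.induct)
    case (gen x)
    show ?case
      by (simp add: nca_gen_delta finsup_delta lie_lift_def L.aact_delta M.aact_delta)
  next
    case (br f l m g l' n)
    have f: "f \<in> finsup {w. length w = m}" and g: "g \<in> finsup {w. length w = n}"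
      and mn: "m > 0" "n > 0" using br by auto
    have fg: "nca_mul f g \<in> finsup {w. length w = m + n}" "nca_mul g f \<in> finsup {w. length w = m + n}"
      by (rule finsup_mul[OF f g] finsup_mul[OF g f]; simp)+
    have "lie_lift (nca_comm f g) =
        sl (of_nat n / of_nat (m + n)) (br l l') - sl (of_nat m / of_nat (n + m)) (br l' l)"
      using br unfolding nca_comm_def
      by (simp add: lie_lift_def lext_diff[OF fg] lie_lift_mul[OF f g, unfolded lie_lift_def]
        lie_lift_mul[OF g f, unfolded lie_lift_def])
    \<comment> \<open>Antisymmetry turns the difference into a sum whose weights n / (m + n) and m /
      (m + n) add up to 1: the Dynkin-Specht-Wever identity.\<close>
    also have "\<dots> = sl (of_nat n / of_nat (m + n) + of_nat m / of_nat (m + n)) (br l l')"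
      by (subst br_anti) (simp add: scale_left_distrib add.commute)
    also have "of_nat n / of_nat (m + n) + of_nat m / of_nat (m + n) = (1 :: 'k)"
      using mn by (simp add: add_divide_distrib[symmetric] add.commute del: of_nat_add)
         (simp add: of_nat_add[symmetric] del: of_nat_add)
    finally have "lie_lift (nca_comm f g) = br l l'" by simp
    moreover have "nca_comm f g \<in> finsup {w. length w = m + n}"
      using fg by (simp add: nca_comm_def finsup_diff)
    ultimately show ?case using br mn
      by (simp add: L.aact_comm[OF f g] M.aact_comm[OF f g] br_br act_br)
  qed
  then show "n > 0" "f \<in> finsup {w. length w = n}" "lie_lift f = l"
    "L.aact f v = br l v" "M.aact f u = act l u" by auto
qed

text \<open>Linear span of the monomial pairs, hence without degree. It is single-valued because
  \<open>lie_lift\<close> computes the value, and its closure rules become the homomorphism laws of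
  \<open>lie_lift\<close>.\<close>

inductive lrel :: "'k nca \<Rightarrow> 'l \<Rightarrow> bool" where
  mon: "lmon f l n \<Longrightarrow> lrel f l"
| zero: "lrel 0 0"
| add: "lrel f l \<Longrightarrow> lrel g l' \<Longrightarrow> lrel (f + g) (l + l')"
| sc: "lrel f l \<Longrightarrow> lrel (nca_sc c f) (sl c l)"

lemma lrel_props:
  assumes "lrel f l"
  shows "f \<in> finsup UNIV \<and> lie_lift f = l \<and> (\<forall>u. M.aact f u = act l u)"
  using assms
proof (induction rule: lrel.induct)
  case (mon f l n)
  then show ?case using lmon_props[OF mon] finsup_mono[of "{w. length w = n}" UNIV] by auto
next
  case zero
  have "act 0 u = 0" for u using act_scale_left[of 0 0 u] by simp
  then show ?case by (simp add: finsup_zero lie_lift_def M.aact_zero)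
next
  case (add f l g l')
  then show ?case
    by (simp add: finsup_add lie_lift_def lext_add[of f UNIV g UNIV] M.aact_add[of f UNIV g UNIV] act_add_left)
next
  case (sc f l c)
  then show ?case
    by (simp add: finsup_sc lie_lift_def lext_sc[of f UNIV] M.aact_sc[of f UNIV] act_scale_left)
qed

text \<open>Bracketing is built in for monomials only; bilinearity carries it to the span, so that
  every Lie polynomial has a value.\<close>

lemma lrel_br:
  assumes "lrel f l" "lrel g l'" shows "lrel (nca_comm f g) (br l l')"
  using assms(1)
proof (induction rule: lrel.induct)
  case (mon f l n)
  show ?case using assms(2)
  proof (induction rule: lrel.induct)
    case (mon g l' m)
    then show ?case using \<open>lmon f l n\<close> by (blast intro: lmon.br lrel.mon)
  qed (auto simp: nca_comm_add_right nca_comm_sc_right nca_comm_zero br_add_right br_scale_right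
      br_zero intro: lrel.zero lrel.add lrel.sc)
qed (auto simp: nca_comm_add_left nca_comm_sc_left nca_comm_zero br_add_left br_scale_left br_zero
      intro: lrel.zero lrel.add lrel.sc)

lemma lie_gen_lrel: "f \<in> lie_gen X \<Longrightarrow> \<exists>l. lrel f l"
proof (induction f rule: lie_gen.induct)
  case (gen x) then show ?case by (blast intro: lrel.mon lmon.gen)
qed (blast intro: lrel.zero lrel.add lrel.sc lrel_br)+

lemma lie_lift_gen: "lie_lift (nca_gen x) = a x"
  by (simp add: lie_lift_def nca_gen_delta)

lemma lie_lift_zero: "lie_lift 0 = 0"
  by (simp add: lie_lift_def)

lemma lie_lift_add: "f \<in> lie_gen X \<Longrightarrow> g \<in> lie_gen X \<Longrightarrow> lie_lift (f + g) = lie_lift f + lie_lift g"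
  by (metis lie_gen_lrel lrel.add lrel_props)

lemma lie_lift_sc: "f \<in> lie_gen X \<Longrightarrow> lie_lift (nca_sc c f) = sl c (lie_lift f)"
  by (metis lie_gen_lrel lrel.sc lrel_props)

lemma lie_lift_br: "f \<in> lie_gen X \<Longrightarrow> g \<in> lie_gen X \<Longrightarrow> lie_lift (nca_comm f g) = br (lie_lift f) (lie_lift g)"
  by (metis lie_gen_lrel lrel_br lrel_props)

lemma mod_lift_gen: "mod_lift (delta ([], y)) = b y"
  by (simp add: mod_lift_def)

lemma mod_lift_zero: "mod_lift 0 = 0"
  by (simp add: mod_lift_def)

lemma mod_lift_add: "m \<in> Fmod X Y \<Longrightarrow> n \<in> Fmod X Y \<Longrightarrow> mod_lift (m + n) = mod_lift m + mod_lift n"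
  unfolding mod_lift_def Fmod_finsup by (rule V.lext_add)

lemma mod_lift_sc: "m \<in> Fmod X Y \<Longrightarrow> mod_lift (nca_sc c m) = sv c (mod_lift m)"
  unfolding mod_lift_def Fmod_finsup by (rule V.lext_sc)

lemma mod_lift_aact:
  assumes "f \<in> Aalg X" "m \<in> Fmod X Y"
  shows "mod_lift (nca_act f m) = M.aact f (mod_lift m)"
  using assms(1) unfolding Aalg_finsup
proof (induction f rule: finsup_induct)
  case zero show ?case by (simp add: nca_act_zero mod_lift_zero M.aact_zero)
next
  case (step c u f)
  have d: "delta u \<in> Aalg X" using step by (simp add: Aalg_finsup finsup_delta)
  have "mod_lift (nca_act (delta u) m) = M.wact u (mod_lift m)"
    using assms(2) unfolding Fmod_finsup
  proof (induction m rule: finsup_induct)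
    case zero
    show ?case using M.wact_scale[of u 0 0] by (simp add: nca_act_zero mod_lift_zero)
  next
    case (step d p m)
    have "nca_act (delta u) m \<in> finsup (lists X \<times> Y)"
      using Fmod_act[OF \<open>delta u \<in> Aalg X\<close>] step by (simp add: Fmod_finsup)
    with step show ?case
      by (cases p) (simp add: nca_act_add_right nca_act_sc_right nca_act_delta mod_lift_def V.lext_step
          M.wact_add M.wact_scale)
  qed
  moreover have "nca_act f m \<in> Fmod X Y" "nca_act (delta u) m \<in> Fmod X Y"
    using Fmod_act[OF _ assms(2)] d step by (auto simp: Aalg_finsup)
  ultimately show ?case using step
    by (simp add: nca_act_add_left nca_act_sc_left mod_lift_def Fmod_finsup
        V.lext_add[OF finsup_sc] V.lext_sc M.aact_step)
qed

text \<open>\<open>mod_lift\<close> intertwines the actions of all polynomials, and for a Lie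
  polynomial the operator \<open>M.aact f\<close> is the action of its lift.\<close>

lemma mod_lift_act:
  assumes "f \<in> lie_gen X" "m \<in> Fmod X Y"
  shows "mod_lift (nca_act f m) = act (lie_lift f) (mod_lift m)"
  using mod_lift_aact[OF lie_gen_Aalg[OF assms(1)] assms(2)] lie_gen_lrel[OF assms(1)] lrel_props
  by metis

end

section \<open>Free Lie algebras with projection-derivation\<close>

text \<open>Words grow by acting with one generator at a time, so A(X)Y arises from Y under the Lie
  action. This fits homomorphisms of representations, which respect the action of Lie polynomials
  only.\<close>

lemma Fmod_induct [consumes 1, case_names zero gen act add sc]:
  fixes m :: "'k::field ncm"
  assumes "m \<in> Fmod X Y" and "P 0" and gen: "\<And>y. y \<in> Y \<Longrightarrow> P (delta ([], y))"
    and act: "\<And>x m. x \<in> X \<Longrightarrow> m \<in> Fmod X Y \<Longrightarrow> P m \<Longrightarrow> P (nca_act (nca_gen x) m)"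
    and add: "\<And>m n. m \<in> Fmod X Y \<Longrightarrow> n \<in> Fmod X Y \<Longrightarrow> P m \<Longrightarrow> P n \<Longrightarrow> P (m + n)"
    and sc: "\<And>c m. m \<in> Fmod X Y \<Longrightarrow> P m \<Longrightarrow> P (nca_sc c m)"
  shows "P m"
  using assms(1) unfolding Fmod_finsup
proof (induction m rule: finsup_induct)
  case (step c p m)
  obtain w y where p: "p = (w, y)" by (cases p)
  have "(delta (w, y) :: 'k ncm) \<in> Fmod X Y \<and> P (delta (w, y))" using step(1) unfolding p
  proof (induction w)
    case (Cons x w)
    then have "P (nca_act (nca_gen x) (delta (w, y)))" by (intro act) auto
    moreover have "(delta (x # w, y) :: 'k ncm) \<in> Fmod X Y" using Cons by (auto simp: Fmod_finsup intro!: finsup_delta)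
    ultimately show ?case by (simp add: nca_gen_delta nca_act_delta)
  qed (auto simp: Fmod_finsup intro!: gen finsup_delta)
  with step show ?case unfolding p by (auto intro!: add sc simp: Fmod_finsup finsup_sc)
qed (rule assms(2))

lemma Fmod_zero: "0 \<in> Fmod X Y"
  by (simp add: Fmod_finsup finsup_zero)
lemma Fmod_gen: "y \<in> Y \<Longrightarrow> delta ([], y) \<in> Fmod X Y"
  by (auto simp: Fmod_finsup intro!: finsup_delta)
lemma Fmod_add: "m \<in> Fmod X Y \<Longrightarrow> n \<in> Fmod X Y \<Longrightarrow> m + n \<in> Fmod X Y"
  by (simp add: Fmod_finsup finsup_add)
lemma Fmod_diff: "m \<in> Fmod X Y \<Longrightarrow> n \<in> Fmod X Y \<Longrightarrow> m - n \<in> Fmod X Y"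
  by (simp add: Fmod_finsup finsup_diff)
lemma Fmod_sc: "m \<in> Fmod X Y \<Longrightarrow> nca_sc c m \<in> Fmod X Y"
  by (simp add: Fmod_finsup finsup_sc)
lemma Fmod_lie_act: "f \<in> lie_gen X \<Longrightarrow> m \<in> Fmod X Y \<Longrightarrow> nca_act f m \<in> Fmod X Y"
  by (simp add: Fmod_act lie_gen_Aalg)

section \<open>The free algebra of the variety as a quotient type\<close>

lemma equivp_teq: "equivp (teq :: 'k::field tm \<Rightarrow> 'k tm \<Rightarrow> bool)"
  by (intro equivpI reflpI sympI transpI) (auto intro: teq.refl teq.sym teq.trans)

\<comment> \<open>All variables are kept at once, so that type class arithmetic and lifting apply;
  \<open>fpd_on M\<close> later cuts out the part generated by \<open>M\<close>.\<close>
quotient_type (overloaded) 'k fpd = "'k::field tm" / teq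
  by (rule equivp_teq)

instantiation fpd :: (field) ab_group_add
begin
lift_definition zero_fpd :: "'a fpd" is TZ .
lift_definition plus_fpd :: "'a fpd \<Rightarrow> 'a fpd \<Rightarrow> 'a fpd" is TA by (rule teq.cA)
lift_definition uminus_fpd :: "'a fpd \<Rightarrow> 'a fpd" is "TS (-1)" by (rule teq.cS)
definition minus_fpd :: "'a fpd \<Rightarrow> 'a fpd \<Rightarrow> 'a fpd" where "minus_fpd x y = x + - y"
instance
proof
  fix x y z :: "'a fpd"
  show "x + y + z = x + (y + z)" by transfer (rule teq.assoc)
  show "x + y = y + x" by transfer (rule teq.comm)
  show "0 + x = x" by transfer (blast intro: teq.comm teq.zero teq.trans)
  show "- x + x = 0" by transfer (blast intro: teq.comm teq.neg teq.trans)
  show "x - y = x + - y" by (rule minus_fpd_def)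
qed
end

lift_definition fsc :: "'k::field \<Rightarrow> 'k fpd \<Rightarrow> 'k fpd" is TS by (rule teq.cS)
lift_definition fbr :: "'k::field fpd \<Rightarrow> 'k fpd \<Rightarrow> 'k fpd" is TB by (rule teq.cB)
lift_definition fp :: "'k::field fpd \<Rightarrow> 'k fpd" is TP by (rule teq.cP)

lemma lie_algebra_fpd: "lie_algebra (fsc :: 'k::field \<Rightarrow> _) fbr"
proof (unfold_locales)
  fix a b :: 'k and x y z :: "'k fpd"
  show "fsc a (x + y) = fsc a x + fsc a y" by transfer (rule teq.sdist)
  show "fsc (a + b) x = fsc a x + fsc b x" by transfer (rule teq.adist)
  show "fsc a (fsc b x) = fsc (a * b) x" by transfer (rule teq.sym[OF teq.smul])
  show "fsc 1 x = x" by transfer (rule teq.sone)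
  show "fbr (x + y) z = fbr x z + fbr y z" by transfer (rule teq.bAl)
  show "fbr x (y + z) = fbr x y + fbr x z" by transfer (rule teq.bAr)
  show "fbr (fsc a x) y = fsc a (fbr x y)" by transfer (rule teq.bSl)
  show "fbr x (fsc a y) = fsc a (fbr x y)" by transfer (rule teq.bSr)
  show "fbr x x = 0" by transfer (rule teq.alt)
  show "fbr x (fbr y z) + (fbr y (fbr z x) + fbr z (fbr x y)) = 0" by transfer (rule teq.jacobi)
qed

interpretation fpd: lie_algebra "fsc :: 'k::field \<Rightarrow> _" fbr
  by (rule lie_algebra_fpd)

text \<open>Target for the lift of a free representation into F(M): both sorts go into the same
  algebra, which acts on itself by the bracket.\<close>

lemma lie_module_fpd: "lie_module (fsc :: 'k::field_char_0 \<Rightarrow> _) fbr fsc fbr"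
  by unfold_locales (simp_all add: fpd.br_add_left fpd.br_add_right fpd.br_scale_left
      fpd.br_scale_right fpd.br_br)

lemma fp_add: "fp (x + y) = fp x + fp y" by transfer (rule teq.pA)
lemma fp_sc: "fp (fsc c x) = fsc c (fp x)" by transfer (rule teq.pS)
lemma fp_fp: "fp (fp x) = fp x" by transfer (rule teq.pP)
lemma fp_br: "fp (fbr x y) = fbr (fp x) y + fbr x (fp y)" by transfer (rule teq.pB)
lemma fp_zero: "fp 0 = 0" using fp_sc[of 0 0] by simp
lemma fp_diff: "fp (x - y) = fp x - fp y"
  using fp_add[of "x - y" y] by (simp add: eq_diff_eq)

text \<open>The bracket of two eigenvectors for the eigenvalue 1 would be one for 2, which is
  not an eigenvalue of a projection.\<close>

lemma fbr_fp_fp: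
  fixes x y :: "'k::field_char_0 fpd"
  shows "fbr (fp x) (fp y) = 0"
proof -
  define z where "z = fbr (fp x) (fp y)"
  have pz: "fp z = z + z" by (simp add: z_def fp_br fp_fp)
  have "fp (fp z) = fp z" by (rule fp_fp)
  then have "z + z = 0" by (simp add: pz fp_add)
  moreover have "fsc 2 z = z + z" using fpd.scale_left_distrib[of 1 1 z] by simp
  ultimately show ?thesis by (simp add: z_def)
qed

text \<open>Bridge to the carrier of \<open>Ffree\<close>, where an element is a class as a set of
  terms and the operations pick representatives by choice.\<close>

lift_definition eqc :: "'k::field fpd \<Rightarrow> 'k tm set" is tcls
  by (auto simp: tcls_def intro: teq.trans teq.sym)

lemma eqc_abs: "tcls t = eqc (abs_fpd t)"
  by (simp add: eqc.abs_eq)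

lemma trep_tcls: "teq t (trep (tcls t))"
  unfolding trep_def by (rule someI2[of _ t]) (auto simp: tcls_def teq.refl)

lemma abs_trep: "abs_fpd (trep (eqc x)) = x"
proof (induction x rule: fpd.abs_induct)
  case (1 t)
  show ?case using trep_tcls[of t] by (simp add: eqc.abs_eq fpd.abs_eq_iff teq.sym)
qed

definition fpd_on :: "nat set \<Rightarrow> 'k::field fpd set" where
  "fpd_on M = abs_fpd ` {t. tvars t \<subseteq> M}"

lemma Fcar_eqc: "Fcar M = eqc ` fpd_on M"
  by (auto simp: Fcar_def fpd_on_def eqc_abs)

lemma fpd_on_induct [consumes 1, case_names var zero add sc br proj]:
  assumes "q \<in> fpd_on M"
    and "\<And>n. n \<in> M \<Longrightarrow> P (abs_fpd (TV n))" and "P 0"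
    and "\<And>x y. x \<in> fpd_on M \<Longrightarrow> y \<in> fpd_on M \<Longrightarrow> P x \<Longrightarrow> P y \<Longrightarrow> P (x + y)"
    and "\<And>c x. x \<in> fpd_on M \<Longrightarrow> P x \<Longrightarrow> P (fsc c x)"
    and "\<And>x y. x \<in> fpd_on M \<Longrightarrow> y \<in> fpd_on M \<Longrightarrow> P x \<Longrightarrow> P y \<Longrightarrow> P (fbr x y)"
    and "\<And>x. x \<in> fpd_on M \<Longrightarrow> P x \<Longrightarrow> P (fp x)"
  shows "P q"
proof -
  have "P (abs_fpd t)" if "tvars t \<subseteq> M" for t
    using that
    by (induction t)
      (auto simp: fpd_on_def zero_fpd.abs_eq[symmetric] plus_fpd.abs_eq[symmetric] fsc.abs_eq[symmetric]
        fbr.abs_eq[symmetric] fp.abs_eq[symmetric] intro!: assms(2-))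
  with assms(1) show ?thesis by (auto simp: fpd_on_def)
qed

lemma fpd_on_var: "n \<in> M \<Longrightarrow> abs_fpd (TV n) \<in> fpd_on M"
  by (auto simp: fpd_on_def)
lemma fpd_on_zero: "0 \<in> fpd_on M"
  by (auto simp: fpd_on_def zero_fpd_def intro!: image_eqI[of _ _ TZ])
lemma fpd_on_add: "x \<in> fpd_on M \<Longrightarrow> y \<in> fpd_on M \<Longrightarrow> x + y \<in> fpd_on M"
  by (auto simp: fpd_on_def plus_fpd.abs_eq intro!: imageI)
lemma fpd_on_sc: "x \<in> fpd_on M \<Longrightarrow> fsc c x \<in> fpd_on M"
  by (auto simp: fpd_on_def fsc.abs_eq intro!: imageI)
lemma fpd_on_br: "x \<in> fpd_on M \<Longrightarrow> y \<in> fpd_on M \<Longrightarrow> fbr x y \<in> fpd_on M"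
  by (auto simp: fpd_on_def fbr.abs_eq intro!: imageI)
lemma fpd_on_proj: "x \<in> fpd_on M \<Longrightarrow> fp x \<in> fpd_on M"
  by (auto simp: fpd_on_def fp.abs_eq intro!: imageI)
lemma fpd_on_diff: "x \<in> fpd_on M \<Longrightarrow> y \<in> fpd_on M \<Longrightarrow> x - y \<in> fpd_on M"
  using fpd_on_add[of x M "fsc (-1) y"] fpd_on_sc[of y M "-1"] by simp

lemma Ffree_eqc:
  "Mcar (Ffree M) = eqc ` fpd_on M"
  "mzero (Ffree M) = eqc 0"
  "madd (Ffree M) (eqc x) (eqc y) = eqc (x + y)"
  "msc (Ffree M) c (eqc x) = eqc (fsc c x)"
  "mbr (Ffree M) (eqc x) (eqc y) = eqc (fbr x y)"
  "mproj (Ffree M) (eqc x) = eqc (fp x)"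
  by (simp_all add: Ffree_def Fcar_eqc eqc_abs abs_trep zero_fpd.abs_eq[symmetric]
      plus_fpd.abs_eq[symmetric] fsc.abs_eq[symmetric] fbr.abs_eq[symmetric] fp.abs_eq[symmetric])

section \<open>Evaluation in the semidirect product\<close>

text \<open>\<open>tevL\<close> and \<open>tevV\<close> are the two components of the value of a
  term in a semidirect product, variable \<open>n\<close> having the value (a n, b n). The Lie
  component can be evaluated alone because the module is an ideal.\<close>

primrec tevL :: "(nat \<Rightarrow> 'k::field nca) \<Rightarrow> 'k tm \<Rightarrow> 'k nca" where
  "tevL a (TV n) = a n"
| "tevL a TZ = 0"
| "tevL a (TA s t) = tevL a s + tevL a t"
| "tevL a (TS c t) = nca_sc c (tevL a t)"
| "tevL a (TB s t) = nca_comm (tevL a s) (tevL a t)"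
| "tevL a (TP t) = 0"

primrec tevV :: "(nat \<Rightarrow> 'k::field nca) \<Rightarrow> (nat \<Rightarrow> 'k ncm) \<Rightarrow> 'k tm \<Rightarrow> 'k ncm" where
  "tevV a b (TV n) = b n"
| "tevV a b TZ = 0"
| "tevV a b (TA s t) = tevV a b s + tevV a b t"
| "tevV a b (TS c t) = nca_sc c (tevV a b t)"
| "tevV a b (TB s t) = nca_act (tevL a s) (tevV a b t) - nca_act (tevL a t) (tevV a b s)"
| "tevV a b (TP t) = tevV a b t"

lemma nca_act_diff_right: "nca_act f (m - m') = nca_act f m - nca_act f m'"
  using nca_act_add_right[of f "m - m'" m'] by (simp add: algebra_simps)

lemma tevL_sound: "teq s t \<Longrightarrow> tevL a s = tevL a t"
  by (induction rule: teq.induct)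
    (auto simp: fn.scale_right_distrib fn.scale_left_distrib nca_comm_add_left nca_comm_add_right
      nca_comm_sc_left nca_comm_sc_right nca_comm_zero nca_jacobi, simp_all add: nca_comm_def)

lemma tevV_sound: "teq s t \<Longrightarrow> tevV a b s = tevV a b t"
  by (induction rule: teq.induct)
    (auto simp: tevL_sound fn.scale_right_distrib fn.scale_left_distrib fn.scale_right_diff_distrib
      nca_act_add_left nca_act_add_right nca_act_diff_right
      nca_act_sc_left nca_act_sc_right nca_act_zero nca_act_comm)

lift_definition evL :: "(nat \<Rightarrow> 'k::field nca) \<Rightarrow> 'k fpd \<Rightarrow> 'k nca" is tevL
  by (rule tevL_sound)

lift_definition evV :: "(nat \<Rightarrow> 'k::field nca) \<Rightarrow> (nat \<Rightarrow> 'k ncm) \<Rightarrow> 'k fpd \<Rightarrow> 'k ncm" is tevV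
  by (rule tevV_sound)

lemma evL_simps:
  "evL a (abs_fpd (TV n)) = a n"
  "evL a 0 = 0"
  "evL a (x + y) = evL a x + evL a y"
  "evL a (fsc c x) = nca_sc c (evL a x)"
  "evL a (fbr x y) = nca_comm (evL a x) (evL a y)"
  "evL a (fp x) = 0"
  by (simp add: evL.abs_eq, (transfer, simp)+)

lemma evV_simps:
  "evV a b (abs_fpd (TV n)) = b n"
  "evV a b 0 = 0"
  "evV a b (x + y) = evV a b x + evV a b y"
  "evV a b (fsc c x) = nca_sc c (evV a b x)"
  "evV a b (fbr x y) = nca_act (evL a x) (evV a b y) - nca_act (evL a y) (evV a b x)"
  "evV a b (fp x) = evV a b x"
  by (simp add: evV.abs_eq, (transfer, simp)+)

lemma ev_diff:
  "evL a (x - y) = evL a x - evL a y" "evV a b (x - y) = evV a b x - evV a b y"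
  using evL_simps(3)[of a "x - y" y] evV_simps(3)[of a b "x - y" y] by (simp_all add: eq_diff_eq)

lemma calF_Wrep:
  "Mcar (calF (Wrep X Y)) = lie_gen X \<times> Fmod X Y"
  "mzero (calF (Wrep X Y)) = (0, 0)"
  "madd (calF (Wrep X Y)) (f, m) (g, n) = (f + g, m + n)"
  "msc (calF (Wrep X Y)) c (f, m) = (nca_sc c f, nca_sc c m)"
  "mbr (calF (Wrep X Y)) (f, m) (g, n) = (nca_comm f g, nca_act f n - nca_act g m)"
  "mproj (calF (Wrep X Y)) (f, m) = (0, m)"
  by (simp_all add: calF_def Wrep_def)

definition pdl_iso :: "('k, 'm1, 'z1) pdl_scheme \<Rightarrow> ('k, 'm2, 'z2) pdl_scheme \<Rightarrow> ('m1 \<Rightarrow> 'm2) \<Rightarrow> bool" where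
  "pdl_iso A B f \<longleftrightarrow> pdl_hom A B f \<and> bij_betw f (Mcar A) (Mcar B)"

text \<open>Evaluation in the semidirect product and the free lift into F(M) are mutually inverse.
  Two independent bijections are allowed because the Lie and the module generators may form
  different sets.\<close>

lemma ex_pdl_iso:
  fixes M A B :: "nat set"
  assumes \<sigma>: "bij_betw \<sigma> M A" and \<tau>: "bij_betw \<tau> M B"
  shows "\<exists>\<theta>. pdl_iso (Ffree M :: ('k::field_char_0, _) pdl) (calF (Wrep A B)) \<theta>"
proof -
  define a :: "nat \<Rightarrow> 'k nca" where "a n = nca_gen (\<sigma> n)" for n
  define b :: "nat \<Rightarrow> 'k ncm" where "b n = delta ([], \<tau> n)" for n
  define \<sigma>' where "\<sigma>' = inv_into M \<sigma>"
  define \<tau>' where "\<tau>' = inv_into M \<tau>"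
  \<comment> \<open>The two parts of a variable v are v - p v, which p annihilates as it must a Lie
    element, and p v, which p fixes as it must a module element.\<close>
  define a' :: "nat \<Rightarrow> 'k fpd" where "a' x = abs_fpd (TV (\<sigma>' x)) - fp (abs_fpd (TV (\<sigma>' x)))" for x
  define b' :: "nat \<Rightarrow> 'k fpd" where "b' y = fp (abs_fpd (TV (\<tau>' y)))" for y
  interpret lie_module fsc fbr fsc fbr by (rule lie_module_fpd)
  interpret F: free_lift fsc fbr fsc fbr a' b' by unfold_locales
  have \<sigma>M: "n \<in> M \<Longrightarrow> \<sigma> n \<in> A \<and> \<sigma>' (\<sigma> n) = n" for n
    using \<sigma> by (auto simp: \<sigma>'_def bij_betw_def)
  have \<tau>M: "n \<in> M \<Longrightarrow> \<tau> n \<in> B \<and> \<tau>' (\<tau> n) = n" for n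
    using \<tau> by (auto simp: \<tau>'_def bij_betw_def)
  have \<sigma>A: "x \<in> A \<Longrightarrow> \<sigma>' x \<in> M \<and> \<sigma> (\<sigma>' x) = x" for x
    using \<sigma> by (auto simp: \<sigma>'_def bij_betw_def f_inv_into_f inv_into_into)
  have \<tau>B: "y \<in> B \<Longrightarrow> \<tau>' y \<in> M \<and> \<tau> (\<tau>' y) = y" for y
    using \<tau> by (auto simp: \<tau>'_def bij_betw_def f_inv_into_f inv_into_into)
  note gens = HOL.trans[OF F.lie_lift_gen a'_def] HOL.trans[OF F.mod_lift_gen b'_def]
    HOL.trans[OF evL_simps(1)[of a] a_def] HOL.trans[OF evV_simps(1)[of a b] b_def]
  have ev: "evL a q \<in> lie_gen A \<and> evV a b q \<in> Fmod A B" if "q \<in> fpd_on M" for q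
    using that
  proof (induction q rule: fpd_on_induct)
    case (var n)
    then show ?case using \<sigma>M \<tau>M by (auto simp: gens intro: lie_gen.gen Fmod_gen)
  qed (auto simp: evL_simps evV_simps Fmod_zero Fmod_add Fmod_diff Fmod_sc Fmod_lie_act
      intro: lie_gen.intros)
  \<comment> \<open>The kernel of p is a subalgebra, so p = 0 propagates from the generators; this
    clause is used again when module elements are built by the action.\<close>
  have lie: "fp (F.lie_lift f) = 0 \<and> F.lie_lift f \<in> fpd_on M \<and> evL a (F.lie_lift f) = f \<and>
      evV a b (F.lie_lift f) = 0" if "f \<in> lie_gen A" for f
    using that
  proof (induction f rule: lie_gen.induct)
    case (gen x)
    then show ?case using \<sigma>A[of x]
      by (simp add: gens fp_diff fp_fp ev_diff evL_simps(2-) evV_simps(2-) fpd_on_diff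
          fpd_on_proj fpd_on_var)
  next
    case zero
    then show ?case by (simp add: F.lie_lift_zero fp_zero fpd_on_zero evL_simps evV_simps)
  next
    case (add f g)
    then show ?case
      by (simp add: F.lie_lift_add[of f A g] fp_add fpd_on_add evL_simps evV_simps)
  next
    case (sc f c)
    then show ?case
      by (simp add: F.lie_lift_sc[of f A c] fp_sc fpd_on_sc evL_simps evV_simps)
  next
    case (br f g)
    then show ?case
      by (simp add: F.lie_lift_br[of f A g] fp_br fpd.br_zero fpd_on_br evL_simps evV_simps nca_act_zero)
  qed
  have mod: "fp (F.mod_lift m) = F.mod_lift m \<and> F.mod_lift m \<in> fpd_on M \<and> evL a (F.mod_lift m) = 0 \<and>
      evV a b (F.mod_lift m) = m" if "m \<in> Fmod A B" for m
    using that
  proof (induction m rule: Fmod_induct)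
    case zero
    show ?case by (simp add: F.mod_lift_zero fp_zero fpd_on_zero evL_simps evV_simps)
  next
    case (gen y)
    then show ?case using \<tau>B[of y]
      by (simp add: gens fp_fp evL_simps(2-) evV_simps(2-) fpd_on_proj fpd_on_var)
  next
    case (act x m)
    have "(nca_gen x :: 'k nca) \<in> lie_gen A" using act by (auto intro: lie_gen.gen)
    then show ?case using act lie[of "nca_gen x"]
      by (simp add: F.mod_lift_act[of _ A _ B] fp_br fpd.br_zero fpd_on_br evL_simps evV_simps nca_comm_zero
          nca_act_zero)
  next
    case (add m n)
    then show ?case
      by (simp add: F.mod_lift_add[of m A B n] fp_add fpd_on_add evL_simps evV_simps)
  next
    case (sc c m)
    then show ?case
      by (simp add: F.mod_lift_sc[of m A B c] fp_sc fpd_on_sc evL_simps evV_simps)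
  qed
  have inv: "F.lie_lift (evL a q) + F.mod_lift (evV a b q) = q" if "q \<in> fpd_on M" for q
    using that
  proof (induction q rule: fpd_on_induct)
    case (var n)
    then show ?case using \<sigma>M[of n] \<tau>M[of n]
      by (simp add: gens)
  next
    case zero
    show ?case by (simp add: evL_simps evV_simps F.lie_lift_zero F.mod_lift_zero)
  next
    case (add x y)
    then show ?case using ev
      by (simp add: evL_simps evV_simps F.lie_lift_add[of _ A] F.mod_lift_add[of _ A B] algebra_simps)
  next
    case (sc c x)
    then show ?case using ev
      by (simp add: evL_simps evV_simps F.lie_lift_sc[of _ A] F.mod_lift_sc[of _ A B]
          fpd.scale_right_distrib[symmetric])
  next
    case (br x y)
    define f m g n where defs: "f = evL a x" "m = evV a b x" "g = evL a y" "n = evV a b y"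
    have mem: "f \<in> lie_gen A" "g \<in> lie_gen A" "m \<in> Fmod A B" "n \<in> Fmod A B"
      using ev br by (auto simp: defs)
    \<comment> \<open>This cross term is absent from the bracket of the semidirect product; here it
      vanishes because both factors lie in the image of p.\<close>
    have mm: "fbr (F.mod_lift m) (F.mod_lift n) = 0"
      using mod[OF mem(3)] mod[OF mem(4)] fbr_fp_fp by metis
    have "F.mod_lift (nca_act f n - nca_act g m) = F.mod_lift (nca_act f n) - F.mod_lift (nca_act g m)"
      using F.mod_lift_add[of "nca_act f n - nca_act g m" A B "nca_act g m"] mem
      by (simp add: Fmod_diff Fmod_lie_act)
    then have "F.lie_lift (evL a (fbr x y)) + F.mod_lift (evV a b (fbr x y)) =
        fbr (F.lie_lift f) (F.lie_lift g) + (fbr (F.lie_lift f) (F.mod_lift n) - fbr (F.lie_lift g) (F.mod_lift m))"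
      using mem by (simp add: evL_simps evV_simps defs[symmetric] F.lie_lift_br[of _ A]
          F.mod_lift_act[of _ A _ B])
    also have "\<dots> = fbr (F.lie_lift f + F.mod_lift m) (F.lie_lift g + F.mod_lift n)"
      using mm fpd.br_anti[of "F.lie_lift g" "F.mod_lift m"]
      by (simp add: fpd.br_add_left fpd.br_add_right algebra_simps)
    finally show ?case using br by (simp add: defs)
  next
    case (proj x)
    have "fp x = fp (F.lie_lift (evL a x) + F.mod_lift (evV a b x))" using proj by simp
    also have "\<dots> = F.mod_lift (evV a b x)" using ev[OF proj(1)] lie mod unfolding fp_add by simp
    finally show ?case unfolding evL_simps evV_simps F.lie_lift_zero by simp
  qed
  define \<theta> where "\<theta> = restrict (\<lambda>C. (evL a (abs_fpd (trep C)), evV a b (abs_fpd (trep C)))) (Fcar M)"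
  have \<theta>: "\<theta> (eqc q) = (evL a q, evV a b q)" if "q \<in> fpd_on M" for q
    using that by (simp add: \<theta>_def Fcar_eqc abs_trep)
  have "bij_betw \<theta> (Fcar M) (lie_gen A \<times> Fmod A B)"
  proof (rule bij_betw_byWitness[where f' = "\<lambda>(f, m). eqc (F.lie_lift f + F.mod_lift m)"])
    show "\<forall>C\<in>Fcar M. (\<lambda>(f, m). eqc (F.lie_lift f + F.mod_lift m)) (\<theta> C) = C"
      by (auto simp: Fcar_eqc \<theta> inv)
    show "\<forall>p\<in>lie_gen A \<times> Fmod A B. \<theta> ((\<lambda>(f, m). eqc (F.lie_lift f + F.mod_lift m)) p) = p"
      using lie mod by (auto simp: \<theta> fpd_on_add evL_simps evV_simps)
    show "\<theta> ` Fcar M \<subseteq> lie_gen A \<times> Fmod A B"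
      using ev by (auto simp: Fcar_eqc \<theta>)
    show "(\<lambda>(f, m). eqc (F.lie_lift f + F.mod_lift m)) ` (lie_gen A \<times> Fmod A B) \<subseteq> Fcar M"
      using lie mod by (auto simp: Fcar_eqc intro!: imageI fpd_on_add)
  qed
  moreover have "pdl_hom (Ffree M) (calF (Wrep A B)) \<theta>"
    unfolding pdl_hom_def
    using ev by (auto simp: Ffree_eqc \<theta> calF_Wrep evL_simps evV_simps fpd_on_add fpd_on_sc fpd_on_br
        fpd_on_proj) (auto simp: \<theta>_def Fcar_eqc)
  ultimately show ?thesis unfolding pdl_iso_def Ffree_eqc(1) calF_Wrep(1)
    by (auto simp: Fcar_eqc)
qed

section \<open>Homomorphisms into semidirect products\<close>

lemma vspace_simps:
  assumes "vspace C z ad sc"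
  shows "z \<in> C" "x \<in> C \<Longrightarrow> y \<in> C \<Longrightarrow> ad x y \<in> C" "x \<in> C \<Longrightarrow> sc a x \<in> C" "x \<in> C \<Longrightarrow> ad x z = x"
    "x \<in> C \<Longrightarrow> ad z x = x" "x \<in> C \<Longrightarrow> sc 0 x = z" "sc a z = z"
proof -
  note v = assms[unfolded vspace_def]
  show z: "z \<in> C" and ad: "x \<in> C \<Longrightarrow> y \<in> C \<Longrightarrow> ad x y \<in> C" and "x \<in> C \<Longrightarrow> sc a x \<in> C"
    and "x \<in> C \<Longrightarrow> ad x z = x" "x \<in> C \<Longrightarrow> ad z x = x" using v by auto
  have sc0: "sc 0 x = z" if "x \<in> C" for x
  proof -
    have "sc (1 + (-1)) x = ad (sc 1 x) (sc (-1) x)" using v that by blast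
    then show ?thesis using v that by simp
  qed
  then show "x \<in> C \<Longrightarrow> sc 0 x = z" .
  have "sc (a * 0) z = sc a (sc 0 z)" using v by blast
  then show "sc a z = z" using sc0[OF z] by simp
qed

lemma is_rep_vspace:
  assumes "is_rep R"
  shows "vspace (Lcar R) (lzero R) (ladd R) (lsc R)" "vspace (Vcar R) (vzero R) (vadd R) (vsc R)"
  using assms by (simp_all add: is_rep_def lie_alg_def)

lemmas rep_simps = vspace_simps[OF is_rep_vspace(1)] vspace_simps[OF is_rep_vspace(2)]

lemma is_repD:
  assumes "is_rep R"
  shows "x \<in> Lcar R \<Longrightarrow> y \<in> Lcar R \<Longrightarrow> lbr R x y \<in> Lcar R"
    "x \<in> Lcar R \<Longrightarrow> v \<in> Vcar R \<Longrightarrow> ract R x v \<in> Vcar R"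
    "x \<in> Lcar R \<Longrightarrow> y \<in> Lcar R \<Longrightarrow> lbr R (lsc R c x) y = lsc R c (lbr R x y)"
    "x \<in> Lcar R \<Longrightarrow> y \<in> Lcar R \<Longrightarrow> lbr R x (lsc R c y) = lsc R c (lbr R x y)"
    "x \<in> Lcar R \<Longrightarrow> v \<in> Vcar R \<Longrightarrow> ract R (lsc R c x) v = vsc R c (ract R x v)"
    "x \<in> Lcar R \<Longrightarrow> v \<in> Vcar R \<Longrightarrow> ract R x (vsc R c v) = vsc R c (ract R x v)"
  using assms by (auto simp: is_rep_def lie_alg_def)

lemmas is_rep_closed = is_repD(1,2)

lemma is_rep_zero:
  assumes R: "is_rep R"
  shows "v \<in> Vcar R \<Longrightarrow> ract R (lzero R) v = vzero R" "x \<in> Lcar R \<Longrightarrow> ract R x (vzero R) = vzero R"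
    "x \<in> Lcar R \<Longrightarrow> lbr R (lzero R) x = lzero R" "x \<in> Lcar R \<Longrightarrow> lbr R x (lzero R) = lzero R"
  using is_repD(3)[OF R, of "lzero R" x 0] is_repD(4)[OF R, of x "lzero R" 0]
    is_repD(5)[OF R, of "lzero R" v 0] is_repD(6)[OF R, of x "vzero R" 0]
    is_rep_closed[OF R] rep_simps[OF R] by auto

lemma rep_homD:
  assumes "rep_hom R S h"
  shows "l \<in> Lcar R \<Longrightarrow> fst h l \<in> Lcar S" "v \<in> Vcar R \<Longrightarrow> snd h v \<in> Vcar S"
    "x \<in> Lcar R \<Longrightarrow> y \<in> Lcar R \<Longrightarrow> fst h (ladd R x y) = ladd S (fst h x) (fst h y)"
    "x \<in> Lcar R \<Longrightarrow> fst h (lsc R a x) = lsc S a (fst h x)"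
    "x \<in> Lcar R \<Longrightarrow> y \<in> Lcar R \<Longrightarrow> fst h (lbr R x y) = lbr S (fst h x) (fst h y)"
    "v \<in> Vcar R \<Longrightarrow> w \<in> Vcar R \<Longrightarrow> snd h (vadd R v w) = vadd S (snd h v) (snd h w)"
    "v \<in> Vcar R \<Longrightarrow> snd h (vsc R a v) = vsc S a (snd h v)"
    "x \<in> Lcar R \<Longrightarrow> v \<in> Vcar R \<Longrightarrow> ract S (fst h x) (snd h v) = snd h (ract R x v)"
  using assms by (auto simp: rep_hom_def)

lemma rep_hom_zero:
  assumes "is_rep R" "is_rep S" "rep_hom R S h"
  shows "fst h (lzero R) = lzero S" "snd h (vzero R) = vzero S"
  using rep_homD(4)[OF assms(3), of "lzero R" 0] rep_homD(7)[OF assms(3), of "vzero R" 0]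
    rep_homD(1,2)[OF assms(3)] rep_simps[OF assms(1)] rep_simps[OF assms(2)] by auto

lemma calF_simps:
  "Mcar (calF R) = Lcar R \<times> Vcar R"
  "mzero (calF R) = (lzero R, vzero R)"
  "madd (calF R) (l, v) (l', v') = (ladd R l l', vadd R v v')"
  "msc (calF R) c (l, v) = (lsc R c l, vsc R c v)"
  "mbr (calF R) (l, v) (l', v') = (lbr R l l', vadd R (ract R l v') (vsc R (-1) (ract R l' v)))"
  "mproj (calF R) (l, v) = (lzero R, v)"
  by (simp_all add: calF_def)

definition hom_pair :: "('k, 'l1, 'v1) rep \<Rightarrow> ('l1 \<Rightarrow> 'l2) \<times> ('v1 \<Rightarrow> 'v2) \<Rightarrow> 'l1 \<times> 'v1 \<Rightarrow> 'l2 \<times> 'v2" where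
  "hom_pair R h = restrict (map_prod (fst h) (snd h)) (Lcar R \<times> Vcar R)"

lemma pdl_hom_hom_pair:
  assumes R: "is_rep R" and S: "is_rep S" and h: "rep_hom R S h"
  shows "pdl_hom (calF R) (calF S) (hom_pair R h)"
  using rep_homD[OF h] rep_hom_zero[OF R S h] rep_simps[OF R] is_rep_closed[OF R]
  unfolding pdl_hom_def hom_pair_def by (auto simp: calF_simps)

lemma pdl_homD:
  assumes "pdl_hom A B f"
  shows "x \<in> Mcar A \<Longrightarrow> f x \<in> Mcar B"
    "x \<in> Mcar A \<Longrightarrow> y \<in> Mcar A \<Longrightarrow> f (madd A x y) = madd B (f x) (f y)"
    "x \<in> Mcar A \<Longrightarrow> f (msc A c x) = msc B c (f x)"
    "x \<in> Mcar A \<Longrightarrow> y \<in> Mcar A \<Longrightarrow> f (mbr A x y) = mbr B (f x) (f y)"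
    "x \<in> Mcar A \<Longrightarrow> f (mproj A x) = mproj B (f x)"
  using assms by (auto simp: pdl_hom_def)

text \<open>\<open>calF\<close> is full: commuting with the projections forces \<open>g\<close> to
  preserve the kernel L x 0 and the image 0 x V of the projection, so there is no off-diagonal
  part.\<close>

lemma pdl_hom_calF_cases:
  assumes R: "is_rep R" and S: "is_rep S" and g: "pdl_hom (calF R) (calF S) g"
  obtains h where "rep_hom R S h" "g = hom_pair R h"
proof -
  note rs = rep_simps[OF R] is_rep_closed[OF R] and ss = rep_simps[OF S] is_rep_closed[OF S]
  note gD = pdl_homD[OF g, unfolded calF_simps(1)]
  define h1 where "h1 = restrict (\<lambda>l. fst (g (l, vzero R))) (Lcar R)"
  define h2 where "h2 = restrict (\<lambda>v. snd (g (lzero R, v))) (Vcar R)"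
  have h1c: "h1 l \<in> Lcar S" if "l \<in> Lcar R" for l
    using gD(1)[of "(l, vzero R)"] that rs by (auto simp: h1_def)
  have h2c: "h2 v \<in> Vcar S" if "v \<in> Vcar R" for v
    using gD(1)[of "(lzero R, v)"] that rs by (auto simp: h2_def)
  obtain z w where zw: "g (lzero R, vzero R) = (z, w)" "z \<in> Lcar S" "w \<in> Vcar S"
    using gD(1)[of "(lzero R, vzero R)"] rs by auto
  have g0: "g (lzero R, vzero R) = (lzero S, vzero S)"
    using gD(3)[of "(lzero R, vzero R)" 0] rs ss zw by (simp add: calF_simps)
  \<comment> \<open>(0, v) is fixed by the projection, hence so is its image.\<close>
  have g2: "g (lzero R, v) = (lzero S, h2 v)" if "v \<in> Vcar R" for v
  proof -
    obtain l' v' where e: "g (lzero R, v) = (l', v')" by fastforce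
    then show ?thesis using gD(5)[of "(lzero R, v)"] that rs by (simp add: calF_simps h2_def)
  qed
  \<comment> \<open>The projection sends (l, 0) to (0, 0), so it annihilates the image of (l,
    0).\<close>
  have g1: "g (l, vzero R) = (h1 l, vzero S)" if "l \<in> Lcar R" for l
  proof -
    obtain l' v' where e: "g (l, vzero R) = (l', v')" by fastforce
    then show ?thesis using gD(5)[of "(l, vzero R)"] that rs g0 by (simp add: calF_simps h1_def)
  qed
  have gp: "g (l, v) = (h1 l, h2 v)" if "l \<in> Lcar R" "v \<in> Vcar R" for l v
    using gD(2)[of "(l, vzero R)" "(lzero R, v)"] that rs ss g1 g2 h1c h2c by (simp add: calF_simps)
  have "rep_hom R S (h1, h2)"
    unfolding rep_hom_def fst_conv snd_conv
  proof (intro conjI ballI allI)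
    show "h1 \<in> Lcar R \<rightarrow>\<^sub>E Lcar S" using h1c by (auto simp: h1_def)
    show "h2 \<in> Vcar R \<rightarrow>\<^sub>E Vcar S" using h2c by (auto simp: h2_def)
  next
    fix x y assume x: "x \<in> Lcar R" and y: "y \<in> Lcar R"
    show "h1 (ladd R x y) = ladd S (h1 x) (h1 y)"
      using gD(2)[of "(x, vzero R)" "(y, vzero R)"] x y rs by (simp add: calF_simps g1)
    show "h1 (lbr R x y) = lbr S (h1 x) (h1 y)"
      using gD(4)[of "(x, vzero R)" "(y, vzero R)"] x y rs is_rep_zero[OF R]
      by (simp add: calF_simps g1)
  next
    fix a x assume "x \<in> Lcar R"
    then show "h1 (lsc R a x) = lsc S a (h1 x)"
      using gD(3)[of "(x, vzero R)" a] rs by (simp add: calF_simps g1)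
  next
    fix v w assume "v \<in> Vcar R" "w \<in> Vcar R"
    then show "h2 (vadd R v w) = vadd S (h2 v) (h2 w)"
      using gD(2)[of "(lzero R, v)" "(lzero R, w)"] rs by (simp add: calF_simps g2)
  next
    fix a v assume "v \<in> Vcar R"
    then show "h2 (vsc R a v) = vsc S a (h2 v)"
      using gD(3)[of "(lzero R, v)" a] rs by (simp add: calF_simps g2)
  next
    fix x v assume x: "x \<in> Lcar R" and v: "v \<in> Vcar R"
    \<comment> \<open>The action is the bracket of (x, 0) with (0, v), so preserving brackets
      contains compatibility with the action.\<close>
    show "ract S (h1 x) (h2 v) = h2 (ract R x v)"
      using gD(4)[of "(x, vzero R)" "(lzero R, v)"] x v rs ss h1c[OF x] h2c[OF v]
        is_rep_zero[OF R] is_rep_zero[OF S]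
      by (simp add: calF_simps g1 g2)
  qed
  moreover have "g = hom_pair R (h1, h2)"
  proof (rule extensionalityI)
    show "g \<in> extensional (Lcar R \<times> Vcar R)" using g by (simp add: pdl_hom_def calF_simps(1) PiE_def)
    show "hom_pair R (h1, h2) \<in> extensional (Lcar R \<times> Vcar R)" by (simp add: hom_pair_def)
  qed (auto simp: hom_pair_def gp)
  ultimately show ?thesis by (rule that)
qed

lemma is_rep_Wrep: "is_rep (Wrep X Y)"
proof -
  have "vspace (lie_gen X) 0 (+) nca_sc" "vspace (Fmod X Y) 0 (+) nca_sc"
    unfolding vspace_def by (auto intro: lie_gen.intros Fmod_zero Fmod_add Fmod_sc
        simp: fn.scale_right_distrib fn.scale_left_distrib ac_simps)
  then show ?thesis
    unfolding is_rep_def lie_alg_def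
    by (auto simp: Wrep_def nca_comm_add_left nca_comm_add_right nca_comm_sc_left nca_comm_sc_right
        nca_jacobi nca_act_add_left nca_act_add_right nca_act_sc_left nca_act_sc_right nca_act_comm
        Fmod_lie_act intro: lie_gen.br) (simp_all add: nca_comm_def)
qed

definition pdl_closed :: "('k, 'm, 'z) pdl_scheme \<Rightarrow> bool" where
  "pdl_closed A \<longleftrightarrow> (\<forall>x\<in>Mcar A. mproj A x \<in> Mcar A \<and> (\<forall>c. msc A c x \<in> Mcar A) \<and>
     (\<forall>y\<in>Mcar A. madd A x y \<in> Mcar A \<and> mbr A x y \<in> Mcar A))"

lemma pdl_hom_compose:
  assumes f: "pdl_hom A B f" and g: "pdl_hom B C g" and closed: "pdl_closed A"
  shows "pdl_hom A C (compose (Mcar A) g f)"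
  using pdl_homD[OF f] pdl_homD[OF g] closed
  unfolding pdl_hom_def[of A C] pdl_closed_def by (auto simp: compose_eq compose_def)

lemma pdl_iso_inv:
  assumes f: "pdl_iso A B f" and A: "pdl_closed A"
  shows "pdl_hom B A (restrict (inv_into (Mcar A) f) (Mcar B))"
proof -
  have hom: "pdl_hom A B f" and inj: "inj_on f (Mcar A)" and im: "f ` Mcar A = Mcar B"
    using f by (auto simp: pdl_iso_def bij_betw_def)
  let ?g = "inv_into (Mcar A) f"
  have gf: "\<And>x. x \<in> Mcar A \<Longrightarrow> ?g (f x) = x" using inj by simp
  show ?thesis
    unfolding pdl_hom_def im[symmetric]
    using A unfolding pdl_closed_def
    by (auto simp: gf pdl_homD(2-)[OF hom, symmetric])
qed

lemma Mcar_Ffree: "Mcar (Ffree M) = Fcar M"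
  by (simp add: Ffree_def)

lemma Ffree_closed:
  "x \<in> Fcar M \<Longrightarrow> y \<in> Fcar M \<Longrightarrow> madd (Ffree M) x y \<in> Fcar M"
  "x \<in> Fcar M \<Longrightarrow> msc (Ffree M) c x \<in> Fcar M"
  by (auto simp: Fcar_eqc Ffree_eqc fpd_on_add fpd_on_sc)

lemma pdl_closed_Ffree: "pdl_closed (Ffree M)"
  by (auto simp: pdl_closed_def Ffree_eqc fpd_on_add fpd_on_br fpd_on_sc fpd_on_proj)

lemma pdl_closed_calF: "is_rep R \<Longrightarrow> pdl_closed (calF R)"
  using rep_simps[of R] is_rep_closed[of R] by (auto simp: pdl_closed_def calF_simps)

section \<open>Presentations of free algebras by free representations\<close>

text \<open>The representation is a parameter because each F(M) is presented twice in the end: by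
  W(M,M) and by its image under the automorphism.\<close>

definition pres :: "nat set \<Rightarrow> nat set \<times> nat set \<Rightarrow> ('k::field tm set \<Rightarrow> 'k nca \<times> 'k ncm) \<Rightarrow> bool" where
  "pres M A \<theta> \<longleftrightarrow> pdl_iso (Ffree M) (calF (Wrep (fst A) (snd A))) \<theta>"

definition lift_hom :: "nat set \<Rightarrow> ('k::field tm set \<Rightarrow> 'k nca \<times> 'k ncm) \<Rightarrow> ('k nca \<Rightarrow> 'l) \<times> ('k ncm \<Rightarrow> 'v)
    \<Rightarrow> 'k tm set \<Rightarrow> 'l \<times> 'v" where
  "lift_hom M \<theta> h = restrict (\<lambda>C. map_prod (fst h) (snd h) (\<theta> C)) (Fcar M)"

text \<open>The morphism that closes the square formed by \<open>calF h\<close> and the two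
  presentations.\<close>

definition transport :: "nat set \<Rightarrow> ('k::field tm set \<Rightarrow> 'k nca \<times> 'k ncm) \<Rightarrow> nat set
    \<Rightarrow> ('k tm set \<Rightarrow> 'k nca \<times> 'k ncm) \<Rightarrow> 'k rmor \<Rightarrow> 'k tmor" where
  "transport M \<theta> N \<eta> h = compose (Fcar M) (inv_into (Fcar N) \<eta>) (lift_hom M \<theta> h)"

text \<open>Closed sets are pairs for representations and single subsets for F(M); the rectangle
  mediates between them.\<close>

definition pull :: "nat set \<Rightarrow> ('k::field tm set \<Rightarrow> 'k nca \<times> 'k ncm) \<Rightarrow> 'k nca set \<times> 'k ncm set
    \<Rightarrow> 'k tm set set" where
  "pull M \<theta> T = {C \<in> Fcar M. \<theta> C \<in> fst T \<times> snd T}"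

lemma Wrep_car: "Lcar (Wrep X Y) = lie_gen X" "Vcar (Wrep X Y) = Fmod X Y"
  "lzero (Wrep X Y) = 0" "vzero (Wrep X Y) = 0"
  by (simp_all add: Wrep_def)

lemma pres_bij: "pres M A \<theta> \<Longrightarrow> bij_betw \<theta> (Fcar M) (lie_gen (fst A) \<times> Fmod (fst A) (snd A))"
  by (simp add: pres_def pdl_iso_def Mcar_Ffree calF_simps Wrep_car)

lemma pres_mem: "pres M A \<theta> \<Longrightarrow> C \<in> Fcar M \<Longrightarrow> \<theta> C \<in> lie_gen (fst A) \<times> Fmod (fst A) (snd A)"
  using pres_bij bij_betwE by fast

lemma pres_obtain:
  assumes "pres M A \<theta>" "l \<in> lie_gen (fst A)" "v \<in> Fmod (fst A) (snd A)"
  obtains C where "C \<in> Fcar M" "\<theta> C = (l, v)"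
proof -
  have "(l, v) \<in> \<theta> ` Fcar M" using pres_bij[OF assms(1)] assms(2,3) by (simp add: bij_betw_def)
  then obtain C where "C \<in> Fcar M" "\<theta> C = (l, v)" by force
  then show ?thesis by (rule that)
qed

lemma lift_hom_eq: "pres M A \<theta> \<Longrightarrow>
    lift_hom M \<theta> h = compose (Fcar M) (hom_pair (Wrep (fst A) (snd A)) h) \<theta>"
  using pres_mem[of M A \<theta>]
  by (force simp: lift_hom_def hom_pair_def compose_def fun_eq_iff Wrep_car)

lemma pdl_hom_lift_hom:
  assumes "pres M A \<theta>" "is_rep H" "rep_hom (Wrep (fst A) (snd A)) H h"
  shows "pdl_hom (Ffree M) (calF H) (lift_hom M \<theta> h)"
  unfolding lift_hom_eq[OF assms(1)] Mcar_Ffree[symmetric]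
  using assms
  by (intro pdl_hom_compose[OF _ pdl_hom_hom_pair[OF is_rep_Wrep] pdl_closed_Ffree])
    (auto simp: pres_def pdl_iso_def)

lemma pres_inv:
  assumes "pres M A \<theta>"
  shows "pdl_hom (calF (Wrep (fst A) (snd A))) (Ffree M)
    (restrict (inv_into (Fcar M) \<theta>) (lie_gen (fst A) \<times> Fmod (fst A) (snd A)))"
  using pdl_iso_inv[OF assms[unfolded pres_def] pdl_closed_Ffree]
  by (simp add: Mcar_Ffree calF_simps(1) Wrep_car)

text \<open>\<open>F\<close> is precomposed with the inverse of the presentation, and then fullness
  of \<open>calF\<close> applies.\<close>

lemma pdl_hom_Ffree_cases:
  fixes \<theta> :: "'k::field tm set \<Rightarrow> 'k nca \<times> 'k ncm"
  assumes p: "pres M A \<theta>" and H: "is_rep H" and F: "pdl_hom (Ffree M) (calF H) F"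
  obtains h where "rep_hom (Wrep (fst A) (snd A)) H h" "F = lift_hom M \<theta> h"
proof -
  let ?W = "Wrep (fst A) (snd A)"
  define i where "i = restrict (inv_into (Fcar M) \<theta>) (lie_gen (fst A) \<times> Fmod (fst A) (snd A))"
  have "pdl_hom (calF ?W) (calF H) (compose (Mcar (calF ?W)) F i)"
    unfolding i_def by (rule pdl_hom_compose[OF pres_inv[OF p] F pdl_closed_calF[OF is_rep_Wrep]])
  then obtain h where h: "rep_hom ?W H h" "compose (Mcar (calF ?W)) F i = hom_pair ?W h"
    using pdl_hom_calF_cases[OF is_rep_Wrep H] by blast
  have i: "i (\<theta> C) = C" if "C \<in> Fcar M" for C
    using pres_bij[OF p] that pres_mem[OF p that] by (simp add: i_def bij_betw_def)
  have "F = compose (Fcar M) (hom_pair ?W h) \<theta>"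
  proof (rule extensionalityI)
    show "F \<in> extensional (Fcar M)" using F by (simp add: pdl_hom_def Mcar_Ffree PiE_def)
    fix C :: "'k tm set" assume C: "C \<in> Fcar M"
    show "F C = compose (Fcar M) (hom_pair ?W h) \<theta> C"
      unfolding h(2)[symmetric] using i[OF C] pres_mem[OF p C] C
      by (simp add: compose_def calF_simps(1) Wrep_car)
  qed (simp add: compose_def)
  with h(1) show ?thesis using that lift_hom_eq[OF p] by metis
qed

lemma rep_hom_eqI:
  assumes "rep_hom R S h" "rep_hom R S h'" "\<And>l. l \<in> Lcar R \<Longrightarrow> fst h l = fst h' l"
    "\<And>v. v \<in> Vcar R \<Longrightarrow> snd h v = snd h' v"
  shows "h = h'"
proof (rule prod_eqI)
  show "fst h = fst h'"
    using assms(1,2) assms(3) unfolding rep_hom_def PiE_def by (intro extensionalityI[of _ "Lcar R"]) blast+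
  show "snd h = snd h'"
    using assms(1,2) assms(4) unfolding rep_hom_def PiE_def by (intro extensionalityI[of _ "Vcar R"]) blast+
qed

lemma ThHom_extensional: "F \<in> ThHom M N \<Longrightarrow> F \<in> extensional (Fcar M)"
  by (simp add: ThHom_def pdl_hom_def Mcar_Ffree PiE_def)

lemma ThHom_mem: "F \<in> ThHom M N \<Longrightarrow> C \<in> Fcar M \<Longrightarrow> F C \<in> Fcar N"
  by (auto simp: ThHom_def pdl_hom_def Mcar_Ffree)

section \<open>Transport of morphisms and of the relations beta\<close>

context
  fixes M N :: "nat set" and A B :: "nat set \<times> nat set"
    and \<theta> \<eta> :: "'k::field tm set \<Rightarrow> 'k nca \<times> 'k ncm"
  assumes \<theta>: "pres M A \<theta>" and \<eta>: "pres N B \<eta>"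
begin

lemma transport_ThHom:
  assumes "h \<in> XiHom A B" shows "transport M \<theta> N \<eta> h \<in> ThHom M N"
proof -
  let ?i = "restrict (inv_into (Fcar N) \<eta>) (lie_gen (fst B) \<times> Fmod (fst B) (snd B))"
  have h: "rep_hom (Wrep (fst A) (snd A)) (Wrep (fst B) (snd B)) h" using assms by (simp add: XiHom_def)
  note L = pdl_hom_lift_hom[OF \<theta> is_rep_Wrep h]
  have "pdl_hom (Ffree M) (Ffree N) (compose (Fcar M) ?i (lift_hom M \<theta> h))"
    unfolding Mcar_Ffree[symmetric, of M]
    by (rule pdl_hom_compose[OF L pres_inv[OF \<eta>] pdl_closed_Ffree])
  also have "compose (Fcar M) ?i (lift_hom M \<theta> h) = transport M \<theta> N \<eta> h"
    using pdl_homD(1)[OF L] by (auto simp: compose_def transport_def fun_eq_iff Mcar_Ffree calF_simps(1) Wrep_car)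
  finally show ?thesis by (simp add: ThHom_def)
qed

lemma transport_apply:
  assumes "h \<in> XiHom A B" "C \<in> Fcar M"
  shows "\<eta> (transport M \<theta> N \<eta> h C) = map_prod (fst h) (snd h) (\<theta> C)"
proof -
  have h: "rep_hom (Wrep (fst A) (snd A)) (Wrep (fst B) (snd B)) h" using assms by (simp add: XiHom_def)
  have "lift_hom M \<theta> h C \<in> lie_gen (fst B) \<times> Fmod (fst B) (snd B)"
    using pdl_homD(1)[OF pdl_hom_lift_hom[OF \<theta> is_rep_Wrep h]] assms(2)
    by (simp add: Mcar_Ffree calF_simps(1) Wrep_car)
  then show ?thesis using pres_bij[OF \<eta>] assms(2)
    by (simp add: transport_def compose_def lift_hom_def bij_betw_def f_inv_into_f)
qed

text \<open>\<open>\<eta>\<close> is injective, so the commuting square determines the transported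
  morphism; surjectivity, composition and identities are all checked through this.\<close>

lemma transport_eqI:
  assumes "F \<in> ThHom M N" "h \<in> XiHom A B" "\<And>C. C \<in> Fcar M \<Longrightarrow> \<eta> (F C) = map_prod (fst h) (snd h) (\<theta> C)"
  shows "F = transport M \<theta> N \<eta> h"
proof (rule extensionalityI)
  show "F \<in> extensional (Fcar M)" "transport M \<theta> N \<eta> h \<in> extensional (Fcar M)"
    using assms(1) transport_ThHom[OF assms(2)] by (auto intro: ThHom_extensional)
  fix C :: "'k tm set" assume C: "C \<in> Fcar M"
  have "F C \<in> Fcar N" "transport M \<theta> N \<eta> h C \<in> Fcar N"
    using assms(1) transport_ThHom[OF assms(2)] C by (auto intro: ThHom_mem)
  then show "F C = transport M \<theta> N \<eta> h C"
    using inj_onD[OF bij_betw_imp_inj_on[OF pres_bij[OF \<eta>]]] assms(3)[OF C] transport_apply[OF assms(2) C]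
    by metis
qed

text \<open>Injectivity is tested on elements over (l, 0) and (0, v); surjectivity is fullness of
  \<open>calF\<close> applied to \<open>\<eta>\<close> after \<open>F\<close>.\<close>

lemma bij_transfer: "bij_betw (transport M \<theta> N \<eta>) (XiHom A B) (ThHom M N)"
proof (intro bij_betw_imageI inj_onI)
  fix h h' assume h: "h \<in> XiHom A B" "h' \<in> XiHom A B" and e: "transport M \<theta> N \<eta> h = transport M \<theta> N \<eta> h'"
  have eq: "map_prod (fst h) (snd h) (\<theta> C) = map_prod (fst h') (snd h') (\<theta> C)" if "C \<in> Fcar M" for C
    using transport_apply[OF h(1) that] transport_apply[OF h(2) that] e by simp
  show "h = h'"
  proof (rule rep_hom_eqI)
    fix l :: "'k nca" assume "l \<in> Lcar (Wrep (fst A) (snd A))"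
    then obtain C where "C \<in> Fcar M" "\<theta> C = (l, 0)"
      using pres_obtain[OF \<theta> _ Fmod_zero] by (auto simp: Wrep_car)
    with eq show "fst h l = fst h' l" by fastforce
  next
    fix v :: "'k ncm" assume "v \<in> Vcar (Wrep (fst A) (snd A))"
    then obtain C where "C \<in> Fcar M" "\<theta> C = (0, v)"
      using pres_obtain[OF \<theta> lie_gen.zero] by (auto simp: Wrep_car)
    with eq show "snd h v = snd h' v" by fastforce
  qed (use h in \<open>simp_all add: XiHom_def\<close>)
next
  show "transport M \<theta> N \<eta> ` XiHom A B = ThHom M N"
  proof (intro equalityI subsetI)
    fix F :: "'k tmor" assume F: "F \<in> ThHom M N"
    let ?V = "Wrep (fst B) (snd B)"
    have "pdl_hom (Ffree M) (calF ?V) (compose (Mcar (Ffree M)) \<eta> F)"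
      using F \<eta> pdl_closed_Ffree by (intro pdl_hom_compose[where B = "Ffree N"])
        (auto simp: ThHom_def pres_def pdl_iso_def)
    then obtain h where h: "rep_hom (Wrep (fst A) (snd A)) ?V h" "compose (Fcar M) \<eta> F = lift_hom M \<theta> h"
      using pdl_hom_Ffree_cases[OF \<theta> is_rep_Wrep] unfolding Mcar_Ffree by blast
    have "F = transport M \<theta> N \<eta> h"
    proof (rule transport_eqI[OF F])
      show "h \<in> XiHom A B" using h by (simp add: XiHom_def)
      fix C :: "'k tm set" assume "C \<in> Fcar M"
      then show "\<eta> (F C) = map_prod (fst h) (snd h) (\<theta> C)"
        using fun_cong[OF h(2), of C] by (simp add: compose_def lift_hom_def)
    qed
    with h show "F \<in> transport M \<theta> N \<eta> ` XiHom A B" by (auto simp: XiHom_def)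
  qed (use transport_ThHom in auto)
qed

text \<open>Seen through \<open>\<eta>\<close>, the difference of two transported morphisms is the
  pair of sortwise differences, so lying in the rectangle is congruence in each sort.\<close>

lemma transport_beta:
  "(\<lambda>(f, g). (transport M \<theta> N \<eta> f, transport M \<theta> N \<eta> g)) ` rep_beta A B T = pdl_beta M N (pull N \<eta> T)"
proof -
  have iff: "(transport M \<theta> N \<eta> f, transport M \<theta> N \<eta> g) \<in> pdl_beta M N (pull N \<eta> T) \<longleftrightarrow> (f, g) \<in> rep_beta A B T"
    if f: "f \<in> XiHom A B" and g: "g \<in> XiHom A B" for f g
  proof -
    let ?F = "transport M \<theta> N \<eta> f" and ?G = "transport M \<theta> N \<eta> g"
    let ?D = "\<lambda>C. madd (Ffree N) (?F C) (msc (Ffree N) (-1) (?G C))"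
    have hom: "pdl_hom (Ffree N) (calF (Wrep (fst B) (snd B))) \<eta>" using \<eta> by (simp add: pres_def pdl_iso_def)
    have FG: "?F C \<in> Fcar N" "?G C \<in> Fcar N" if "C \<in> Fcar M" for C
      using transport_ThHom[OF f] transport_ThHom[OF g] that by (auto intro: ThHom_mem)
    have D: "?D C \<in> Fcar N" if "C \<in> Fcar M" for C using FG[OF that] Ffree_closed by blast
    have \<eta>D: "\<eta> (?D C) = (fst f l - fst g l, snd f v - snd g v)" if "C \<in> Fcar M" "\<theta> C = (l, v)" for C l v
      using pdl_homD(2)[OF hom, unfolded Mcar_Ffree, OF FG(1)[OF that(1)] Ffree_closed(2)[OF FG(2)[OF that(1)]], of "-1"]
        pdl_homD(3)[OF hom, unfolded Mcar_Ffree, OF FG(2)[OF that(1)], of "-1"]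
        transport_apply[OF f that(1)] transport_apply[OF g that(1)] that(2)
      by (simp add: calF_Wrep)
    have "(\<forall>C\<in>Fcar M. ?D C \<in> pull N \<eta> T) \<longleftrightarrow>
        (\<forall>l\<in>lie_gen (fst A). fst f l - fst g l \<in> fst T) \<and>
        (\<forall>v\<in>Fmod (fst A) (snd A). snd f v - snd g v \<in> snd T)" (is "?L \<longleftrightarrow> ?R")
    proof
      assume L: ?L
      show ?R
      proof (intro conjI ballI)
        fix l :: "'k nca" assume "l \<in> lie_gen (fst A)"
        then obtain C where "C \<in> Fcar M" "\<theta> C = (l, 0)" using pres_obtain[OF \<theta> _ Fmod_zero] by blast
        with L \<eta>D show "fst f l - fst g l \<in> fst T" by (fastforce simp: pull_def)
      next
        fix v :: "'k ncm" assume "v \<in> Fmod (fst A) (snd A)"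
        then obtain C where "C \<in> Fcar M" "\<theta> C = (0, v)" using pres_obtain[OF \<theta> lie_gen.zero] by blast
        with L \<eta>D show "snd f v - snd g v \<in> snd T" by (fastforce simp: pull_def)
      qed
    next
      assume R: ?R
      show ?L
      proof
        fix C :: "'k tm set" assume C: "C \<in> Fcar M"
        obtain l v where "\<theta> C = (l, v)" "l \<in> lie_gen (fst A)" "v \<in> Fmod (fst A) (snd A)"
          using pres_mem[OF \<theta> C] by (cases "\<theta> C") auto
        with R \<eta>D[OF C] D[OF C] show "?D C \<in> pull N \<eta> T" by (simp add: pull_def)
      qed
    qed
    then show ?thesis using f g transport_ThHom by (simp add: pdl_beta_def rep_beta_def)
  qed
  show ?thesis
  proof (intro equalityI subsetI)
    fix p assume p: "p \<in> pdl_beta M N (pull N \<eta> T)"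
    then obtain F G where FG: "p = (F, G)" "F \<in> ThHom M N" "G \<in> ThHom M N" by (auto simp: pdl_beta_def)
    then have "F \<in> transport M \<theta> N \<eta> ` XiHom A B" "G \<in> transport M \<theta> N \<eta> ` XiHom A B"
      using bij_betw_imp_surj_on[OF bij_transfer] by simp_all
    then obtain f g where "f \<in> XiHom A B" "g \<in> XiHom A B" "F = transport M \<theta> N \<eta> f" "G = transport M \<theta> N \<eta> g"
      by (elim imageE)
    with p iff[of f g] FG(1)
    show "p \<in> (\<lambda>(f, g). (transport M \<theta> N \<eta> f, transport M \<theta> N \<eta> g)) ` rep_beta A B T" by force
  next
    fix p assume "p \<in> (\<lambda>(f, g). (transport M \<theta> N \<eta> f, transport M \<theta> N \<eta> g)) ` rep_beta A B T"
    then obtain f g where p: "p = (transport M \<theta> N \<eta> f, transport M \<theta> N \<eta> g)" "(f, g) \<in> rep_beta A B T" by auto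
    then have "f \<in> XiHom A B" "g \<in> XiHom A B" by (auto simp: rep_beta_def)
    with iff p show "p \<in> pdl_beta M N (pull N \<eta> T)" by simp
  qed
qed

end

lemma XiComp_XiHom:
  assumes "f \<in> XiHom A B" "g \<in> XiHom B C" shows "XiComp A g f \<in> XiHom A C"
  using assms unfolding XiHom_def mem_Collect_eq rep_hom_def XiComp_def
  by (auto simp: Wrep_def compose_def Fmod_add Fmod_sc Fmod_lie_act Pi_iff
      lie_gen.add lie_gen.sc lie_gen.br PiE_iff)

lemma transport_comp:
  fixes \<theta>1 \<theta>2 \<theta>3 :: "'k::field tm set \<Rightarrow> 'k nca \<times> 'k ncm"
  assumes p: "pres M1 A1 \<theta>1" "pres M2 A2 \<theta>2" "pres M3 A3 \<theta>3" and f: "f \<in> XiHom A1 A2" and g: "g \<in> XiHom A2 A3"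
  shows "transport M1 \<theta>1 M3 \<theta>3 (XiComp A1 g f) = ThComp M1 (transport M2 \<theta>2 M3 \<theta>3 g) (transport M1 \<theta>1 M2 \<theta>2 f)"
proof (rule transport_eqI[OF p(1,3), symmetric])
  note F = transport_ThHom[OF p(1,2) f] and G = transport_ThHom[OF p(2,3) g]
  show "ThComp M1 (transport M2 \<theta>2 M3 \<theta>3 g) (transport M1 \<theta>1 M2 \<theta>2 f) \<in> ThHom M1 M3"
    using F G pdl_hom_compose[of "Ffree M1" "Ffree M2"] pdl_closed_Ffree
    by (auto simp: ThHom_def ThComp_def Mcar_Ffree[symmetric])
  show "XiComp A1 g f \<in> XiHom A1 A3" by (rule XiComp_XiHom[OF f g])
  fix C :: "'k tm set" assume C: "C \<in> Fcar M1"
  have "transport M1 \<theta>1 M2 \<theta>2 f C \<in> Fcar M2"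
    using F C by (auto intro: ThHom_mem)
  then show "\<theta>3 (ThComp M1 (transport M2 \<theta>2 M3 \<theta>3 g) (transport M1 \<theta>1 M2 \<theta>2 f) C) =
      map_prod (fst (XiComp A1 g f)) (snd (XiComp A1 g f)) (\<theta>1 C)"
    using transport_apply[OF p(2,3) g] transport_apply[OF p(1,2) f C] C pres_mem[OF p(1) C]
    by (cases "\<theta>1 C") (simp add: ThComp_def XiComp_def compose_def)
qed

lemma XiId_XiHom: "XiId A \<in> XiHom A A"
  by (auto simp: XiHom_def rep_hom_def XiId_def Wrep_def Fmod_add Fmod_sc Fmod_lie_act
      lie_gen.add lie_gen.sc lie_gen.br)

lemma transport_id:
  fixes \<theta> :: "'k::field tm set \<Rightarrow> 'k nca \<times> 'k ncm"
  assumes p: "pres M A \<theta>"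
  shows "transport M \<theta> M \<theta> (XiId A) = ThId M"
proof (rule transport_eqI[OF p p _ XiId_XiHom, symmetric])
  show "ThId M \<in> ThHom M M"
    using pdl_closed_Ffree[of M] by (auto simp: ThHom_def pdl_hom_def ThId_def Mcar_Ffree pdl_closed_def)
  fix C :: "'k tm set" assume "C \<in> Fcar M"
  then show "\<theta> (ThId M C) = map_prod (fst (XiId A)) (snd (XiId A)) (\<theta> C)"
    using pres_mem[OF p, of C] by (cases "\<theta> C") (simp add: ThId_def XiId_def)
qed

section \<open>Correspondence of closed sets\<close>

context
  fixes M :: "nat set" and A :: "nat set \<times> nat set"
    and \<theta> :: "'k::field tm set \<Rightarrow> 'k nca \<times> 'k ncm" and H :: "('k, 'l, 'v) rep"
  assumes p: "pres M A \<theta>" and H: "is_rep H"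
begin

lemma rep_T'_iff_pdl_T':
  "F \<in> pdl_T' (calF H) M S \<longleftrightarrow> (\<exists>h. rep_hom (Wrep (fst A) (snd A)) H h \<and> F = lift_hom M \<theta> h \<and>
     (\<forall>t\<in>S. F t = mzero (calF H)))"
  unfolding pdl_T'_def using pdl_hom_Ffree_cases[OF p H] pdl_hom_lift_hom[OF p H] by blast

text \<open>Each lifted map acts sortwise, so vanishing at (l, v) is a condition on \<open>l\<close>
  and one on \<open>v\<close>. The family \<open>K\<close> is arbitrary because this serves both for
  closures and for the surjectivity of \<open>pull\<close>.\<close>

lemma zero_locus_lift_hom:
  "{C \<in> Fcar M. \<forall>F\<in>lift_hom M \<theta> ` K. F C = mzero (calF H)} =
    pull M \<theta> ({l \<in> lie_gen (fst A). \<forall>h\<in>K. fst h l = lzero H},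
      {v \<in> Fmod (fst A) (snd A). \<forall>h\<in>K. snd h v = vzero H})"
  unfolding pull_def
proof (rule Collect_cong, rule conj_cong[OF HOL.refl])
  fix C :: "'k tm set" assume C: "C \<in> Fcar M"
  obtain l v where "\<theta> C = (l, v)" "l \<in> lie_gen (fst A)" "v \<in> Fmod (fst A) (snd A)"
    using pres_mem[OF p C] by (cases "\<theta> C") auto
  then show "(\<forall>F\<in>lift_hom M \<theta> ` K. F C = mzero (calF H)) \<longleftrightarrow>
      \<theta> C \<in> fst ({l \<in> lie_gen (fst A). \<forall>h\<in>K. fst h l = lzero H},
        {v \<in> Fmod (fst A) (snd A). \<forall>h\<in>K. snd h v = vzero H}) \<times>
      snd ({l \<in> lie_gen (fst A). \<forall>h\<in>K. fst h l = lzero H},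
        {v \<in> Fmod (fst A) (snd A). \<forall>h\<in>K. snd h v = vzero H})"
    using C by (auto simp: lift_hom_def calF_simps)
qed

text \<open>With 0 in both sides the rectangle contains T1 x 0 and 0 x T2, so vanishing on it is
  vanishing on each side; an empty side would make the other one disappear.\<close>

lemma pull_closed_sets:
  assumes 0: "0 \<in> fst T" "0 \<in> snd T" and sub: "fst T \<subseteq> lie_gen (fst A)" "snd T \<subseteq> Fmod (fst A) (snd A)"
  shows "pdl_T'' (calF H) M (pull M \<theta> T) = pull M \<theta> (rep_T'' H A T)"
proof -
  have "lift_hom M \<theta> h \<in> pdl_T' (calF H) M (pull M \<theta> T) \<longleftrightarrow> h \<in> rep_T' H A T"
    if h: "rep_hom (Wrep (fst A) (snd A)) H h" for h
  proof -
    have "(\<forall>C\<in>pull M \<theta> T. lift_hom M \<theta> h C = mzero (calF H)) \<longleftrightarrow>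
        (\<forall>l\<in>fst T. fst h l = lzero H) \<and> (\<forall>v\<in>snd T. snd h v = vzero H)" (is "?L \<longleftrightarrow> ?R")
    proof
      assume L: ?L
      show ?R
      proof (intro conjI ballI)
        fix l :: "'k nca" assume l: "l \<in> fst T"
        then obtain C where "C \<in> Fcar M" "\<theta> C = (l, 0)" using pres_obtain[OF p _ Fmod_zero] sub by blast
        with L l 0 show "fst h l = lzero H" by (force simp: pull_def lift_hom_def calF_simps)
      next
        fix v :: "'k ncm" assume v: "v \<in> snd T"
        then obtain C where "C \<in> Fcar M" "\<theta> C = (0, v)" using pres_obtain[OF p lie_gen.zero] sub by blast
        with L v 0 show "snd h v = vzero H" by (force simp: pull_def lift_hom_def calF_simps)
      qed
    next
      assume ?R
      then show ?L by (auto simp: pull_def lift_hom_def calF_simps mem_Times_iff map_prod_def split_beta)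
    qed
    then show ?thesis using h pdl_hom_lift_hom[OF p H h] by (simp add: pdl_T'_def rep_T'_def)
  qed
  note iff = this
  have T': "pdl_T' (calF H) M (pull M \<theta> T) = lift_hom M \<theta> ` rep_T' H A T"
  proof (intro equalityI subsetI)
    fix F assume F: "F \<in> pdl_T' (calF H) M (pull M \<theta> T)"
    then obtain h where h: "rep_hom (Wrep (fst A) (snd A)) H h" "F = lift_hom M \<theta> h"
      using rep_T'_iff_pdl_T' by blast
    with F iff[OF h(1)] show "F \<in> lift_hom M \<theta> ` rep_T' H A T" by blast
  next
    fix F assume "F \<in> lift_hom M \<theta> ` rep_T' H A T"
    then obtain h where h: "h \<in> rep_T' H A T" "F = lift_hom M \<theta> h" by blast
    then have "rep_hom (Wrep (fst A) (snd A)) H h" by (simp add: rep_T'_def)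
    with h iff show "F \<in> pdl_T' (calF H) M (pull M \<theta> T)" by blast
  qed
  show ?thesis
    unfolding pdl_T''_def T' rep_T''_def by (rule zero_locus_lift_hom)
qed

text \<open>A rectangle determines its sides when both are nonempty, which the zeros
  guarantee.\<close>

lemma pull_inj:
  assumes "0 \<in> fst T" "0 \<in> snd T" "fst T \<subseteq> lie_gen (fst A)" "snd T \<subseteq> Fmod (fst A) (snd A)"
    and "0 \<in> fst U" "0 \<in> snd U" "fst U \<subseteq> lie_gen (fst A)" "snd U \<subseteq> Fmod (fst A) (snd A)"
    and eq: "pull M \<theta> T = pull M \<theta> U"
  shows "T = U"
proof -
  have im: "\<theta> ` pull M \<theta> V = fst V \<times> snd V"
    if V: "fst V \<subseteq> lie_gen (fst A)" "snd V \<subseteq> Fmod (fst A) (snd A)" for V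
  proof (intro equalityI subsetI)
    fix q assume q: "q \<in> fst V \<times> snd V"
    then obtain l v where lv: "q = (l, v)" "l \<in> lie_gen (fst A)" "v \<in> Fmod (fst A) (snd A)"
      using V by blast
    then obtain C where "C \<in> Fcar M" "\<theta> C = q" using pres_obtain[OF p] by metis
    with q show "q \<in> \<theta> ` pull M \<theta> V" by (auto simp: pull_def intro!: image_eqI[of q \<theta> C])
  qed (auto simp: pull_def)
  have "fst T \<times> snd T = fst U \<times> snd U"
    using im[OF assms(3,4)] im[OF assms(7,8)] eq by simp
  then have "fst T = fst U \<and> snd T = snd U" using assms(1,2,5,6) by (auto simp: times_eq_iff)
  then show ?thesis by (simp add: prod_eq_iff)
qed

lemma rep_T''_props:
  "0 \<in> fst (rep_T'' H A T)" "0 \<in> snd (rep_T'' H A T)"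
  "fst (rep_T'' H A T) \<subseteq> lie_gen (fst A)" "snd (rep_T'' H A T) \<subseteq> Fmod (fst A) (snd A)"
  using rep_hom_zero[OF is_rep_Wrep H] by (auto simp: rep_T''_def rep_T'_def Wrep_car Fmod_zero lie_gen.zero)

lemma bij_pull: "bij_betw (pull M \<theta>) (rep_Cl H A) (pdl_Cl (calF H) M)"
proof (intro bij_betw_imageI inj_onI)
  have props: "0 \<in> fst T" "0 \<in> snd T" "fst T \<subseteq> lie_gen (fst A)" "snd T \<subseteq> Fmod (fst A) (snd A)"
    if "T \<in> rep_Cl H A" for T
    using rep_T''_props[of T] that by (simp_all add: rep_Cl_def)
  show "T = U" if "T \<in> rep_Cl H A" "U \<in> rep_Cl H A" "pull M \<theta> T = pull M \<theta> U" for T U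
    using pull_inj[OF props[OF that(1)] props[OF that(2)] that(3)] .
  show "pull M \<theta> ` rep_Cl H A = pdl_Cl (calF H) M"
  proof (intro equalityI subsetI)
    fix S assume "S \<in> pull M \<theta> ` rep_Cl H A"
    then obtain T where T: "T \<in> rep_Cl H A" "S = pull M \<theta> T" by blast
    then show "S \<in> pdl_Cl (calF H) M"
      using pull_closed_sets[OF props[OF T(1)]] by (simp add: pdl_Cl_def rep_Cl_def)
  next
    fix S assume S: "S \<in> pdl_Cl (calF H) M"
    \<comment> \<open>A closed \<open>S\<close> is the common zero set of the maps that kill it.
      These form the family \<open>K\<close>, and its zero set is the rectangle over
      \<open>T\<close>; that \<open>T\<close> is closed then follows from injectivity of
      \<open>pull\<close>.\<close>
    define K where "K = {h. rep_hom (Wrep (fst A) (snd A)) H h \<and> (\<forall>t\<in>S. lift_hom M \<theta> h t = mzero (calF H))}"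
    define T where "T = ({l \<in> lie_gen (fst A). \<forall>h\<in>K. fst h l = lzero H},
      {v \<in> Fmod (fst A) (snd A). \<forall>h\<in>K. snd h v = vzero H})"
    have T': "pdl_T' (calF H) M S = lift_hom M \<theta> ` K"
      using rep_T'_iff_pdl_T' by (auto simp: K_def)
    have S_eq: "S = pdl_T'' (calF H) M S" using S by (simp add: pdl_Cl_def)
    also have "\<dots> = pull M \<theta> T"
      unfolding pdl_T''_def T' T_def by (rule zero_locus_lift_hom)
    finally have ST: "S = pull M \<theta> T" .
    have T0: "0 \<in> fst T" "0 \<in> snd T" "fst T \<subseteq> lie_gen (fst A)" "snd T \<subseteq> Fmod (fst A) (snd A)"
      using rep_hom_zero[OF is_rep_Wrep H] by (auto simp: T_def K_def Wrep_car Fmod_zero lie_gen.zero)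
    have "pull M \<theta> (rep_T'' H A T) = pull M \<theta> T"
      using pull_closed_sets[OF T0] S_eq ST by simp
    then have "rep_T'' H A T = T" by (rule pull_inj[OF rep_T''_props T0])
    then show "S \<in> pull M \<theta> ` rep_Cl H A" using ST by (auto simp: rep_Cl_def)
  qed
qed

end

section \<open>Coproducts and ranks in the category of free representations\<close>

lemma underdetermined_system:
  fixes m :: "'a \<Rightarrow> 's \<Rightarrow> 'k::field"
  assumes "finite S" "finite A" "card S < card A"
  shows "\<exists>c. (\<forall>s\<in>S. (\<Sum>v\<in>A. c v * m v s) = 0) \<and> (\<exists>v\<in>A. c v \<noteq> 0)"
  using assms
\<comment> \<open>Gaussian elimination: one equation removes one unknown, which changes both the
  unknowns and the coefficients, so both are generalised.\<close>
proof (induction S arbitrary: A m rule: finite_induct)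
  case empty
  then obtain v where "v \<in> A" by fastforce
  then show ?case by (intro exI[of _ "\<lambda>_. 1"]) auto
next
  case (insert s S)
  show ?case
  proof (cases "\<forall>v\<in>A. m v s = 0")
    case True
    have "card S < card A" using insert by simp
    from insert.IH[OF \<open>finite A\<close> this, of m] obtain c where
      "\<forall>s\<in>S. (\<Sum>v\<in>A. c v * m v s) = 0" "\<exists>v\<in>A. c v \<noteq> 0" by blast
    then show ?thesis using True by (intro exI[of _ c]) auto
  next
    case False
    then obtain w where w: "w \<in> A" "m w s \<noteq> 0" by blast
    define B where "B = A - {w}"
    have B: "finite B" "A = insert w B" "w \<notin> B" using w insert by (auto simp: B_def)
    have "card S < card B" using insert B by simp
    from insert.IH[OF B(1) this, of "\<lambda>v t. m v t - m v s / m w s * m w t"] obtain c where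
      c: "\<forall>t\<in>S. (\<Sum>v\<in>B. c v * (m v t - m v s / m w s * m w t)) = 0" "\<exists>v\<in>B. c v \<noteq> 0" by blast
    \<comment> \<open>Back substitution: the value at the pivot \<open>w\<close> is forced by
      equation \<open>s\<close>.\<close>
    define d where "d = c(w := - (\<Sum>v\<in>B. c v * m v s) / m w s)"
    have sum: "(\<Sum>v\<in>A. d v * m v t) = d w * m w t + (\<Sum>v\<in>B. c v * m v t)" for t
    proof -
      have "(\<Sum>v\<in>B. d v * m v t) = (\<Sum>v\<in>B. c v * m v t)"
        using B by (intro sum.cong) (auto simp: d_def)
      then show ?thesis using B by simp
    qed
    have "(\<Sum>v\<in>A. d v * m v t) = 0" if "t \<in> S" for t
    proof -
      have "(\<Sum>v\<in>B. c v * m v t) - (\<Sum>v\<in>B. c v * m v s) / m w s * m w t = 0"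
        using c(1) that by (simp add: algebra_simps sum_subtractf sum_distrib_left sum_distrib_right sum_divide_distrib)
      then show ?thesis unfolding sum by (simp add: d_def)
    qed
    moreover have "(\<Sum>v\<in>A. d v * m v s) = 0" unfolding sum using w by (simp add: d_def)
    moreover have "\<exists>v\<in>A. d v \<noteq> 0" using c(2) B by (auto simp: d_def)
    ultimately show ?thesis by blast
  qed
qed

text \<open>Invariance of dimension under a linear bijection, in coordinates.\<close>

lemma card_eq_if_bijective_system:
  fixes m :: "'a \<Rightarrow> 's \<Rightarrow> 'k::field"
  assumes fin: "finite A" "finite S"
    and emb: "\<And>c. \<forall>s\<in>S. (\<Sum>v\<in>A. c v * m v s) = 0 \<Longrightarrow> \<forall>v\<in>A. c v = 0"
    and surj: "\<And>d. \<exists>c. \<forall>s\<in>S. (\<Sum>v\<in>A. c v * m v s) = d s"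
  shows "card A = card S"
proof (rule antisym; rule ccontr; unfold not_le)
  assume "card S < card A"
  from underdetermined_system[OF fin(2,1) this, of m] emb show False by blast
next
  assume less: "card A < card S"
  \<comment> \<open>\<open>n\<close> is a one-sided inverse of \<open>m\<close>, made of the
    solutions for the unit vectors; a relation \<open>d\<close> between its rows, multiplied by
    \<open>m\<close>, returns \<open>d\<close> itself and so forces it to be 0.\<close>
  have "\<exists>n. \<forall>t s. s \<in> S \<longrightarrow> (\<Sum>v\<in>A. n t v * m v s) = (if s = t then 1 else 0)"
    using surj[of "\<lambda>s. if s = _ then 1 else 0"] by (intro choice) blast
  then obtain n where n: "\<And>t s. s \<in> S \<Longrightarrow> (\<Sum>v\<in>A. n t v * m v s) = (if s = t then 1 else 0)" by blast
  from underdetermined_system[OF fin less, of n] obtain d where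
    d: "\<forall>v\<in>A. (\<Sum>t\<in>S. d t * n t v) = 0" "\<exists>t\<in>S. d t \<noteq> 0" by blast
  have "d s = 0" if s: "s \<in> S" for s
  proof -
    have "d s = (\<Sum>t\<in>S. d t * (if s = t then 1 else 0))" using fin s by (simp add: if_distrib[of "\<lambda>x. _ * x"] cong: if_cong)
    also have "\<dots> = (\<Sum>t\<in>S. d t * (\<Sum>v\<in>A. n t v * m v s))" using n s by (intro sum.cong) auto
    also have "\<dots> = (\<Sum>v\<in>A. (\<Sum>t\<in>S. d t * n t v) * m v s)"
      unfolding sum_distrib_left sum_distrib_right by (subst sum.swap) (simp add: mult.assoc)
    also have "\<dots> = 0" using d(1) by simp
    finally show ?thesis .
  qed
  with d(2) show False by blast
qed

section \<open>Coproducts and automorphisms of a category\<close>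

definition coprod :: "'o set \<Rightarrow> ('o \<Rightarrow> 'o \<Rightarrow> 'm set) \<Rightarrow> ('o \<Rightarrow> 'm \<Rightarrow> 'm \<Rightarrow> 'm) \<Rightarrow> 'o \<Rightarrow> 'i set
    \<Rightarrow> ('i \<Rightarrow> 'o) \<Rightarrow> ('i \<Rightarrow> 'm) \<Rightarrow> bool" where
  "coprod Obj Hom cmp A I src emb \<longleftrightarrow> (\<forall>i\<in>I. emb i \<in> Hom (src i) A) \<and>
     (\<forall>Z\<in>Obj. \<forall>g. (\<forall>i\<in>I. g i \<in> Hom (src i) Z) \<longrightarrow>
        (\<exists>!h. h \<in> Hom A Z \<and> (\<forall>i\<in>I. cmp (src i) h (emb i) = g i)))"

text \<open>\<open>\<Phi>o\<close> is onto and \<open>\<Phi>m\<close> is bijective on hom-sets, so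
  every cocone under the image diagram comes from one under the original diagram, and so does every
  candidate for the mediating morphism.\<close>

lemma cat_aut_coprod:
  assumes aut: "cat_aut Obj Hom cmp idm \<Phi>o \<Phi>m"
    and comp: "\<And>A B C f g. f \<in> Hom A B \<Longrightarrow> g \<in> Hom B C \<Longrightarrow> cmp A g f \<in> Hom A C"
    and A: "A \<in> Obj" and src: "\<And>i. i \<in> I \<Longrightarrow> src i \<in> Obj"
    and cp: "coprod Obj Hom cmp A I src emb"
  shows "coprod Obj Hom cmp (\<Phi>o A) I (\<lambda>i. \<Phi>o (src i)) (\<lambda>i. \<Phi>m (src i) A (emb i))"
  unfolding coprod_def
proof (intro conjI ballI allI impI)
  have bij: "bij_betw (\<Phi>m X Y) (Hom X Y) (Hom (\<Phi>o X) (\<Phi>o Y))" if "X \<in> Obj" "Y \<in> Obj" for X Y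
    using aut that by (simp add: cat_aut_def)
  have cmp: "\<Phi>m X Z (cmp X g f) = cmp (\<Phi>o X) (\<Phi>m Y Z g) (\<Phi>m X Y f)"
    if "X \<in> Obj" "Y \<in> Obj" "Z \<in> Obj" "f \<in> Hom X Y" "g \<in> Hom Y Z" for X Y Z f g
    using aut that by (simp add: cat_aut_def)
  have emb: "emb i \<in> Hom (src i) A" if "i \<in> I" for i using cp that by (simp add: coprod_def)
  show "\<Phi>m (src i) A (emb i) \<in> Hom (\<Phi>o (src i)) (\<Phi>o A)" if "i \<in> I" for i
    using bij_betwE[OF bij[OF src[OF that] A]] emb[OF that] by blast
  fix Z g assume Z: "Z \<in> Obj" and g: "\<forall>i\<in>I. g i \<in> Hom (\<Phi>o (src i)) Z"
  obtain Z0 where Z0: "Z0 \<in> Obj" "Z = \<Phi>o Z0"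
  proof -
    have "Z \<in> \<Phi>o ` Obj" using aut Z by (simp add: cat_aut_def bij_betw_def)
    then show ?thesis using that by blast
  qed
  define g0 where "g0 = (\<lambda>i. inv_into (Hom (src i) Z0) (\<Phi>m (src i) Z0) (g i))"
  have g0: "g0 i \<in> Hom (src i) Z0" "\<Phi>m (src i) Z0 (g0 i) = g i" if "i \<in> I" for i
    using bij_betw_imp_surj_on[OF bij[OF src[OF that] Z0(1)]] g that Z0(2)
    by (auto simp: g0_def inv_into_into f_inv_into_f)
  have ex: "\<exists>!h. h \<in> Hom A Z0 \<and> (\<forall>i\<in>I. cmp (src i) h (emb i) = g0 i)"
    using cp Z0(1) g0(1) by (simp add: coprod_def)
  have iff: "(\<forall>i\<in>I. cmp (\<Phi>o (src i)) (\<Phi>m A Z0 h) (\<Phi>m (src i) A (emb i)) = g i) \<longleftrightarrow>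
      (\<forall>i\<in>I. cmp (src i) h (emb i) = g0 i)" if h: "h \<in> Hom A Z0" for h
  proof (intro ball_cong HOL.refl)
    fix i assume i: "i \<in> I"
    have "cmp (\<Phi>o (src i)) (\<Phi>m A Z0 h) (\<Phi>m (src i) A (emb i)) = \<Phi>m (src i) Z0 (cmp (src i) h (emb i))"
      using cmp[OF src[OF i] A Z0(1) emb[OF i] h] by simp
    then show "cmp (\<Phi>o (src i)) (\<Phi>m A Z0 h) (\<Phi>m (src i) A (emb i)) = g i \<longleftrightarrow>
        cmp (src i) h (emb i) = g0 i"
      using g0[OF i] comp[OF emb[OF i] h] inj_onD[OF bij_betw_imp_inj_on[OF bij[OF src[OF i] Z0(1)]]]
      by metis
  qed
  have surj: "\<exists>h0\<in>Hom A Z0. h = \<Phi>m A Z0 h0" if "h \<in> Hom (\<Phi>o A) Z" for h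
    using bij_betw_imp_surj_on[OF bij[OF A Z0(1)]] that Z0(2) by blast
  from ex obtain h where h: "h \<in> Hom A Z0" "\<forall>i\<in>I. cmp (src i) h (emb i) = g0 i"
    and uniq: "\<And>h'. h' \<in> Hom A Z0 \<Longrightarrow> \<forall>i\<in>I. cmp (src i) h' (emb i) = g0 i \<Longrightarrow> h' = h" by blast
  show "\<exists>!h. h \<in> Hom (\<Phi>o A) Z \<and> (\<forall>i\<in>I. cmp (\<Phi>o (src i)) h (\<Phi>m (src i) A (emb i)) = g i)"
  proof (intro ex1I[of _ "\<Phi>m A Z0 h"] conjI)
    show "\<Phi>m A Z0 h \<in> Hom (\<Phi>o A) Z" using bij_betwE[OF bij[OF A Z0(1)]] h(1) Z0(2) by blast
    show "\<forall>i\<in>I. cmp (\<Phi>o (src i)) (\<Phi>m A Z0 h) (\<Phi>m (src i) A (emb i)) = g i" using iff h by blast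
    fix h' assume h': "h' \<in> Hom (\<Phi>o A) Z \<and> (\<forall>i\<in>I. cmp (\<Phi>o (src i)) h' (\<Phi>m (src i) A (emb i)) = g i)"
    then obtain h0 where "h0 \<in> Hom A Z0" "h' = \<Phi>m A Z0 h0" using surj by blast
    with h' iff uniq show "h' = \<Phi>m A Z0 h" by blast
  qed
qed

section \<open>Morphisms between free representations\<close>

lemma lie_module_nca: "lie_module (nca_sc :: 'k::field_char_0 \<Rightarrow> _) nca_comm nca_sc nca_act"
  by unfold_locales (simp_all add: nca_comm_add_left nca_comm_add_right nca_comm_sc_left nca_comm_sc_right
      nca_jacobi nca_act_add_left nca_act_add_right nca_act_sc_left nca_act_sc_right nca_act_comm,
      simp add: nca_comm_def)

lemma XiHomD:
  assumes "h \<in> XiHom A B"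
  shows "f \<in> lie_gen (fst A) \<Longrightarrow> fst h f \<in> lie_gen (fst B)"
    "m \<in> Fmod (fst A) (snd A) \<Longrightarrow> snd h m \<in> Fmod (fst B) (snd B)"
    "f \<in> lie_gen (fst A) \<Longrightarrow> g \<in> lie_gen (fst A) \<Longrightarrow> fst h (f + g) = fst h f + fst h g"
    "f \<in> lie_gen (fst A) \<Longrightarrow> fst h (nca_sc c f) = nca_sc c (fst h f)"
    "f \<in> lie_gen (fst A) \<Longrightarrow> g \<in> lie_gen (fst A) \<Longrightarrow> fst h (nca_comm f g) = nca_comm (fst h f) (fst h g)"
    "m \<in> Fmod (fst A) (snd A) \<Longrightarrow> n \<in> Fmod (fst A) (snd A) \<Longrightarrow> snd h (m + n) = snd h m + snd h n"
    "m \<in> Fmod (fst A) (snd A) \<Longrightarrow> snd h (nca_sc c m) = nca_sc c (snd h m)"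
    "f \<in> lie_gen (fst A) \<Longrightarrow> m \<in> Fmod (fst A) (snd A) \<Longrightarrow> snd h (nca_act f m) = nca_act (fst h f) (snd h m)"
  using assms by (auto simp: XiHom_def rep_hom_def Wrep_def)

lemma XiHom_zero:
  assumes "h \<in> XiHom A B" shows "fst h 0 = 0" "snd h 0 = 0"
  using XiHomD(4)[OF assms lie_gen.zero, of 0] XiHomD(7)[OF assms Fmod_zero, of 0] by simp_all

lemma XiHom_eqI:
  assumes h: "h \<in> XiHom A B" and h': "h' \<in> XiHom A B"
    and gen: "\<And>x. x \<in> fst A \<Longrightarrow> fst h (nca_gen x) = fst h' (nca_gen x)"
      "\<And>y. y \<in> snd A \<Longrightarrow> snd h (delta ([], y)) = snd h' (delta ([], y))"
  shows "h = h'"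
proof -
  have 1: "fst h f = fst h' f" if "f \<in> lie_gen (fst A)" for f
    using that by (induction f rule: lie_gen.induct) (simp_all add: gen XiHomD[OF h] XiHomD[OF h'] XiHom_zero[OF h] XiHom_zero[OF h'])
  have 2: "snd h m = snd h' m" if "m \<in> Fmod (fst A) (snd A)" for m
    using that by (induction m rule: Fmod_induct) (simp_all add: gen XiHomD[OF h] XiHomD[OF h'] XiHom_zero[OF h] XiHom_zero[OF h'] lie_gen.gen)
  show ?thesis using h h' 1 2 by (intro rep_hom_eqI[of "Wrep (fst A) (snd A)"]) (auto simp: XiHom_def Wrep_car)
qed

text \<open>The lift is taken into the full polynomial algebra and module, then shown to land in the
  free representation over \<open>B\<close> and cut down to the carriers.\<close>

lemma XiHom_exists:
  fixes a :: "nat \<Rightarrow> 'k::field_char_0 nca"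
  assumes a: "\<And>x. x \<in> fst A \<Longrightarrow> a x \<in> lie_gen (fst B)"
    and b: "\<And>y. y \<in> snd A \<Longrightarrow> b y \<in> Fmod (fst B) (snd B)"
  obtains h where "h \<in> XiHom A B" "\<And>x. x \<in> fst A \<Longrightarrow> fst h (nca_gen x) = a x"
    "\<And>y. y \<in> snd A \<Longrightarrow> snd h (delta ([], y)) = b y"
proof -
  interpret lie_module nca_sc nca_comm nca_sc nca_act by (rule lie_module_nca)
  interpret F: free_lift nca_sc nca_comm nca_sc nca_act a b by unfold_locales
  have 1: "F.lie_lift f \<in> lie_gen (fst B)" if "f \<in> lie_gen (fst A)" for f
    using that by (induction f rule: lie_gen.induct)
      (auto simp: F.lie_lift_gen F.lie_lift_zero F.lie_lift_add[of _ "fst A"] F.lie_lift_sc[of _ "fst A"]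
        F.lie_lift_br[of _ "fst A"] a intro: lie_gen.intros)
  have 2: "F.mod_lift m \<in> Fmod (fst B) (snd B)" if "m \<in> Fmod (fst A) (snd A)" for m
    using that by (induction m rule: Fmod_induct)
      (auto simp: F.mod_lift_gen F.mod_lift_zero F.mod_lift_add[of _ "fst A" "snd A"]
        F.mod_lift_sc[of _ "fst A" "snd A"] F.mod_lift_act[of _ "fst A" _ "snd A"] b
        Fmod_zero Fmod_add Fmod_sc lie_gen.gen F.lie_lift_gen a intro!: Fmod_lie_act)
  define h where "h = (restrict F.lie_lift (lie_gen (fst A)), restrict F.mod_lift (Fmod (fst A) (snd A)))"
  have "h \<in> XiHom A B"
    using 1 2 by (auto simp: XiHom_def rep_hom_def Wrep_def h_def Fmod_add Fmod_sc Fmod_lie_act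
        lie_gen.add lie_gen.sc lie_gen.br F.lie_lift_add[of _ "fst A"] F.lie_lift_sc[of _ "fst A"]
        F.lie_lift_br[of _ "fst A"] F.mod_lift_add[of _ "fst A" "snd A"]
        F.mod_lift_sc[of _ "fst A" "snd A"] F.mod_lift_act[of _ "fst A" _ "snd A"])
  moreover have "fst h (nca_gen x) = a x" if "x \<in> fst A" for x
    using that by (simp add: h_def lie_gen.gen F.lie_lift_gen)
  moreover have "snd h (delta ([], y)) = b y" if "y \<in> snd A" for y
    using that by (simp add: h_def Fmod_gen F.mod_lift_gen)
  ultimately show ?thesis using that by blast
qed

text \<open>The summands of every object, and also the targets for counting: the first gives a
  one-dimensional Lie algebra with zero module, the second a zero Lie algebra with a one-dimensional
  module.\<close>

abbreviation XiLine :: "nat set \<times> nat set" where "XiLine \<equiv> ({0}, {})"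
abbreviation XiPoint :: "nat set \<times> nat set" where "XiPoint \<equiv> ({}, {0})"

lemma XiComp_apply:
  "f \<in> lie_gen (fst A) \<Longrightarrow> fst (XiComp A h i) f = fst h (fst i f)"
  "m \<in> Fmod (fst A) (snd A) \<Longrightarrow> snd (XiComp A h i) m = snd h (snd i m)"
  by (simp_all add: XiComp_def compose_def)

text \<open>A morphism out of W(X,Y) is a free choice of values on the generators, that is, of one
  morphism from each summand. The index set is a disjoint sum since X and Y may share
  elements.\<close>

lemma XiObj_coprod:
  fixes A :: "nat set \<times> nat set"
  shows "\<exists>emb :: nat + nat \<Rightarrow> 'k::field_char_0 rmor.
    coprod XiObj XiHom XiComp A (fst A <+> snd A) (case_sum (\<lambda>_. XiLine) (\<lambda>_. XiPoint)) emb"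
proof -
  let ?src = "case_sum (\<lambda>_. XiLine) (\<lambda>_. XiPoint)"
  have ex: "\<exists>i :: 'k rmor. i \<in> XiHom (?src j) A \<and> (\<forall>x. j = Inl x \<longrightarrow> fst i (nca_gen 0) = nca_gen x) \<and>
      (\<forall>y. j = Inr y \<longrightarrow> snd i (delta ([], 0)) = delta ([], y))" if j: "j \<in> fst A <+> snd A" for j
  proof (cases j)
    case (Inl x)
    then have x: "x \<in> fst A" using j by auto
    obtain i :: "'k rmor" where "i \<in> XiHom XiLine A" "fst i (nca_gen 0) = nca_gen x"
      by (rule XiHom_exists[of XiLine "\<lambda>_. nca_gen x" A "\<lambda>_. 0"]) (use x in \<open>auto intro: lie_gen.gen\<close>)
    then show ?thesis using Inl by (intro exI[of _ i]) simp
  next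
    case (Inr y)
    then have y: "y \<in> snd A" using j by auto
    obtain i :: "'k rmor" where "i \<in> XiHom XiPoint A" "snd i (delta ([], 0)) = delta ([], y)"
      by (rule XiHom_exists[of XiPoint "\<lambda>_. 0" A "\<lambda>_. delta ([], y)"]) (use y in \<open>auto intro: Fmod_gen\<close>)
    then show ?thesis using Inr by (intro exI[of _ i]) simp
  qed
  have "\<forall>j\<in>fst A <+> snd A. \<exists>i :: 'k rmor. i \<in> XiHom (?src j) A \<and>
      (\<forall>x. j = Inl x \<longrightarrow> fst i (nca_gen 0) = nca_gen x) \<and>
      (\<forall>y. j = Inr y \<longrightarrow> snd i (delta ([], 0)) = delta ([], y))" by (rule ballI) (rule ex)
  from bchoice[OF this] obtain emb :: "nat + nat \<Rightarrow> 'k rmor" where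
    e: "\<forall>j\<in>fst A <+> snd A. emb j \<in> XiHom (?src j) A \<and>
      (\<forall>x. j = Inl x \<longrightarrow> fst (emb j) (nca_gen 0) = nca_gen x) \<and>
      (\<forall>y. j = Inr y \<longrightarrow> snd (emb j) (delta ([], 0)) = delta ([], y))" by (elim exE)
  have emb1: "emb j \<in> XiHom (?src j) A" if "j \<in> fst A <+> snd A" for j
    using bspec[OF e that] by (elim conjE)
  have emb2: "fst (emb (Inl x)) (nca_gen 0) = nca_gen x" if "x \<in> fst A" for x
    using bspec[OF e InlI[OF that]] by simp
  have emb3: "snd (emb (Inr y)) (delta ([], 0)) = delta ([], y)" if "y \<in> snd A" for y
    using bspec[OF e InrI[OF that]] by simp
  \<comment> \<open>The cocone equations only prescribe \<open>h\<close> on the generators;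
    existence and uniqueness then come from freeness.\<close>
  have iff: "(\<forall>j\<in>fst A <+> snd A. XiComp (?src j) h (emb j) = g j) \<longleftrightarrow>
      (\<forall>x\<in>fst A. fst h (nca_gen x) = fst (g (Inl x)) (nca_gen 0)) \<and>
      (\<forall>y\<in>snd A. snd h (delta ([], y)) = snd (g (Inr y)) (delta ([], 0)))"
    if h: "h \<in> XiHom A Z" and g: "\<forall>j\<in>fst A <+> snd A. g j \<in> XiHom (?src j) Z"
    for h :: "'k rmor" and g Z
  proof -
    have gl: "XiComp XiLine h (emb (Inl x)) = g (Inl x) \<longleftrightarrow> fst h (nca_gen x) = fst (g (Inl x)) (nca_gen 0)"
      if x: "x \<in> fst A" for x
    proof -
      have i: "emb (Inl x) \<in> XiHom XiLine A" using emb1[OF InlI[OF x]] by simp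
      have e: "fst (XiComp XiLine h (emb (Inl x))) (nca_gen 0) = fst h (nca_gen x)"
        using emb2[OF x] by (simp add: XiComp_apply lie_gen.gen)
      show ?thesis
      proof
        assume *: "fst h (nca_gen x) = fst (g (Inl x)) (nca_gen 0)"
        show "XiComp XiLine h (emb (Inl x)) = g (Inl x)"
          using bspec[OF g InlI[OF x]] * e by (intro XiHom_eqI[OF XiComp_XiHom[OF i h]]) auto
      qed (use e in auto)
    qed
    have gr: "XiComp XiPoint h (emb (Inr y)) = g (Inr y) \<longleftrightarrow>
        snd h (delta ([], y)) = snd (g (Inr y)) (delta ([], 0))"
      if y: "y \<in> snd A" for y
    proof -
      have i: "emb (Inr y) \<in> XiHom XiPoint A" using emb1[OF InrI[OF y]] by simp
      have e: "snd (XiComp XiPoint h (emb (Inr y))) (delta ([], 0)) = snd h (delta ([], y))"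
        using emb3[OF y] by (simp add: XiComp_apply Fmod_gen)
      show ?thesis
      proof
        assume *: "snd h (delta ([], y)) = snd (g (Inr y)) (delta ([], 0))"
        show "XiComp XiPoint h (emb (Inr y)) = g (Inr y)"
          using bspec[OF g InrI[OF y]] * e by (intro XiHom_eqI[OF XiComp_XiHom[OF i h]]) auto
      qed (use e in auto)
    qed
    have "(\<forall>j\<in>fst A <+> snd A. P j) \<longleftrightarrow> (\<forall>x\<in>fst A. P (Inl x)) \<and> (\<forall>y\<in>snd A. P (Inr y))" for P
      by (auto simp: Plus_def)
    from this[of "\<lambda>j. XiComp (?src j) h (emb j) = g j"] show ?thesis by (simp add: gl gr)
  qed
  have "coprod XiObj XiHom XiComp A (fst A <+> snd A) ?src emb"
    unfolding coprod_def
  proof (intro conjI ballI allI impI)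
    fix Z and g :: "nat + nat \<Rightarrow> 'k rmor"
    assume g: "\<forall>j\<in>fst A <+> snd A. g j \<in> XiHom (?src j) Z"
    have gl: "fst (g (Inl x)) (nca_gen 0) \<in> lie_gen (fst Z)" if "x \<in> fst A" for x
      using XiHomD(1)[of "g (Inl x)" XiLine Z "nca_gen 0"] bspec[OF g InlI[OF that]] by (simp add: lie_gen.gen)
    have gr: "snd (g (Inr y)) (delta ([], 0)) \<in> Fmod (fst Z) (snd Z)" if "y \<in> snd A" for y
      using XiHomD(2)[of "g (Inr y)" XiPoint Z "delta ([], 0)"] bspec[OF g InrI[OF that]] by (simp add: Fmod_gen)
    obtain h where h: "h \<in> XiHom A Z" "\<And>x. x \<in> fst A \<Longrightarrow> fst h (nca_gen x) = fst (g (Inl x)) (nca_gen 0)"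
        "\<And>y. y \<in> snd A \<Longrightarrow> snd h (delta ([], y)) = snd (g (Inr y)) (delta ([], 0))"
      using XiHom_exists[of A "\<lambda>x. fst (g (Inl x)) (nca_gen 0)" Z "\<lambda>y. snd (g (Inr y)) (delta ([], 0))", OF gl gr]
      by blast
    show "\<exists>!h. h \<in> XiHom A Z \<and> (\<forall>i\<in>fst A <+> snd A. XiComp (?src i) h (emb i) = g i)"
    proof (intro ex1I[of _ h] conjI)
      show "\<forall>i\<in>fst A <+> snd A. XiComp (?src i) h (emb i) = g i" unfolding iff[OF h(1) g] by (simp add: h)
      fix h' assume "h' \<in> XiHom A Z \<and> (\<forall>i\<in>fst A <+> snd A. XiComp (?src i) h' (emb i) = g i)"
      then have h': "h' \<in> XiHom A Z" "\<forall>i\<in>fst A <+> snd A. XiComp (?src i) h' (emb i) = g i" by blast+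
      from h'(2) have eq: "(\<forall>x\<in>fst A. fst h' (nca_gen x) = fst (g (Inl x)) (nca_gen 0)) \<and>
          (\<forall>y\<in>snd A. snd h' (delta ([], y)) = snd (g (Inr y)) (delta ([], 0)))"
        unfolding iff[OF h'(1) g] .
      show "h' = h" by (rule XiHom_eqI[OF h'(1) h(1)]) (use eq h(2,3) in simp_all)
    qed (rule h)
  qed (rule emb1)
  then show ?thesis by blast
qed

text \<open>In the next lemma Z is an object such that Hom(A,Z) is a vector space with coordinates indexed by the
  generators of A and precomposition is linear; Hom(_,Z) turns coproducts into products, so
  dimensions add up.\<close>

lemma coprod_card:
  fixes coef :: "'k::field rmor \<Rightarrow> nat \<Rightarrow> 'k" and emb :: "'i \<Rightarrow> 'k rmor"
  assumes cp: "coprod XiObj XiHom XiComp A I src emb" and fin: "finite I" and A: "A \<in> XiObj"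
    and src: "\<And>i. i \<in> I \<Longrightarrow> src i \<in> XiObj" and Z: "Z \<in> XiObj"
    and gens: "\<And>A. A \<in> XiObj \<Longrightarrow> finite (gens A)"
    and ex: "\<And>A c. A \<in> XiObj \<Longrightarrow> \<exists>h\<in>XiHom A Z. \<forall>v\<in>gens A. coef h v = c v"
    and uniq: "\<And>A h h'. A \<in> XiObj \<Longrightarrow> h \<in> XiHom A Z \<Longrightarrow> h' \<in> XiHom A Z \<Longrightarrow> \<forall>v\<in>gens A. coef h v = coef h' v \<Longrightarrow> h = h'"
    and lin: "\<And>A B f h u. A \<in> XiObj \<Longrightarrow> B \<in> XiObj \<Longrightarrow> f \<in> XiHom A B \<Longrightarrow> h \<in> XiHom B Z \<Longrightarrow> u \<in> gens A \<Longrightarrow>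
      coef (XiComp A h f) u = (\<Sum>v\<in>gens B. coef h v * mat f v u)"
  shows "card (gens A) = (\<Sum>i\<in>I. card (gens (src i)))"
proof -
  let ?S = "Sigma I (\<lambda>i. gens (src i))"
  \<comment> \<open>Matrix of the map from Hom(A,Z) to the product of the Hom(src i, Z) given by
    precomposing with the injections.\<close>
  define m where "m = (\<lambda>v (i, u). mat (emb i) v u)"
  have emb: "emb i \<in> XiHom (src i) A" if "i \<in> I" for i using cp that by (simp add: coprod_def)
  have univ: "\<exists>!h. h \<in> XiHom A Z \<and> (\<forall>i\<in>I. XiComp (src i) h (emb i) = g i)"
    if "\<And>i. i \<in> I \<Longrightarrow> g i \<in> XiHom (src i) Z" for g
    using cp Z that by (simp add: coprod_def)
  have "card (gens A) = card ?S"
  proof (rule card_eq_if_bijective_system[where m = m])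
    show "finite (gens A)" "finite ?S" using gens A src fin by auto
  next
    fix c :: "nat \<Rightarrow> 'k" assume c: "\<forall>s\<in>?S. (\<Sum>v\<in>gens A. c v * m v s) = 0"
    obtain h where h: "h \<in> XiHom A Z" "\<forall>v\<in>gens A. coef h v = c v" using ex[OF A] by blast
    obtain h0 where h0: "h0 \<in> XiHom A Z" "\<forall>v\<in>gens A. coef h0 v = 0" using ex[OF A, of "\<lambda>_. 0"] by blast
    have eq: "XiComp (src i) h (emb i) = XiComp (src i) h0 (emb i)" if i: "i \<in> I" for i
    proof (rule uniq[OF src[OF i]])
      show "\<forall>u\<in>gens (src i). coef (XiComp (src i) h (emb i)) u = coef (XiComp (src i) h0 (emb i)) u"
        using c i h h0 lin[OF src[OF i] A emb[OF i]] by (auto simp: m_def)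
    qed (rule XiComp_XiHom[OF emb[OF i]], rule h h0)+
    \<comment> \<open>Uniqueness of the mediating morphism gives a trivial kernel; \<open>h0\<close>
      stands for the zero vector.\<close>
    have "\<exists>!h. h \<in> XiHom A Z \<and> (\<forall>i\<in>I. XiComp (src i) h (emb i) = XiComp (src i) h0 (emb i))"
      by (rule univ) (rule XiComp_XiHom[OF emb h0(1)])
    then have "h = h0" using h(1) h0(1) eq by (elim ex1E) metis
    then show "\<forall>v\<in>gens A. c v = 0" using h h0 by simp
  next
    fix d :: "'i \<times> nat \<Rightarrow> 'k"
    have "\<forall>i\<in>I. \<exists>g. g \<in> XiHom (src i) Z \<and> (\<forall>u\<in>gens (src i). coef g u = d (i, u))"
    proof
      fix i assume "i \<in> I"
      from ex[OF src[OF this], of "\<lambda>u. d (i, u)"]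
      show "\<exists>g. g \<in> XiHom (src i) Z \<and> (\<forall>u\<in>gens (src i). coef g u = d (i, u))" by blast
    qed
    from bchoice[OF this] obtain g where g: "\<And>i. i \<in> I \<Longrightarrow> g i \<in> XiHom (src i) Z"
      "\<And>i u. i \<in> I \<Longrightarrow> u \<in> gens (src i) \<Longrightarrow> coef (g i) u = d (i, u)" by auto
    \<comment> \<open>Existence of the mediating morphism gives solvability for every right-hand
      side.\<close>
    have "\<exists>!h. h \<in> XiHom A Z \<and> (\<forall>i\<in>I. XiComp (src i) h (emb i) = g i)" by (rule univ[OF g(1)])
    from ex1_implies_ex[OF this] obtain h where
      h: "h \<in> XiHom A Z" "\<forall>i\<in>I. XiComp (src i) h (emb i) = g i" by blast
    show "\<exists>c. \<forall>s\<in>?S. (\<Sum>v\<in>gens A. c v * m v s) = d s"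
    proof (intro exI[of _ "coef h"] ballI)
      fix s assume "s \<in> ?S"
      then obtain i u where s: "s = (i, u)" "i \<in> I" "u \<in> gens (src i)" by blast
      then show "(\<Sum>v\<in>gens A. coef h v * m v s) = d s"
        using lin[OF src[OF s(2)] A emb[OF s(2)] h(1) s(3)] h(2) g(2)[OF s(2,3)] by (simp add: m_def)
    qed
  qed
  also have "\<dots> = (\<Sum>i\<in>I. card (gens (src i)))"
    using fin gens src by (simp add: card_SigmaI)
  finally show ?thesis .
qed

section \<open>Counting the generators of each sort\<close>

lemma lie_gen_line:
  assumes "f \<in> lie_gen {0}"
  obtains c where "f = nca_sc c (nca_gen 0)"
proof -
  have "\<exists>c. f = nca_sc c (nca_gen 0)" using assms
  proof (induction f rule: lie_gen.induct)
    case (gen x)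
    then show ?case by (intro exI[of _ 1]) simp
  next
    case zero
    show ?case by (intro exI[of _ 0]) simp
  next
    case (add f g)
    then show ?case by (auto simp: fn.scale_left_distrib[symmetric])
  next
    case (sc f c)
    then show ?case by auto
  next
    case (br f g)
    then obtain a b where "f = nca_sc a (nca_gen 0)" "g = nca_sc b (nca_gen 0)" by blast
    then have "nca_comm f g = 0" by (simp add: nca_comm_sc_left nca_comm_sc_right) (simp add: nca_comm_def)
    then show ?case by (intro exI[of _ 0]) simp
  qed
  with that show ?thesis by blast
qed

lemma lie_gen_empty: "f \<in> lie_gen {} \<Longrightarrow> f = 0"
  by (induction f rule: lie_gen.induct) (simp_all add: nca_comm_zero)

lemma Fmod_empty: "m \<in> Fmod X {} \<Longrightarrow> m = 0"
  by (auto simp: Fmod_def fun_eq_iff fun_applys)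

lemma Fmod_point: "m \<in> Fmod {} {0} \<Longrightarrow> m = nca_sc (m ([], 0)) (delta ([], 0))"
  by (force simp: Fmod_def fun_eq_iff fun_applys delta_def)

text \<open>The target is an abelian Lie algebra, so \<open>h\<close> sees only the linear part of a
  Lie polynomial.\<close>

lemma XiHom_line_coef:
  assumes h: "h \<in> XiHom B XiLine" and fin: "finite (fst B)" and f: "f \<in> lie_gen (fst B)"
  shows "fst h f [0] = (\<Sum>v\<in>fst B. fst h (nca_gen v) [0] * f [v])"
  using f
proof (induction f rule: lie_gen.induct)
  case (gen x)
  have "(\<Sum>v\<in>fst B. fst h (nca_gen v) [0] * nca_gen x [v]) =
      (\<Sum>v\<in>fst B. if v = x then fst h (nca_gen v) [0] else 0)"
    by (intro sum.cong) (auto simp: nca_gen_def)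
  then show ?case using fin gen by simp
next
  case zero
  show ?case unfolding XiHom_zero[OF h] by (simp add: fun_applys)
next
  case (add f g)
  then show ?case unfolding XiHomD(3)[OF h add.hyps] by (simp add: fun_applys algebra_simps sum.distrib)
next
  case (sc f c)
  then show ?case unfolding XiHomD(4)[OF h sc.hyps] by (simp add: fun_applys algebra_simps sum_distrib_left)
next
  case (br f g)
  \<comment> \<open>Degree-one terms cancel in a commutator; this makes both sides zero, once for
    the image in the target and once for the argument.\<close>
  have comm1: "nca_comm f g [v] = 0" for f g :: "'a nca" and v
    by (simp add: nca_comm_def fun_applys nca_mul_Cons nca_mul_Nil lshift_def)
  then show ?case using br by (simp add: XiHomD[OF h])
qed

text \<open>The target has zero Lie algebra, so words of positive length are sent to 0 and only
  coefficients at the empty word remain.\<close>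

lemma XiHom_point_coef:
  fixes h :: "'k::field rmor"
  assumes h: "h \<in> XiHom B XiPoint" and fin: "finite (snd B)" and m: "m \<in> Fmod (fst B) (snd B)"
  shows "snd h m ([], 0) = (\<Sum>y\<in>snd B. snd h (delta ([], y)) ([], 0) * m ([], y))"
  using m
proof (induction m rule: Fmod_induct)
  case (gen x)
  have "(\<Sum>v\<in>snd B. snd h (delta ([], v)) ([], 0) * (delta ([], x) :: 'k ncm) ([], v)) =
      (\<Sum>v\<in>snd B. if v = x then snd h (delta ([], v)) ([], 0) else 0)"
    by (intro sum.cong) (auto simp: delta_def)
  then show ?case using fin gen by simp
next
  case zero
  show ?case unfolding XiHom_zero[OF h] by (simp add: fun_applys)
next
  case (act x m)
  have "fst h (nca_gen x) = 0" using XiHomD(1)[OF h, of "nca_gen x"] act by (auto intro: lie_gen.gen lie_gen_empty)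
  moreover have "nca_act (nca_gen x) m ([], y) = 0" for y
    by (simp add: nca_act_mul nca_mul_Nil nca_gen_def)
  ultimately show ?case using act by (simp add: XiHomD[OF h] lie_gen.gen nca_act_zero fun_applys)
next
  case (add m n)
  then show ?case unfolding XiHomD(6)[OF h add.hyps] by (simp add: fun_applys algebra_simps sum.distrib)
next
  case (sc c m)
  then show ?case unfolding XiHomD(7)[OF h sc.hyps] by (simp add: fun_applys algebra_simps sum_distrib_left)
qed

text \<open>Into \<open>XiLine\<close> the module generators can only go to 0, into
  \<open>XiPoint\<close> the Lie generators; so each target counts one sort.\<close>

lemma coprod_card_Xi:
  fixes emb :: "'i \<Rightarrow> 'k::field_char_0 rmor"
  assumes cp: "coprod XiObj XiHom XiComp A I src emb" and fin: "finite I" and A: "A \<in> XiObj"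
    and src: "\<And>i. i \<in> I \<Longrightarrow> src i \<in> XiObj"
  shows "card (fst A) = (\<Sum>i\<in>I. card (fst (src i)))" "card (snd A) = (\<Sum>i\<in>I. card (snd (src i)))"
proof -
  have obj: "finite (fst B)" "finite (snd B)" if "B \<in> XiObj" for B using that by (auto simp: XiObj_def)
  show "card (fst A) = (\<Sum>i\<in>I. card (fst (src i)))"
  proof (rule coprod_card[OF cp fin A src, where Z = XiLine and gens = fst and
        coef = "\<lambda>h v. fst h (nca_gen v) [0]" and mat = "\<lambda>f v u. fst f (nca_gen u) [v]"])
    fix B and c :: "nat \<Rightarrow> 'k"
    obtain h where "h \<in> XiHom B XiLine" "\<And>x. x \<in> fst B \<Longrightarrow> fst h (nca_gen x) = nca_sc (c x) (nca_gen 0)"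
      by (rule XiHom_exists[of B "\<lambda>x. nca_sc (c x) (nca_gen 0)" XiLine "\<lambda>_. 0"])
        (auto intro: lie_gen.gen lie_gen.sc Fmod_zero)
    then show "\<exists>h\<in>XiHom B XiLine. \<forall>v\<in>fst B. fst h (nca_gen v) [0] = c v"
      by (intro bexI[of _ h]) (auto simp: nca_sc_apply nca_gen_def)
  next
    fix B and h h' :: "'k rmor"
    assume h: "h \<in> XiHom B XiLine" "h' \<in> XiHom B XiLine" "\<forall>v\<in>fst B. fst h (nca_gen v) [0] = fst h' (nca_gen v) [0]"
    show "h = h'"
    proof (rule XiHom_eqI[OF h(1,2)])
      fix x assume x: "x \<in> fst B"
      show "fst h (nca_gen x) = fst h' (nca_gen x)"
      proof -
        have "fst h (nca_gen x) \<in> lie_gen {0}" "fst h' (nca_gen x) \<in> lie_gen {0}"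
          using XiHomD(1)[OF h(1) lie_gen.gen[OF x]] XiHomD(1)[OF h(2) lie_gen.gen[OF x]] by simp_all
        then obtain c c' where "fst h (nca_gen x) = nca_sc c (nca_gen 0)" "fst h' (nca_gen x) = nca_sc c' (nca_gen 0)"
          by (elim lie_gen_line)
        then show ?thesis using h(3) x by (auto simp: nca_sc_apply nca_gen_def)
      qed
    next
      fix y assume "y \<in> snd B"
      then show "snd h (delta ([], y)) = snd h' (delta ([], y))"
        using XiHomD(2)[OF h(1) Fmod_gen, of y] XiHomD(2)[OF h(2) Fmod_gen, of y] by (auto dest!: Fmod_empty)
    qed
  next
    fix B C and f h :: "'k rmor" and u
    assume "C \<in> XiObj" and f: "f \<in> XiHom B C" and h: "h \<in> XiHom C XiLine" and u: "u \<in> fst B"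
    then show "fst (XiComp B h f) (nca_gen u) [0] = (\<Sum>v\<in>fst C. fst h (nca_gen v) [0] * fst f (nca_gen u) [v])"
      using XiHom_line_coef[OF h _ XiHomD(1)[OF f]] obj by (simp add: XiComp_apply lie_gen.gen)
  qed (auto simp: obj, auto simp: XiObj_def)
  show "card (snd A) = (\<Sum>i\<in>I. card (snd (src i)))"
  proof (rule coprod_card[OF cp fin A src, where Z = XiPoint and gens = snd and
        coef = "\<lambda>h v. snd h (delta ([], v)) ([], 0)" and mat = "\<lambda>f v u. snd f (delta ([], u)) ([], v)"])
    fix B and c :: "nat \<Rightarrow> 'k"
    obtain h where "h \<in> XiHom B XiPoint" "\<And>y. y \<in> snd B \<Longrightarrow> snd h (delta ([], y)) = nca_sc (c y) (delta ([], 0))"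
      by (rule XiHom_exists[of B "\<lambda>_. 0" XiPoint "\<lambda>y. nca_sc (c y) (delta ([], 0))"])
        (auto intro: lie_gen.zero Fmod_sc Fmod_gen)
    then show "\<exists>h\<in>XiHom B XiPoint. \<forall>v\<in>snd B. snd h (delta ([], v)) ([], 0) = c v"
      by (intro bexI[of _ h]) (auto simp: nca_sc_apply delta_def)
  next
    fix B and h h' :: "'k rmor"
    assume h: "h \<in> XiHom B XiPoint" "h' \<in> XiHom B XiPoint"
      "\<forall>v\<in>snd B. snd h (delta ([], v)) ([], 0) = snd h' (delta ([], v)) ([], 0)"
    show "h = h'"
    proof (rule XiHom_eqI[OF h(1,2)])
      fix x assume "x \<in> fst B"
      then show "fst h (nca_gen x) = fst h' (nca_gen x)"
        using XiHomD(1)[OF h(1) lie_gen.gen, of x] XiHomD(1)[OF h(2) lie_gen.gen, of x] by (auto dest!: lie_gen_empty)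
    next
      fix y assume y: "y \<in> snd B"
      have "snd h (delta ([], y)) \<in> Fmod {} {0}" "snd h' (delta ([], y)) \<in> Fmod {} {0}"
        using XiHomD(2)[OF h(1) Fmod_gen[OF y]] XiHomD(2)[OF h(2) Fmod_gen[OF y]] by simp_all
      from this[THEN Fmod_point] show "snd h (delta ([], y)) = snd h' (delta ([], y))"
        using h(3) y by metis
    qed
  next
    fix B C and f h :: "'k rmor" and u
    assume "C \<in> XiObj" and f: "f \<in> XiHom B C" and h: "h \<in> XiHom C XiPoint" and u: "u \<in> snd B"
    then show "snd (XiComp B h f) (delta ([], u)) ([], 0) =
        (\<Sum>v\<in>snd C. snd h (delta ([], v)) ([], 0) * snd f (delta ([], u)) ([], v))"
      using XiHom_point_coef[OF h _ XiHomD(2)[OF f]] obj by (simp add: XiComp_apply Fmod_gen)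
  qed (auto simp: obj, auto simp: XiObj_def)
qed

text \<open>The decomposition of \<open>A\<close> is carried to one of \<open>\<Phi>o A\<close> into
  images of the two basic summands, and ranks add up over it.\<close>

lemma aut_Xi_rank:
  assumes aut: "cat_aut XiObj (XiHom :: _ \<Rightarrow> _ \<Rightarrow> 'k::field_char_0 rmor set) XiComp XiId \<Phi>o \<Phi>m"
    and A: "A \<in> XiObj"
  shows "card (fst (\<Phi>o A)) = card (fst A) * card (fst (\<Phi>o XiLine)) + card (snd A) * card (fst (\<Phi>o XiPoint))"
    "card (snd (\<Phi>o A)) = card (fst A) * card (snd (\<Phi>o XiLine)) + card (snd A) * card (snd (\<Phi>o XiPoint))"
proof -
  let ?src = "case_sum (\<lambda>_. XiLine) (\<lambda>_. XiPoint)" and ?I = "fst A <+> snd A"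
  have fin: "finite (fst A)" "finite (snd A)" using A by (auto simp: XiObj_def)
  have src: "?src i \<in> XiObj" for i :: "nat + nat" by (cases i) (auto simp: XiObj_def)
  obtain emb :: "nat + nat \<Rightarrow> 'k rmor" where cp: "coprod XiObj XiHom XiComp A ?I ?src emb"
    using XiObj_coprod by blast
  have \<Phi>: "\<Phi>o B \<in> XiObj" if "B \<in> XiObj" for B using aut that by (auto simp: cat_aut_def bij_betw_def)
  note c = coprod_card_Xi[OF cat_aut_coprod[OF aut XiComp_XiHom A src cp] _ \<Phi>[OF A] \<Phi>[OF src]]
  show "card (fst (\<Phi>o A)) = card (fst A) * card (fst (\<Phi>o XiLine)) + card (snd A) * card (fst (\<Phi>o XiPoint))"
    using c(1) fin by (simp add: sum.Plus)
  show "card (snd (\<Phi>o A)) = card (fst A) * card (snd (\<Phi>o XiLine)) + card (snd A) * card (snd (\<Phi>o XiPoint))"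
    using c(2) fin by (simp add: sum.Plus)
qed

lemma aut_Xi_diagonal:
  assumes aut: "cat_aut XiObj (XiHom :: _ \<Rightarrow> _ \<Rightarrow> 'k::field_char_0 rmor set) XiComp XiId \<Phi>o \<Phi>m"
    and M: "finite M"
  shows "card (fst (\<Phi>o (M, M))) = card M" "card (snd (\<Phi>o (M, M))) = card M"
proof -
  define a b c d where defs: "a = card (fst (\<Phi>o XiLine))" "b = card (snd (\<Phi>o XiLine))"
    "c = card (fst (\<Phi>o XiPoint))" "d = card (snd (\<Phi>o XiPoint))"
  have surj: "\<Phi>o ` XiObj = XiObj" using aut by (simp add: cat_aut_def bij_betw_def)
  have "XiLine \<in> \<Phi>o ` XiObj" "XiPoint \<in> \<Phi>o ` XiObj" unfolding surj by (auto simp: XiObj_def)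
  \<comment> \<open>Preimages of the two basic summands; their ranks are the rows of the inverse
    matrix.\<close>
  then obtain A B where AB: "A \<in> XiObj" "\<Phi>o A = XiLine" "B \<in> XiObj" "\<Phi>o B = XiPoint" by auto
  define n m p q where defs': "n = card (fst A)" "m = card (snd A)" "p = card (fst B)" "q = card (snd B)"
  have e: "n * a + m * c = 1" "n * b + m * d = 0" "p * a + q * c = 0" "p * b + q * d = 1"
    using aut_Xi_rank[OF aut AB(1)] aut_Xi_rank[OF aut AB(3)] unfolding AB defs[symmetric] defs'[symmetric] by simp_all
  \<comment> \<open>Column sums 1 hold for the identity (first case) and for the swap (second case),
    and they suffice on the diagonal.\<close>
  have "a + c = 1 \<and> b + d = 1"
  proof (cases "m * c = 0")
    case True
    then have "n = 1" "a = 1" using e(1) by auto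
    then show ?thesis using e True by auto
  next
    case False
    then have "m * c = 1" "n * a = 0" using e(1) by linarith+
    then have "m = 1" "c = 1" by auto
    then show ?thesis using e \<open>n * a = 0\<close> by auto
  qed
  moreover have "(M, M) \<in> XiObj" using M by (simp add: XiObj_def)
  ultimately show "card (fst (\<Phi>o (M, M))) = card M" "card (snd (\<Phi>o (M, M))) = card M"
    using aut_Xi_rank[OF aut, of "(M, M)"] unfolding defs[symmetric]
    by (simp_all add: distrib_left[symmetric])
qed

section \<open>Transport along the equivalence\<close>

lemma ex_pres:
  assumes "finite M" "A \<in> XiObj" "card (fst A) = card M" "card (snd A) = card M"
  shows "\<exists>\<theta> :: 'k::field_char_0 tm set \<Rightarrow> 'k nca \<times> 'k ncm. pres M A \<theta>"
proof -
  have "finite (fst A)" "finite (snd A)" using assms(2) by (auto simp: XiObj_def)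
  then obtain \<sigma> \<tau> where "bij_betw \<sigma> M (fst A)" "bij_betw \<tau> M (snd A)"
    using finite_same_card_bij assms by metis
  then show ?thesis unfolding pres_def by (rule ex_pdl_iso)
qed

theorem theorem6:
  fixes H1 :: "('k::field_char_0, 'l1, 'v1) rep" and H2 :: "('k, 'l2, 'v2) rep"
  assumes "is_rep H1" and "is_rep H2" and "rep_aut_equiv H1 H2"
  shows "pdl_aut_equiv (calF H1) (calF H2)"
proof -
  from assms(3) obtain \<Phi>o and \<Phi>m :: "_ \<Rightarrow> _ \<Rightarrow> 'k rmor \<Rightarrow> 'k rmor" and \<alpha> where
    aut: "cat_aut XiObj XiHom XiComp XiId \<Phi>o \<Phi>m"
    and \<alpha>: "\<forall>A\<in>XiObj. bij_betw (\<alpha> A) (rep_Cl H1 A) (rep_Cl H2 (\<Phi>o A))"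
    and beta: "\<forall>A\<in>XiObj. \<forall>B\<in>XiObj. \<forall>T\<in>rep_Cl H1 B.
      (\<lambda>(f, g). (\<Phi>m A B f, \<Phi>m A B g)) ` rep_beta A B T = rep_beta (\<Phi>o A) (\<Phi>o B) (\<alpha> B T)"
    unfolding rep_aut_equiv_def aut_equiv_def by (elim exE conjE)
  define D :: "nat set \<Rightarrow> nat set \<times> nat set" where "D = (\<lambda>M. (M, M))"
  \<comment> \<open>\<open>E M\<close> has the ranks of \<open>D M\<close>, but its generator sets
    may differ from \<open>M\<close>.\<close>
  define E where "E = (\<lambda>M. \<Phi>o (D M))"
  have D: "D M \<in> XiObj" if "M \<in> ThObj" for M using that by (simp add: D_def XiObj_def ThObj_def)
  have E: "E M \<in> XiObj" if "M \<in> ThObj" for M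
    using aut D[OF that] unfolding E_def cat_aut_def by (blast dest: bij_betwE)
  have "\<forall>M\<in>ThObj. \<exists>\<theta> :: 'k tm set \<Rightarrow> 'k nca \<times> 'k ncm. pres M (D M) \<theta>"
  proof
    fix M :: "nat set" assume M: "M \<in> ThObj"
    then show "\<exists>\<theta> :: 'k tm set \<Rightarrow> 'k nca \<times> 'k ncm. pres M (D M) \<theta>"
      by (intro ex_pres D) (simp_all add: ThObj_def D_def)
  qed
  from bchoice[OF this] obtain \<theta> :: "nat set \<Rightarrow> 'k tm set \<Rightarrow> 'k nca \<times> 'k ncm" where
    \<theta>: "\<And>M. M \<in> ThObj \<Longrightarrow> pres M (D M) (\<theta> M)" by blast
  have "\<forall>M\<in>ThObj. \<exists>\<theta> :: 'k tm set \<Rightarrow> 'k nca \<times> 'k ncm. pres M (E M) \<theta>"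
  proof
    fix M :: "nat set" assume M: "M \<in> ThObj"
    then have "finite M" by (simp add: ThObj_def)
    then show "\<exists>\<theta> :: 'k tm set \<Rightarrow> 'k nca \<times> 'k ncm. pres M (E M) \<theta>"
      using ex_pres[OF _ E[OF M]] aut_Xi_diagonal[OF aut] unfolding E_def D_def by blast
  qed
  from bchoice[OF this] obtain \<eta> :: "nat set \<Rightarrow> 'k tm set \<Rightarrow> 'k nca \<times> 'k ncm" where
    \<eta>: "\<And>M. M \<in> ThObj \<Longrightarrow> pres M (E M) (\<eta> M)" by blast
  \<comment> \<open>The two presentations identify morphisms of free algebras with morphisms of
    representations: \<open>J\<close> before the automorphism is applied, \<open>J'\<close> after
    it. \<open>\<Psi>\<close> and \<open>\<alpha>'\<close> go back along the first, through the
    given data, and out along the second.\<close>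
  define J where "J = (\<lambda>M N. transport M (\<theta> M) N (\<theta> N))"
  define J' where "J' = (\<lambda>M N. transport M (\<eta> M) N (\<eta> N))"
  define G where "G = (\<lambda>M N. inv_into (XiHom (D M) (D N)) (J M N))"
  define \<Psi> where "\<Psi> = (\<lambda>M N F. J' M N (\<Phi>m (D M) (D N) (G M N F)))"
  define Q where "Q = (\<lambda>M. inv_into (rep_Cl H1 (D M)) (pull M (\<theta> M)))"
  define \<alpha>' where "\<alpha>' = (\<lambda>M S. pull M (\<eta> M) (\<alpha> (D M) (Q M S)))"
  have \<Phi>bij: "bij_betw (\<Phi>m A B) (XiHom A B) (XiHom (\<Phi>o A) (\<Phi>o B))" if "A \<in> XiObj" "B \<in> XiObj" for A B
    using aut that by (simp add: cat_aut_def)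
  have \<Phi>comp: "\<Phi>m A C (XiComp A g f) = XiComp (\<Phi>o A) (\<Phi>m B C g) (\<Phi>m A B f)"
    if "A \<in> XiObj" "B \<in> XiObj" "C \<in> XiObj" "f \<in> XiHom A B" "g \<in> XiHom B C" for A B C f g
    using aut that by (simp add: cat_aut_def)
  have \<Phi>id: "\<Phi>m A A (XiId A) = XiId (\<Phi>o A)" if "A \<in> XiObj" for A using aut that by (simp add: cat_aut_def)
  have J: "bij_betw (J M N) (XiHom (D M) (D N)) (ThHom M N)" if "M \<in> ThObj" "N \<in> ThObj" for M N
    unfolding J_def by (rule bij_transfer[OF \<theta>[OF that(1)] \<theta>[OF that(2)]])
  have J': "bij_betw (J' M N) (XiHom (E M) (E N)) (ThHom M N)" if "M \<in> ThObj" "N \<in> ThObj" for M N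
    unfolding J'_def by (rule bij_transfer[OF \<eta>[OF that(1)] \<eta>[OF that(2)]])
  have GJ: "G M N (J M N f) = f" if "M \<in> ThObj" "N \<in> ThObj" "f \<in> XiHom (D M) (D N)" for M N f
    unfolding G_def using bij_betw_imp_inj_on[OF J[OF that(1,2)]] that(3) by simp
  \<comment> \<open>Working form of \<open>\<Psi>\<close>: every morphism of free algebras is some
    \<open>J M N f\<close>, so the functor laws are checked on these.\<close>
  have \<Psi>J: "\<Psi> M N (J M N f) = J' M N (\<Phi>m (D M) (D N) f)"
    if "M \<in> ThObj" "N \<in> ThObj" "f \<in> XiHom (D M) (D N)" for M N f
    by (simp add: \<Psi>_def GJ[OF that])
  have \<Phi>E: "\<Phi>m (D M) (D N) f \<in> XiHom (E M) (E N)"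
    if "M \<in> ThObj" "N \<in> ThObj" "f \<in> XiHom (D M) (D N)" for M N f
    using bij_betwE[OF \<Phi>bij[OF D[OF that(1)] D[OF that(2)]]] that(3) by (simp add: E_def)
  have J_cases: "\<exists>f\<in>XiHom (D M) (D N). F = J M N f" if "M \<in> ThObj" "N \<in> ThObj" "F \<in> ThHom M N" for M N F
    using bij_betw_imp_surj_on[OF J[OF that(1,2)]] that(3) by blast
  \<comment> \<open>The identity on objects is possible because F(M) is presented by
    \<open>D M\<close> and by \<open>E M\<close> alike.\<close>
  have "cat_aut ThObj (ThHom :: _ \<Rightarrow> _ \<Rightarrow> 'k tmor set) ThComp ThId id \<Psi>"
    unfolding cat_aut_def
  proof (intro conjI ballI)
    show "bij_betw id ThObj ThObj" by simp
  next
    fix M N assume MN: "M \<in> ThObj" "N \<in> ThObj"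
    have "bij_betw (G M N) (ThHom M N) (XiHom (D M) (D N))"
      unfolding G_def by (rule bij_betw_inv_into[OF J[OF MN]])
    from bij_betw_trans[OF bij_betw_trans[OF this \<Phi>bij[OF D[OF MN(1)] D[OF MN(2)]]] J'[OF MN, unfolded E_def]]
    show "bij_betw (\<Psi> M N) (ThHom M N) (ThHom (id M) (id N))"
      by (simp add: \<Psi>_def comp_def)
  next
    fix M N K and F F' :: "'k tmor"
    assume M: "M \<in> ThObj" and N: "N \<in> ThObj" and K: "K \<in> ThObj" and "F \<in> ThHom M N" "F' \<in> ThHom N K"
    then obtain f f' where f: "f \<in> XiHom (D M) (D N)" "F = J M N f" and f': "f' \<in> XiHom (D N) (D K)" "F' = J N K f'"
      using J_cases by meson
    have "ThComp M F' F = J M K (XiComp (D M) f' f)"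
      unfolding f(2) f'(2) J_def by (rule transport_comp[OF \<theta>[OF M] \<theta>[OF N] \<theta>[OF K] f(1) f'(1), symmetric])
    then have "\<Psi> M K (ThComp M F' F) = J' M K (XiComp (E M) (\<Phi>m (D N) (D K) f') (\<Phi>m (D M) (D N) f))"
      using \<Psi>J[OF M K XiComp_XiHom[OF f(1) f'(1)]] \<Phi>comp[OF D[OF M] D[OF N] D[OF K] f(1) f'(1)] by (simp add: E_def)
    also have "\<dots> = ThComp M (J' N K (\<Phi>m (D N) (D K) f')) (J' M N (\<Phi>m (D M) (D N) f))"
      unfolding J'_def by (rule transport_comp[OF \<eta>[OF M] \<eta>[OF N] \<eta>[OF K] \<Phi>E[OF M N f(1)] \<Phi>E[OF N K f'(1)]])
    finally show "\<Psi> M K (ThComp M F' F) = ThComp (id M) (\<Psi> N K F') (\<Psi> M N F)"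
      by (simp add: f(2) f'(2) \<Psi>J[OF M N f(1)] \<Psi>J[OF N K f'(1)])
  next
    fix M assume M: "M \<in> ThObj"
    have "ThId M = J M M (XiId (D M))" unfolding J_def by (rule transport_id[OF \<theta>[OF M], symmetric])
    then have "\<Psi> M M (ThId M) = J' M M (XiId (E M))"
      using \<Psi>J[OF M M XiId_XiHom] \<Phi>id[OF D[OF M]] by (simp add: E_def)
    also have "\<dots> = ThId M" unfolding J'_def by (rule transport_id[OF \<eta>[OF M]])
    finally show "\<Psi> M M (ThId M) = ThId (id M)" by simp
  qed
  moreover have "bij_betw (\<alpha>' M) (pdl_Cl (calF H1) M) (pdl_Cl (calF H2) (id M))" if M: "M \<in> ThObj" for M
  proof -
    have "bij_betw (Q M) (pdl_Cl (calF H1) M) (rep_Cl H1 (D M))"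
      unfolding Q_def by (rule bij_betw_inv_into[OF bij_pull[OF \<theta>[OF M] assms(1)]])
    moreover have "bij_betw (\<alpha> (D M)) (rep_Cl H1 (D M)) (rep_Cl H2 (E M))"
      using \<alpha> D[OF M] by (simp add: E_def)
    moreover have "bij_betw (pull M (\<eta> M)) (rep_Cl H2 (E M)) (pdl_Cl (calF H2) M)"
      by (rule bij_pull[OF \<eta>[OF M] assms(2)])
    ultimately show ?thesis
      using bij_betw_trans[OF bij_betw_trans] by (fastforce simp: \<alpha>'_def comp_def)
  qed
  moreover have "(\<lambda>(F, F'). (\<Psi> M N F, \<Psi> M N F')) ` pdl_beta M N S = pdl_beta (id M) (id N) (\<alpha>' N S)"
    if M: "M \<in> ThObj" and N: "N \<in> ThObj" and S: "S \<in> pdl_Cl (calF H1) N" for M N S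
  proof -
    note bp = bij_pull[OF \<theta>[OF N] assms(1)]
    define T where "T = Q N S"
    have "S \<in> pull N (\<theta> N) ` rep_Cl H1 (D N)" using bij_betw_imp_surj_on[OF bp] S by simp
    then have T: "T \<in> rep_Cl H1 (D N)" "pull N (\<theta> N) T = S"
      unfolding T_def Q_def by (rule inv_into_into, rule f_inv_into_f)
    \<comment> \<open>The relation takes the same route as the morphisms; in the middle stands the
      hypothesis on \<open>\<Phi>m\<close> and \<open>\<alpha>\<close>.\<close>
    have "(\<lambda>(F, F'). (\<Psi> M N F, \<Psi> M N F')) ` pdl_beta M N S =
        (\<lambda>(F, F'). (\<Psi> M N F, \<Psi> M N F')) ` (\<lambda>(f, f'). (J M N f, J M N f')) ` rep_beta (D M) (D N) T"
      unfolding J_def transport_beta[OF \<theta>[OF M] \<theta>[OF N]] T(2) ..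
    also have "\<dots> = (\<lambda>(g, g'). (J' M N g, J' M N g')) `
        (\<lambda>(f, f'). (\<Phi>m (D M) (D N) f, \<Phi>m (D M) (D N) f')) ` rep_beta (D M) (D N) T"
      unfolding image_image by (rule image_cong) (auto simp: rep_beta_def \<Psi>J[OF M N])
    also have "\<dots> = (\<lambda>(g, g'). (J' M N g, J' M N g')) ` rep_beta (E M) (E N) (\<alpha> (D N) T)"
      using beta D[OF M] D[OF N] T(1) by (simp add: E_def)
    also have "\<dots> = pdl_beta M N (\<alpha>' N S)"
      unfolding J'_def \<alpha>'_def T_def by (rule transport_beta[OF \<eta>[OF M] \<eta>[OF N]])
    finally show ?thesis by simp
  qed
  ultimately show ?thesis
    unfolding pdl_aut_equiv_def aut_equiv_def by (intro exI[of _ id] exI[of _ \<Psi>] exI[of _ \<alpha>'] conjI ballI)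
qed

end
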